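(* The following bounds hold: $$2.682918382150264832337066716763<\lambda_*<2.682918382150264832337066725454.$$ Consequently $$1.341459191075132416168533358381<C_{2,0}<1.341459191075132416168533362727.$$ In particular, $\lambda_*$ rounds to $2.6829183821502648323370667$ at $25$ decimal places.
   Context: $\lambda_*$ is the largest eigenvalue of the bounded, compact, positive self-adjoint operator $K_*$ on $L^2(0,1)$ given by $K_*f(x)=\int_0^1|x-y|^{-1/2}f(y)\,dy$, and $C_{2,0}=\lambda_*/2$. *)

theory Defs
  imports "HOL-Analysis.Analysis"
begin

abbreviation M01 :: "real measure" where
  "M01 \<equiv> restrict_space lborel {0<..<1}"

text \<open>
  Representatives of the elements of the real Hilbert space \<open>L\<^sup>2(0,1)\<close>. Elements of the space are
  classes modulo almost-everywhere equality, so every statement about them below is made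
  almost everywhere. Every Lebesgue measurable function is almost everywhere equal to a Borel
  measurable one, so nothing is lost by using \<^const>\<open>lborel\<close>.
\<close>
definition L2_01 :: "(real \<Rightarrow> real) set" where
  "L2_01 = {f \<in> borel_measurable M01. integrable M01 (\<lambda>x. (f x)\<^sup>2)}"

text \<open>
  For \<open>f\<close> in \<open>L\<^sup>2(0,1)\<close> the integral converges absolutely for almost every \<open>x\<close> in \<open>(0,1)\<close>; at the
  remaining points the Bochner integral returns the default value 0. The value
  \<open>0 powr (-1/2) = 0\<close> at \<open>y = x\<close> concerns a single point \<open>y\<close>.
\<close>
definition Kstar :: "(real \<Rightarrow> real) \<Rightarrow> real \<Rightarrow> real" where
  "Kstar f x = (\<integral>y. \<bar>x - y\<bar> powr (-1/2) * f y \<partial>M01)"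

definition L2_eigenvalue :: "((real \<Rightarrow> real) \<Rightarrow> real \<Rightarrow> real) \<Rightarrow> real \<Rightarrow> bool" where
  "L2_eigenvalue T l \<longleftrightarrow>
     (\<exists>f\<in>L2_01. \<not> (AE x in M01. f x = 0) \<and> (AE x in M01. T f x = l * f x))"

text \<open>
  \<^const>\<open>Greatest\<close> is a definite description: it denotes the maximum of the eigenvalues
  when this exists and is unspecified otherwise, so any bound on \<open>lambda_star\<close> depends on
  the maximum being attained.
\<close>
definition lambda_star :: real where
  "lambda_star = (GREATEST l. L2_eigenvalue Kstar l)"

definition C_2_0 :: real where
  "C_2_0 = lambda_star / 2"

end

theory Submission imports Defs
begin

text \<open>
  Let \<open>K\<close> be the operator and write \<open>K = 1 \<otimes> 1 + R\<close>. The kernel of \<open>R\<close> is nonnegative, and its row integrals are at most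
  \<open>cR = 2 sqrt 2 - 1 < 1.829\<close>, whereas the largest eigenvalue is about \<open>2.68\<close>. This gap drives the proof.

  \<^item> Existence. The Neumann series of \<open>R\<close> applied to the constant 1, with the parameter fixed by the intermediate value
    theorem, gives a bounded eigenfunction that is bounded away from zero (\<open>perron_exists\<close>). Pairing with it shows that no
    eigenvalue is larger (\<open>eigenvalue_le\<close>), so the maximum is attained.

  \<^item> Two-sided bounds from a trial function. Positivity of the eigenfunction makes the Rayleigh quotient of any bounded \<open>v\<close> a
    lower bound (\<open>rayleigh_le\<close>). The Schur bound for \<open>R\<close> on functions of mean zero gives an inequality of Temple type, in which the
    distance of the eigenvalue from the Rayleigh quotient is of the order of the squared residual (\<open>temple\<close>). Both need only the
    three moments \<open>\<langle>v, v\<rangle>\<close>, \<open>\<langle>v, K v\<rangle>\<close> and \<open>\<langle>K v, K v\<rangle>\<close>.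

  \<^item> Closed forms. For combinations of \<open>x powr (k/4) + (1 - x) powr (k/4)\<close> the moments reduce to Beta values and to one family of
    singular double integrals (\<open>norm_trial\<close>, \<open>form_trial\<close>, \<open>square_trial\<close>). A combination of 25 such terms already has a squared
    residual of relative size \<open>3 * 10 powr (-27)\<close>. The second power of \<open>K\<close> stays tractable because half-integrals compose to ordinary integrals.

  \<^item> Numbers. Beta values and singular integrals satisfy common recursions: a double integration by parts that converges like
    \<open>4 powr (-n)\<close> for the initial values, and a stable shift in one exponent for the rest. They are evaluated in integer arithmetic at
    scale \<open>4 ^ 93\<close> by rewriting. About 56 digits are needed because the coefficients of the trial function are of size \<open>10 ^ 24\<close> and
    cancel strongly, down to a norm of \<open>10 ^ 14\<close>. Rounding errors are tracked by \<open>apx\<close> and enter the moments through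
    \<open>A0_err\<close>, \<open>A1_err\<close> and \<open>A2_err\<close>.
\<close>

section \<open>The integral operator on bounded functions\<close>

definition ker :: "real \<Rightarrow> real \<Rightarrow> real" where
  "ker x y = \<bar>x - y\<bar> powr (-1/2)"

lemma ker_sym: "ker x y = ker y x"
  by (simp add: ker_def abs_minus_commute)

lemma ker_nonneg [simp]: "0 \<le> ker x y"
  by (simp add: ker_def)

lemma space_M01 [simp]: "space M01 = {0<..<1}"
  by (simp add: space_restrict_space)

lemma finite_M01: "finite_measure M01"
  by (rule finite_measureI) (simp add: emeasure_restrict_space)

interpretation M01: finite_measure M01 by (rule finite_M01)

interpretation MM: pair_sigma_finite M01 M01 by standard

lemma measure_M01 [simp]: "measure M01 {0<..<1} = 1"
  by (subst measure_restrict_space) auto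

lemma id_measurable_M01 [measurable]: "(\<lambda>x. x) \<in> borel_measurable M01"
  by (rule measurable_restrict_space1) auto

lemma borel_measurable_M01: "f \<in> borel_measurable borel \<Longrightarrow> f \<in> borel_measurable M01"
  by (rule measurable_restrict_space1) auto

lemma fst_measurable_M01 [measurable]: "fst \<in> borel_measurable (M01 \<Otimes>\<^sub>M M01)"
  by (rule measurable_compose[OF measurable_fst id_measurable_M01])

lemma snd_measurable_M01 [measurable]: "snd \<in> borel_measurable (M01 \<Otimes>\<^sub>M M01)"
  by (rule measurable_compose[OF measurable_snd id_measurable_M01])

lemma ker_measurable [measurable]: "(\<lambda>p. ker (fst p) (snd p)) \<in> borel_measurable (M01 \<Otimes>\<^sub>M M01)"
  unfolding ker_def by measurable

lemma ker_measurable_M01 [measurable]: "ker x \<in> borel_measurable M01"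
  unfolding ker_def by measurable

lemma Kstar_ker: "Kstar f x = (\<integral>y. ker x y * f y \<partial>M01)"
  by (simp add: Kstar_def ker_def)

lemma nn_integral_M01:
  assumes "f \<in> borel_measurable borel"
  shows "(\<integral>\<^sup>+x. f x \<partial>M01) = (\<integral>\<^sup>+x. f x * indicator {0<..<1} x \<partial>lborel)"
  by (rule nn_integral_restrict_space) auto

lemma nn_integral_M01_has_integral:
  assumes "\<And>x. x \<in> {0<..<1} \<Longrightarrow> 0 \<le> f x" "(f has_integral I) {0..1}"
  shows "(\<integral>\<^sup>+x. ennreal (f x) \<partial>M01) = ennreal I"
proof -
  have "(f has_integral I) {0<..<1}" using assms(2) by (simp add: has_integral_Icc_iff_Ioo)
  from nn_integral_has_integral_lebesgue'[OF assms(1) this] show ?thesis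
    by (subst nn_integral_restrict_space) auto
qed

lemma nn_integral_M01_reflect:
  assumes [measurable]: "f \<in> borel_measurable borel"
  shows "(\<integral>\<^sup>+x. f x \<partial>M01) = (\<integral>\<^sup>+x. f (1 - x) \<partial>M01)"
proof -
  have "(\<integral>\<^sup>+x. f x \<partial>M01) = (\<integral>\<^sup>+x. f x * indicator {0<..<1} x \<partial>lborel)"
    by (rule nn_integral_M01) auto
  also have "\<dots> = (\<integral>\<^sup>+x. f (1 + (-1) * x) * indicator {0<..<1} (1 + (-1) * x) \<partial>lborel)"
    by (subst nn_integral_real_affine[of _ "-1" 1]) auto
  also have "\<dots> = (\<integral>\<^sup>+x. f (1 - x) * indicator {0<..<1} x \<partial>lborel)"
    by (intro nn_integral_cong) (auto split: split_indicator)
  also have "\<dots> = (\<integral>\<^sup>+x. f (1 - x) \<partial>M01)"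
    by (rule nn_integral_M01[symmetric]) auto
  finally show ?thesis .
qed

text \<open>The substitution \<open>x = z s\<close> on \<open>(0, z)\<close>, phrased on the unit interval so that it can be applied inside
  iterated integrals over that interval.\<close>
lemma nn_integral_M01_scale:
  assumes [measurable]: "f \<in> borel_measurable borel" and z: "0 < z" "z \<le> 1"
  shows "(\<integral>\<^sup>+x. f x * indicator {..<z} x \<partial>M01) = ennreal z * (\<integral>\<^sup>+s. f (z * s) \<partial>M01)"
proof -
  have "(\<integral>\<^sup>+x. f x * indicator {..<z} x \<partial>M01)
     = (\<integral>\<^sup>+x. f x * indicator {..<z} x * indicator {0<..<1} x \<partial>lborel)"
    by (rule nn_integral_M01) auto
  also have "\<dots> = (\<integral>\<^sup>+x. f x * indicator {0<..<z} x \<partial>lborel)"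
    using z by (intro nn_integral_cong) (auto split: split_indicator)
  also have "\<dots> = ennreal z * (\<integral>\<^sup>+x. f (0 + z * x) * indicator {0<..<z} (0 + z * x) \<partial>lborel)"
    using z by (subst nn_integral_real_affine[of _ z 0]) auto
  also have "(\<integral>\<^sup>+x. f (0 + z * x) * indicator {0<..<z} (0 + z * x) \<partial>lborel)
      = (\<integral>\<^sup>+x. f (z * x) * indicator {0<..<1} x \<partial>lborel)"
    using z by (intro nn_integral_cong) (auto split: split_indicator simp: zero_less_mult_iff)
  also have "\<dots> = (\<integral>\<^sup>+x. f (z * x) \<partial>M01)"
    by (rule nn_integral_M01[symmetric]) auto
  finally show ?thesis .
qed

text \<open>The part of the power kernel that lies below the diagonal. For \<open>e = -1/2\<close> it is the kernel of a
  Riemann-Liouville half-integral, and the kernel of the operator is the sum of two such halves; all closed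
  formulas below come from treating the halves separately.\<close>
definition tk :: "real \<Rightarrow> real \<Rightarrow> real \<Rightarrow> real" where
  "tk e x y = (if y < x then (x - y) powr e else 0)"

abbreviation kerp :: "real \<Rightarrow> real \<Rightarrow> real" where "kerp \<equiv> tk (-1/2)"

lemma tk_nonneg [simp]: "0 \<le> tk e x y" by (simp add: tk_def)

lemma ker_eq_kerp: "ker x y = kerp x y + kerp y x"
  by (auto simp: ker_def tk_def)

lemma tk_reflect: "tk e (1 - x) (1 - y) = tk e y x"
  by (simp add: tk_def)

lemma tk_reflect': "tk e (1 - x) y = tk e (1 - y) x"
proof -
  have "1 - x - y = 1 - y - x" by simp
  then show ?thesis by (simp only: tk_def) auto
qed

lemma tk_measurable [measurable]: "(\<lambda>p. tk e (fst p) (snd p)) \<in> borel_measurable (borel \<Otimes>\<^sub>M borel)"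
  unfolding tk_def by measurable

lemma tk_measurable' [measurable]: "(\<lambda>p. tk e (fst p) (snd p)) \<in> borel_measurable (M01 \<Otimes>\<^sub>M M01)"
  unfolding tk_def by measurable

lemma tk_measurable1 [measurable]: "tk e x \<in> borel_measurable borel"
  unfolding tk_def by measurable

lemma tk_measurable2 [measurable]: "(\<lambda>x. tk e x y) \<in> borel_measurable borel"
  unfolding tk_def by measurable

abbreviation beta :: "real \<Rightarrow> real" where "beta a \<equiv> Beta (1/2) (a + 1)"

lemma nn_integral_Beta:
  assumes "a > -1" "b > -1"
  shows "(\<integral>\<^sup>+x. ennreal (x powr a * (1 - x) powr b) \<partial>M01) = ennreal (Beta (a + 1) (b + 1))"
  using has_integral_Beta_real[of "a + 1" "b + 1"] assms
  by (intro nn_integral_M01_has_integral) auto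

lemma Beta_half_1: "Beta (1/2) 1 = (2::real)"
proof -
  have "Gamma (1/2 + 1) = 1/2 * Gamma (1/2 :: real)" by (rule Gamma_plus1) (auto elim!: nonpos_Ints_cases)
  then have "Beta (1/2) 1 = Gamma (1/2) * 1 / (1/2 * Gamma (1/2 :: real))" by (simp only: Beta_def Gamma_1)
  then show ?thesis by (simp add: Gamma_one_half_real)
qed

text \<open>Substituting \<open>y = x s\<close> makes the integrand homogeneous in \<open>x\<close> and leaves an Euler Beta integral.\<close>
lemma nn_integral_tk_powr:
  assumes e: "e > -1" and b: "b > -1" and x: "0 < x" "x \<le> 1"
  shows "(\<integral>\<^sup>+y. ennreal (tk e x y * y powr b) \<partial>M01) = ennreal (Beta (e + 1) (b + 1) * x powr (b + e + 1))"
proof -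
  have "(\<integral>\<^sup>+y. ennreal (tk e x y * y powr b) \<partial>M01)
     = (\<integral>\<^sup>+y. ennreal ((x - y) powr e * y powr b) * indicator {..<x} y \<partial>M01)"
    by (intro nn_integral_cong) (auto simp: tk_def split: split_indicator)
  also have "\<dots> = ennreal x * (\<integral>\<^sup>+s. ennreal ((x - x * s) powr e * (x * s) powr b) \<partial>M01)"
    using x by (intro nn_integral_M01_scale) auto
  also have "(\<integral>\<^sup>+s. ennreal ((x - x * s) powr e * (x * s) powr b) \<partial>M01)
     = (\<integral>\<^sup>+s. ennreal (x powr (b + e)) * ennreal (s powr b * (1 - s) powr e) \<partial>M01)"
  proof (intro nn_integral_cong)
    fix s assume "s \<in> space M01"
    then have s: "0 < s" "s < 1" by auto
    have "x - x * s = x * (1 - s)" by (simp add: right_diff_distrib)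
    then have "(x - x * s) powr e * (x * s) powr b = (x powr b * x powr e) * (s powr b * (1 - s) powr e)"
      using s x by (simp add: powr_mult mult_ac)
    also have "x powr b * x powr e = x powr (b + e)" by (simp flip: powr_add)
    finally show "ennreal ((x - x * s) powr e * (x * s) powr b) = ennreal (x powr (b + e)) * ennreal (s powr b * (1 - s) powr e)"
      by (simp add: ennreal_mult)
  qed
  also have "\<dots> = ennreal (x powr (b + e)) * ennreal (Beta (b + 1) (e + 1))"
    using nn_integral_Beta[of b e] e b by (subst nn_integral_cmult) auto
  also have "ennreal x * \<dots> = ennreal (Beta (e + 1) (b + 1) * x powr (b + e + 1))"
  proof -
    have "x * x powr (b + e) = x powr (b + e + 1)"
      using x powr_add[of x 1 "b + e"] by (simp add: add_ac)
    moreover have "0 \<le> Beta (b + 1) (e + 1)"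
      using e b by (simp add: Beta_def Gamma_real_pos less_imp_le)
    ultimately show ?thesis using x
      by (simp add: Beta_commute[of "e + 1"] mult.assoc[symmetric] mult.commute flip: ennreal_mult'')
  qed
  finally show ?thesis .
qed

lemma nn_integral_kerp_powr:
  assumes "b > -1" "0 < x" "x \<le> 1"
  shows "(\<integral>\<^sup>+y. ennreal (kerp x y * y powr b) \<partial>M01) = ennreal (beta b * x powr (b + 1/2))"
  using nn_integral_tk_powr[of "-1/2" b x] assms by (simp add: algebra_simps)

lemma nn_integral_ker:
  assumes "0 < x" "x < 1"
  shows "(\<integral>\<^sup>+y. ennreal (ker x y) \<partial>M01) = ennreal (2 * sqrt x + 2 * sqrt (1 - x))"
proof -
  have 1: "(\<integral>\<^sup>+y. ennreal (kerp x y) \<partial>M01) = ennreal (2 * sqrt x)" if "0 < x" "x < 1" for x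
  proof -
    have "(\<integral>\<^sup>+y. ennreal (kerp x y) \<partial>M01) = (\<integral>\<^sup>+y. ennreal (kerp x y * y powr 0) \<partial>M01)"
      by (intro nn_integral_cong) auto
    also have "\<dots> = ennreal (beta 0 * x powr (1/2))"
      using nn_integral_kerp_powr[of 0 x] that by simp
    finally show ?thesis using that by (simp add: Beta_half_1 powr_half_sqrt)
  qed
  have "(\<integral>\<^sup>+y. ennreal (kerp y x) \<partial>M01) = (\<integral>\<^sup>+y. ennreal (kerp (1 - y) x) \<partial>M01)"
    by (rule nn_integral_M01_reflect) auto
  also have "\<dots> = (\<integral>\<^sup>+y. ennreal (kerp (1 - x) y) \<partial>M01)"
    by (simp add: tk_reflect'[of _ _ x])
  also have "\<dots> = ennreal (2 * sqrt (1 - x))" using 1[of "1 - x"] assms by simp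
  finally have 2: "(\<integral>\<^sup>+y. ennreal (kerp y x) \<partial>M01) = ennreal (2 * sqrt (1 - x))" .
  have "(\<integral>\<^sup>+y. ennreal (ker x y) \<partial>M01) = (\<integral>\<^sup>+y. ennreal (kerp x y) + ennreal (kerp y x) \<partial>M01)"
    by (simp add: ker_eq_kerp)
  also have "\<dots> = (\<integral>\<^sup>+y. ennreal (kerp x y) \<partial>M01) + (\<integral>\<^sup>+y. ennreal (kerp y x) \<partial>M01)"
    by (rule nn_integral_add) (auto intro!: borel_measurable_M01)
  finally show ?thesis using 1[OF assms] 2 assms by (simp flip: ennreal_plus)
qed

lemma integrable_ker: "0 < x \<Longrightarrow> x < 1 \<Longrightarrow> integrable M01 (ker x)"
  by (rule integrableI_nonneg) (auto simp: nn_integral_ker)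

lemma integral_ker: "0 < x \<Longrightarrow> x < 1 \<Longrightarrow> (\<integral>y. ker x y \<partial>M01) = 2 * sqrt x + 2 * sqrt (1 - x)"
  by (subst integral_eq_nn_integral) (auto simp: nn_integral_ker simp del: ennreal_plus)

lemma Kstar_one: "0 < x \<Longrightarrow> x < 1 \<Longrightarrow> Kstar (\<lambda>_. 1) x = 2 * sqrt x + 2 * sqrt (1 - x)"
  by (simp add: Kstar_ker integral_ker)

lemma Kstar_one_ge: assumes "0 < x" "x < 1" shows "2 \<le> Kstar (\<lambda>_. 1) x"
proof -
  have "x \<le> sqrt x" "1 - x \<le> sqrt (1 - x)" using assms by (auto simp: real_le_rsqrt power2_eq_square mult_le_cancel_left1)
  then show ?thesis using assms by (simp add: Kstar_one)
qed

lemma Kstar_one_le: assumes "0 < x" "x < 1" shows "Kstar (\<lambda>_. 1) x \<le> 2 * sqrt 2"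
proof -
  have "(sqrt x + sqrt (1 - x))\<^sup>2 \<le> (sqrt x + sqrt (1 - x))\<^sup>2 + (sqrt x - sqrt (1 - x))\<^sup>2" by simp
  also have "\<dots> = 2" using assms by (simp add: power2_sum power2_diff)
  finally have "sqrt x + sqrt (1 - x) \<le> sqrt 2" by (rule real_le_rsqrt)
  then show ?thesis using assms by (simp add: Kstar_one)
qed

named_theorems bm_intros

text \<open>Bounded measurable functions form the working space: it is invariant under the operator, contains the Perron
  function and every trial function, and makes all integrability side conditions automatic.\<close>
definition bm :: "(real \<Rightarrow> real) \<Rightarrow> bool" where
  "bm f \<longleftrightarrow> f \<in> borel_measurable M01 \<and> (\<exists>C. \<forall>x\<in>{0<..<1}. \<bar>f x\<bar> \<le> C)"

lemma bm_measurable [measurable_dest]: "bm f \<Longrightarrow> f \<in> borel_measurable M01" by (simp add: bm_def)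

lemma bmD: assumes "bm f" shows "\<exists>C\<ge>0. \<forall>x\<in>{0<..<1}. \<bar>f x\<bar> \<le> C"
proof -
  from assms obtain C where "\<forall>x\<in>{0<..<1}. \<bar>f x\<bar> \<le> C" by (auto simp: bm_def)
  then show ?thesis by (intro exI[of _ "max 0 C"]) (auto intro: order_trans[OF _ max.cobounded2])
qed

lemma bmI: "f \<in> borel_measurable M01 \<Longrightarrow> (\<And>x. 0 < x \<Longrightarrow> x < 1 \<Longrightarrow> \<bar>f x\<bar> \<le> C) \<Longrightarrow> bm f"
  unfolding bm_def by (metis greaterThanLessThan_iff)

lemma bm_const [simp, bm_intros]: "bm (\<lambda>_. c)" by (rule bmI[of _ "\<bar>c\<bar>"]) auto

lemma bm_add [bm_intros]: assumes "bm f" "bm g" shows "bm (\<lambda>x. f x + g x)"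
proof -
  obtain C where "0 \<le> C" "\<And>x. x \<in> {0<..<1} \<Longrightarrow> \<bar>f x\<bar> \<le> C" using bmD[OF assms(1)] by blast
  moreover obtain D where "0 \<le> D" "\<And>x. x \<in> {0<..<1} \<Longrightarrow> \<bar>g x\<bar> \<le> D" using bmD[OF assms(2)] by blast
  ultimately have "\<bar>f x + g x\<bar> \<le> C + D" if "0 < x" "x < 1" for x
    using that by (smt (verit) greaterThanLessThan_iff)
  then show ?thesis using assms by (intro bmI[of _ "C + D"]) (auto simp: bm_def)
qed

lemma bm_mult [bm_intros]: assumes "bm f" "bm g" shows "bm (\<lambda>x. f x * g x)"
proof -
  obtain C where "0 \<le> C" "\<And>x. x \<in> {0<..<1} \<Longrightarrow> \<bar>f x\<bar> \<le> C" using bmD[OF assms(1)] by blast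
  moreover obtain D where "0 \<le> D" "\<And>x. x \<in> {0<..<1} \<Longrightarrow> \<bar>g x\<bar> \<le> D" using bmD[OF assms(2)] by blast
  ultimately have "\<bar>f x * g x\<bar> \<le> C * D" if "0 < x" "x < 1" for x
    using that by (auto simp: abs_mult intro!: mult_mono)
  then show ?thesis using assms by (intro bmI[of _ "C * D"]) (auto simp: bm_def)
qed

lemma bm_diff [bm_intros]: assumes "bm f" "bm g" shows "bm (\<lambda>x. f x - g x)"
  using bm_add[OF assms(1) bm_mult[OF bm_const[of "-1"] assms(2)]] by simp

lemma bm_sum [bm_intros]: "(\<And>i. i \<in> I \<Longrightarrow> bm (f i)) \<Longrightarrow> bm (\<lambda>x. \<Sum>i\<in>I. f i x)"
  by (induction I rule: infinite_finite_induct) (auto intro: bm_add)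

lemma bm_power2 [bm_intros]: "bm f \<Longrightarrow> bm (\<lambda>x. (f x)\<^sup>2)"
  unfolding power2_eq_square by (rule bm_mult)

lemma integrable_bm [intro]: assumes "bm f" shows "integrable M01 f"
proof -
  obtain C where "0 \<le> C" and "\<And>x. x \<in> {0<..<1} \<Longrightarrow> \<bar>f x\<bar> \<le> C" using bmD[OF assms(1)] by blast
  then show ?thesis using assms by (intro M01.integrable_const_bound[where B = C]) auto
qed

lemma integrable_ker_bm: assumes "bm f" "0 < x" "x < 1" shows "integrable M01 (\<lambda>y. ker x y * f y)"
proof -
  obtain C where "0 \<le> C" and C: "\<And>x. x \<in> {0<..<1} \<Longrightarrow> \<bar>f x\<bar> \<le> C" using bmD[OF assms(1)] by blast
  show ?thesis
  proof (rule Bochner_Integration.integrable_bound[OF integrable_mult_left[OF integrable_ker[OF assms(2,3)], of C]])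
    show "AE y in M01. norm (ker x y * f y) \<le> norm (ker x y * C)"
      using C by (intro AE_I2) (force simp: abs_mult intro!: mult_left_mono)
  qed (use assms in measurable)
qed

lemma Kstar_measurable [measurable]: "f \<in> borel_measurable M01 \<Longrightarrow> Kstar f \<in> borel_measurable M01"
  unfolding Kstar_ker[abs_def] by (intro M01.borel_measurable_lebesgue_integral) (simp add: split_def)

lemma Kstar_bm [bm_intros]: assumes "bm f" shows "bm (Kstar f)"
proof -
  obtain C where C0: "0 \<le> C" and C: "\<And>x. x \<in> {0<..<1} \<Longrightarrow> \<bar>f x\<bar> \<le> C" using bmD[OF assms] by blast
  show ?thesis
  proof (rule bmI[of _ "C * (2 * sqrt 2)"])
    fix x :: real assume x: "0 < x" "x < 1"
    have "\<bar>Kstar f x\<bar> \<le> (\<integral>y. \<bar>ker x y * f y\<bar> \<partial>M01)"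
      unfolding Kstar_ker by (rule integral_abs_bound)
    also have "\<dots> \<le> (\<integral>y. C * ker x y \<partial>M01)"
      using C assms x by (intro integral_mono integrable_abs integrable_ker_bm integrable_mult_right integrable_ker)
         (auto simp: abs_mult mult.commute[of C] intro!: mult_left_mono)
    also have "\<dots> \<le> C * (2 * sqrt 2)"
      using Kstar_one_le[OF x] C0 by (simp add: Kstar_ker mult_left_mono)
    finally show "\<bar>Kstar f x\<bar> \<le> C * (2 * sqrt 2)" .
  qed (use assms in measurable)
qed

lemma Kstar_add: "bm f \<Longrightarrow> bm g \<Longrightarrow> 0 < x \<Longrightarrow> x < 1 \<Longrightarrow> Kstar (\<lambda>y. f y + g y) x = Kstar f x + Kstar g x"
  by (simp add: Kstar_ker distrib_left integrable_ker_bm)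

lemma Kstar_cmult: "Kstar (\<lambda>y. c * f y) x = c * Kstar f x"
  by (simp add: Kstar_ker mult.left_commute)

lemma Kstar_diff: "bm f \<Longrightarrow> bm g \<Longrightarrow> 0 < x \<Longrightarrow> x < 1 \<Longrightarrow> Kstar (\<lambda>y. f y - g y) x = Kstar f x - Kstar g x"
  by (simp add: Kstar_ker right_diff_distrib integrable_ker_bm)

lemma Kstar_sum:
  assumes "\<And>i. i \<in> I \<Longrightarrow> bm (f i)" "0 < x" "x < 1"
  shows "Kstar (\<lambda>y. \<Sum>i\<in>I. f i y) x = (\<Sum>i\<in>I. Kstar (f i) x)"
  using assms by (simp add: Kstar_ker sum_distrib_left integrable_ker_bm)

lemma Kstar_mono:
  assumes "bm f" "bm g" "\<And>y. 0 < y \<Longrightarrow> y < 1 \<Longrightarrow> f y \<le> g y" "0 < x" "x < 1"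
  shows "Kstar f x \<le> Kstar g x"
  unfolding Kstar_ker using assms by (intro integral_mono integrable_ker_bm mult_left_mono) auto

lemma ker_ge_1: assumes "x \<in> {0<..<1}" "y \<in> {0<..<1}" "x \<noteq> y" shows "1 \<le> ker x y"
proof -
  have "\<bar>x - y\<bar> powr 0 \<le> \<bar>x - y\<bar> powr (-1/2)" using assms by (intro powr_mono') auto
  then show ?thesis using assms by (simp add: ker_def)
qed

lemma AE_neq: "AE y in M01. x \<noteq> y"
proof -
  have "AE y in lborel. y \<noteq> x" by (rule AE_lborel_singleton)
  then show ?thesis by (subst AE_restrict_space_iff) (auto elim: eventually_mono)
qed

text \<open>The kernel is at least 1 on the unit square, so the operator dominates the rank-one operator
  \<open>f \<mapsto> \<integral> f\<close>. The nonnegative remainder is what is iterated to build the Perron function.\<close>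
lemma integral_le_Kstar:
  assumes "bm f" "\<And>y. 0 < y \<Longrightarrow> y < 1 \<Longrightarrow> 0 \<le> f y" "0 < x" "x < 1"
  shows "(\<integral>y. f y \<partial>M01) \<le> Kstar f x"
  unfolding Kstar_ker
proof (rule integral_mono_AE)
  show "AE y in M01. f y \<le> ker x y * f y"
    using AE_neq[of x] AE_space
  proof eventually_elim
    case (elim y)
    then have "1 \<le> ker x y" "0 \<le> f y" using ker_ge_1[of x y] assms by auto
    then show ?case using mult_right_mono[of 1 "ker x y" "f y"] by simp
  qed
qed (use assms in \<open>auto intro: integrable_ker_bm\<close>)

lemma Kstar_sym:
  assumes f: "bm f" and g: "bm g"
  shows "(\<integral>x. f x * Kstar g x \<partial>M01) = (\<integral>x. Kstar f x * g x \<partial>M01)"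
proof -
  obtain C where C0: "0 \<le> C" and C: "\<And>x. x \<in> {0<..<1} \<Longrightarrow> \<bar>f x\<bar> \<le> C" using bmD[OF f] by blast
  have ab: "bm (\<lambda>x. \<bar>g x\<bar>)" using g by (auto simp: bm_def)
  have "integrable (M01 \<Otimes>\<^sub>M M01) (\<lambda>(x, y). f x * (ker x y * g y))"
  proof (rule MM.Fubini_integrable)
    have "integrable M01 (\<lambda>x. \<bar>f x\<bar> * Kstar (\<lambda>y. \<bar>g y\<bar>) x)"
      using f ab by (intro integrable_bm bm_mult Kstar_bm) (auto simp: bm_def)
    then show "integrable M01 (\<lambda>x. \<integral>y. norm (case (x, y) of (x, y) \<Rightarrow> f x * (ker x y * g y)) \<partial>M01)"
      by (simp add: abs_mult Kstar_ker)
    show "AE x in M01. integrable M01 (\<lambda>y. case (x, y) of (x, y) \<Rightarrow> f x * (ker x y * g y))"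
      using g by (intro AE_I2) (auto intro!: integrable_ker_bm)
    show "(\<lambda>(x, y). f x * (ker x y * g y)) \<in> borel_measurable (M01 \<Otimes>\<^sub>M M01)"
    proof -
      have [measurable]: "f \<in> borel_measurable M01" "g \<in> borel_measurable M01" using f g by (auto simp: bm_def)
      show ?thesis unfolding split_def by measurable
    qed
  qed
  then have "(\<integral>y. (\<integral>x. f x * (ker x y * g y) \<partial>M01) \<partial>M01) = (\<integral>x. (\<integral>y. f x * (ker x y * g y) \<partial>M01) \<partial>M01)"
    using MM.Fubini_integral[of "\<lambda>x y. f x * (ker x y * g y)"] by simp
  moreover have "(\<integral>x. f x * (ker x y * g y) \<partial>M01) = Kstar f y * g y" for y
  proof -
    have "(\<integral>x. f x * (ker x y * g y) \<partial>M01) = (\<integral>x. (ker y x * f x) * g y \<partial>M01)"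
      by (simp add: ker_sym[of y] mult_ac)
    then show ?thesis by (simp add: Kstar_ker)
  qed
  ultimately show ?thesis by (simp add: Kstar_ker)
qed

abbreviation ip :: "(real \<Rightarrow> real) \<Rightarrow> (real \<Rightarrow> real) \<Rightarrow> real" where
  "ip f g \<equiv> (\<integral>x. f x * g x \<partial>M01)"

lemma integral_const_M01 [simp]: "(\<integral>x. c \<partial>M01) = (c::real)"
  by simp

lemma integral_nonneg_M01: "(\<And>x. 0 < x \<Longrightarrow> x < 1 \<Longrightarrow> 0 \<le> f x) \<Longrightarrow> 0 \<le> (\<integral>x. f x \<partial>M01)"
  for f :: "real \<Rightarrow> real"
  by (rule integral_nonneg_AE) (auto intro!: AE_I2)

lemma integral_mono_M01: "bm f \<Longrightarrow> bm g \<Longrightarrow> (\<And>x. 0 < x \<Longrightarrow> x < 1 \<Longrightarrow> f x \<le> g x) \<Longrightarrow> (\<integral>x. f x \<partial>M01) \<le> (\<integral>x. g x \<partial>M01)"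
  by (rule integral_mono) auto

lemma integral_cong_M01: "(\<And>x. 0 < x \<Longrightarrow> x < 1 \<Longrightarrow> f x = g x) \<Longrightarrow> (\<integral>x. f x \<partial>M01) = (\<integral>x. g x \<partial>M01)"
  for f :: "real \<Rightarrow> real"
  by (rule Bochner_Integration.integral_cong) auto

section \<open>The Perron pair and Temple's inequality\<close>

lemma Kstar_ge_0: "bm f \<Longrightarrow> (\<And>y. 0 < y \<Longrightarrow> y < 1 \<Longrightarrow> 0 \<le> f y) \<Longrightarrow> 0 < x \<Longrightarrow> x < 1 \<Longrightarrow> 0 \<le> Kstar f x"
  using Kstar_mono[of "\<lambda>_. 0" f x] by (simp add: Kstar_ker)

text \<open>The supremum of \<open>K 1 - 1\<close> on the unit interval, attained at \<open>x = 1/2\<close>. By the Schur test it bounds the remainder left after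
  removing the rank-one part, hence it bounds everything below the top of the spectrum.\<close>
definition cR :: real where "cR = 2 * sqrt 2 - 1"

lemma cR_bounds: "1 < cR" "cR < 1829/1000"
proof -
  have "sqrt 2 < 1.4145" by (rule real_less_lsqrt) (auto simp: power2_eq_square)
  moreover have "1 < sqrt (2::real)" by simp
  ultimately show "1 < cR" "cR < 1829/1000" unfolding cR_def by auto
qed

text \<open>The Schur test for the kernel \<open>|x - y| powr (-1/2) - 1\<close>: integrate the nonnegative quantity
  \<open>\<integral> (|x - y| powr (-1/2) - 1) (e x - e y)\<^sup>2 dy\<close> over \<open>x\<close> and bound the diagonal terms by \<^term>\<open>cR\<close>.\<close>
lemma schur_R:
  assumes e: "bm e"
  shows "ip e (Kstar e) - (\<integral>x. e x \<partial>M01)\<^sup>2 \<le> cR * (\<integral>x. (e x)\<^sup>2 \<partial>M01)"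
proof -
  define m where "m = (\<integral>x. e x \<partial>M01)"
  define s where "s = (\<integral>x. (e x)\<^sup>2 \<partial>M01)"
  have pt: "0 \<le> (e x)\<^sup>2 * cR - 2 * (e x * Kstar e x) + 2 * m * e x + (Kstar (\<lambda>y. (e y)\<^sup>2) x - s)"
    if x: "0 < x" "x < 1" for x
  proof -
    let ?f = "\<lambda>y. (e x - e y)\<^sup>2"
    have bf: "bm ?f" by (intro bm_power2 bm_diff bm_const e)
    have "(\<integral>y. ?f y \<partial>M01) \<le> Kstar ?f x"
      by (rule integral_le_Kstar[OF bf _ x]) auto
    moreover have "(\<integral>y. ?f y \<partial>M01) = (\<integral>y. (e x)\<^sup>2 - 2 * e x * e y + (e y)\<^sup>2 \<partial>M01)"
      by (rule integral_cong_M01) (simp add: power2_diff)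
    moreover have "\<dots> = (e x)\<^sup>2 - 2 * e x * m + s"
      using integrable_bm[OF e] integrable_bm[OF bm_power2[OF e]] by (simp add: m_def s_def)
    moreover have "Kstar ?f x = Kstar (\<lambda>y. ((e x)\<^sup>2 * 1 - (2 * e x) * e y) + (e y)\<^sup>2) x"
      unfolding Kstar_ker by (rule integral_cong_M01) (simp add: power2_diff)
    moreover have "\<dots> = (e x)\<^sup>2 * Kstar (\<lambda>_. 1) x - 2 * e x * Kstar e x + Kstar (\<lambda>y. (e y)\<^sup>2) x"
    proof -
      have b: "bm (\<lambda>y. (e x)\<^sup>2 * 1)" "bm (\<lambda>y. (2 * e x) * e y)" "bm (\<lambda>y. (e y)\<^sup>2)" by (intro bm_intros e)+
      show ?thesis
        unfolding Kstar_add[OF bm_diff[OF b(1,2)] b(3) x] Kstar_diff[OF b(1,2) x]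
          Kstar_cmult[of "(e x)\<^sup>2" "\<lambda>_. 1"] Kstar_cmult[of "2 * e x" e] ..
    qed
    moreover have "(e x)\<^sup>2 * Kstar (\<lambda>_. 1) x \<le> (e x)\<^sup>2 * (cR + 1)"
      using Kstar_one_le[OF x] by (intro mult_left_mono) (auto simp: cR_def)
    ultimately show ?thesis by (simp add: algebra_simps)
  qed
  have "0 \<le> (\<integral>x. ((e x)\<^sup>2 * cR - 2 * (e x * Kstar e x) + 2 * m * e x + (Kstar (\<lambda>y. (e y)\<^sup>2) x - s)) \<partial>M01)"
    by (rule integral_nonneg_M01) (rule pt)
  also have "\<dots> = s * cR - 2 * ip e (Kstar e) + 2 * m * m + ((\<integral>x. Kstar (\<lambda>y. (e y)\<^sup>2) x \<partial>M01) - s)"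
  proof -
    have "integrable M01 (\<lambda>x. (e x)\<^sup>2)" "integrable M01 (\<lambda>x. e x * Kstar e x)" "integrable M01 e" "integrable M01 (Kstar (\<lambda>y. (e y)\<^sup>2))"
      by (intro integrable_bm bm_intros e)+
    then show ?thesis by (simp add: m_def s_def)
  qed
  finally have 1: "0 \<le> s * cR - 2 * ip e (Kstar e) + 2 * m * m + ((\<integral>x. Kstar (\<lambda>y. (e y)\<^sup>2) x \<partial>M01) - s)" .
  have "(\<integral>x. Kstar (\<lambda>y. (e y)\<^sup>2) x \<partial>M01) = (\<integral>x. (e x)\<^sup>2 * Kstar (\<lambda>_. 1) x \<partial>M01)"
    using Kstar_sym[OF bm_power2[OF e] bm_const[of 1]] by simp
  also have "\<dots> \<le> (\<integral>x. (e x)\<^sup>2 * (cR + 1) \<partial>M01)"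
    by (intro integral_mono_M01 bm_intros e mult_left_mono) (auto simp: cR_def Kstar_one_le)
  also have "\<dots> = s * (cR + 1)" unfolding s_def by (rule integral_mult_left_zero)
  also have "\<dots> = s * cR + s" by (simp add: distrib_left)
  finally have "ip e (Kstar e) - m * m \<le> cR * s" using 1 by (simp add: mult.commute[of cR])
  then show ?thesis unfolding m_def s_def power2_eq_square[of "integral\<^sup>L M01 e"] .
qed

text \<open>A positive eigenfunction, bounded away from zero so that quotients by it stay bounded.\<close>
locale perron =
  fixes lam :: real and phi :: "real \<Rightarrow> real" and t :: real
  assumes phi_bm: "bm phi" and t0: "0 < t"
    and phi_ge: "\<And>x. 0 < x \<Longrightarrow> x < 1 \<Longrightarrow> t \<le> phi x"
    and phi_mass: "(\<integral>x. phi x \<partial>M01) = 1"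
    and phi_eig: "\<And>x. 0 < x \<Longrightarrow> x < 1 \<Longrightarrow> Kstar phi x = lam * phi x"
    and lam_ge_2: "2 \<le> lam" and lam_le: "lam \<le> 2 * sqrt 2"
begin

text \<open>Write \<open>v = phi w\<close>. The nonnegative double integral of
  \<open>phi x ker x y phi y (w x - w y)\<^sup>2\<close> expands, by the eigenvalue equation and the symmetry of the kernel, to twice
  \<open>lam \<langle>v, v\<rangle> - \<langle>v, K v\<rangle>\<close>.\<close>
lemma rayleigh_le:
  assumes v: "bm v"
  shows "ip v (Kstar v) \<le> lam * ip v v"
proof -
  define w where "w = (\<lambda>x. v x / phi x)"
  have pos: "0 < phi x" if "0 < x" "x < 1" for x using phi_ge[OF that] t0 by linarith
  have w: "bm w"
  proof -
    obtain C where "0 \<le> C" and C: "\<And>x. x \<in> {0<..<1} \<Longrightarrow> \<bar>v x\<bar> \<le> C" using bmD[OF v] by blast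
    have "\<bar>w x\<bar> \<le> C / t" if "0 < x" "x < 1" for x
    proof -
      have "\<bar>v x\<bar> \<le> C" "\<bar>phi x\<bar> = phi x" using C that pos[OF that] by auto
      then show ?thesis unfolding w_def abs_divide using phi_ge[OF that] t0 \<open>0 \<le> C\<close> by (simp add: frac_le)
    qed
    moreover have "w \<in> borel_measurable M01"
    proof -
      have [measurable]: "v \<in> borel_measurable M01" "phi \<in> borel_measurable M01" using v phi_bm by (auto simp: bm_def)
      show ?thesis unfolding w_def by measurable
    qed
    ultimately show ?thesis by (intro bmI)
  qed
  have vw: "v x = phi x * w x" if "0 < x" "x < 1" for x using pos[OF that] by (simp add: w_def)
  let ?pw = "\<lambda>y. phi y * w y" and ?pww = "\<lambda>y. phi y * (w y)\<^sup>2"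
  have bpw: "bm ?pw" "bm ?pww" by (intro bm_intros phi_bm w)+
  have Kv: "Kstar ?pw x = Kstar v x" for x
    unfolding Kstar_ker by (rule integral_cong_M01) (simp add: vw)
  have pt: "0 \<le> lam * (phi x * ?pww x) - 2 * (v x * Kstar v x) + phi x * Kstar ?pww x"
    if x: "0 < x" "x < 1" for x
  proof -
    have "0 \<le> Kstar (\<lambda>y. phi y * (w x - w y)\<^sup>2) x"
      using x pos by (intro Kstar_ge_0 bm_intros phi_bm w) (simp add: less_imp_le)
    also have "\<dots> = Kstar (\<lambda>y. ((w x)\<^sup>2 * phi y - (2 * w x) * ?pw y) + ?pww y) x"
      by (rule arg_cong[where f = "\<lambda>f. Kstar f x"]) (auto simp: power2_diff algebra_simps)
    also have "\<dots> = (w x)\<^sup>2 * Kstar phi x - (2 * w x) * Kstar ?pw x + Kstar ?pww x"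
    proof -
      have b: "bm (\<lambda>y. (w x)\<^sup>2 * phi y)" "bm (\<lambda>y. (2 * w x) * ?pw y)" by (intro bm_intros phi_bm bpw)+
      show ?thesis
        unfolding Kstar_add[OF bm_diff[OF b] bpw(2) x] Kstar_diff[OF b x]
          Kstar_cmult[of "(w x)\<^sup>2" phi] Kstar_cmult[of "2 * w x" ?pw] ..
    qed
    also have "\<dots> = (w x)\<^sup>2 * (lam * phi x) - 2 * w x * Kstar v x + Kstar ?pww x"
      using x by (simp add: phi_eig Kv)
    finally have "0 \<le> phi x * ((w x)\<^sup>2 * (lam * phi x) - 2 * w x * Kstar v x + Kstar ?pww x)"
      using pos[OF x] by simp
    then show ?thesis using vw[OF x] by (simp add: algebra_simps power2_eq_square)
  qed
  have "0 \<le> (\<integral>x. (lam * (phi x * ?pww x) - 2 * (v x * Kstar v x) + phi x * Kstar ?pww x) \<partial>M01)"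
    by (rule integral_nonneg_M01) (rule pt)
  also have "\<dots> = lam * ip phi ?pww - 2 * ip v (Kstar v) + ip phi (Kstar ?pww)"
  proof -
    have "integrable M01 (\<lambda>x. phi x * ?pww x)" "integrable M01 (\<lambda>x. v x * Kstar v x)" "integrable M01 (\<lambda>x. phi x * Kstar ?pww x)"
      by (intro integrable_bm bm_intros phi_bm bpw v)+
    then show ?thesis by simp
  qed
  also have "ip phi (Kstar ?pww) = (\<integral>x. lam * phi x * ?pww x \<partial>M01)"
    unfolding Kstar_sym[OF phi_bm bpw(2)] by (rule integral_cong_M01) (simp add: phi_eig)
  also have "\<dots> = lam * ip phi ?pww" by (simp add: mult.assoc)
  also have "ip phi ?pww = ip v v"
    by (rule integral_cong_M01) (simp add: vw power2_eq_square)
  finally show ?thesis by simp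
qed

text \<open>The discriminant argument, since the functions are representatives rather than elements of a
  Hilbert space type.\<close>
lemma cauchy_schwarz:
  assumes f: "bm f" and g: "bm g"
  shows "\<bar>ip f g\<bar> \<le> sqrt (ip f f) * sqrt (ip g g)"
proof -
  have "(ip f g)\<^sup>2 \<le> ip f f * ip g g"
  proof -
    have q: "0 \<le> ip f f - 2 * s * ip f g + s\<^sup>2 * ip g g" for s
    proof -
      have "0 \<le> (\<integral>x. (f x - s * g x)\<^sup>2 \<partial>M01)" by (rule integral_nonneg_M01) auto
      also have "\<dots> = (\<integral>x. f x * f x - 2 * s * (f x * g x) + s\<^sup>2 * (g x * g x) \<partial>M01)"
        by (rule integral_cong_M01) (simp add: power2_eq_square algebra_simps)
      also have "\<dots> = ip f f - 2 * s * ip f g + s\<^sup>2 * ip g g"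
      proof -
        have "integrable M01 (\<lambda>x. f x * f x)" "integrable M01 (\<lambda>x. f x * g x)" "integrable M01 (\<lambda>x. g x * g x)"
          by (intro integrable_bm bm_intros f g)+
        then show ?thesis by simp
      qed
      finally show ?thesis .
    qed
    have gg: "0 \<le> ip g g" by (rule integral_nonneg_M01) auto
    show ?thesis
    proof (cases "ip g g = 0")
      case True
      have "ip f g = 0"
      proof (rule ccontr)
        assume "ip f g \<noteq> 0"
        then show False using q[of "(ip f f + 1) / (2 * ip f g)"] True by simp
      qed
      then show ?thesis using True by simp
    next
      case False
      with gg have "0 < ip g g" by linarith
      then show ?thesis using q[of "ip f g / ip g g"] by (simp add: field_simps power2_eq_square)
    qed
  qed
  then show ?thesis by (metis real_sqrt_abs real_sqrt_le_mono real_sqrt_mult)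
qed

text \<open>Any trial function \<open>v\<close> with small residual \<open>r = K v - rho v\<close> pins down the eigenvalue from above. Put
  \<open>e = m phi - v\<close>, where \<open>m\<close> is the mass of \<open>v\<close>. Since \<open>e\<close> has mean zero, the rank-one part of the operator does not see it,
  and \<open>(lam - K) e = r - eps v\<close> together with the Schur test gives \<open>(rho - cR) \<parallel>e\<parallel> \<le> s + eps \<parallel>v\<parallel>\<close>. Pairing
  \<open>K (m phi) = lam m phi\<close> with \<open>v\<close> gives \<open>eps (A0 + \<langle>v, e\<rangle>) = d + \<langle>r, e\<rangle>\<close>, so that, apart from
  the defect \<open>d\<close>, \<open>eps\<close> is quadratically small in the residual.\<close>
lemma temple:
  assumes v: "bm v" and A0: "0 < A0" "ip v v = A0" and d: "ip v (Kstar v) - rho * A0 = d" "0 \<le> d"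
    and R2: "ip (Kstar v) (Kstar v) - 2 * rho * ip v (Kstar v) + rho\<^sup>2 * A0 \<le> s\<^sup>2" and s: "0 \<le> s"
    and rho: "cR < rho"
  defines "eps \<equiv> lam - rho"
  shows "0 \<le> eps" "eps * A0 * (rho - cR) \<le> d * (rho - cR) + s\<^sup>2 + (2 * s + eps * sqrt A0) * (eps * sqrt A0) "
proof -
  have "ip v (Kstar v) \<le> lam * A0" using rayleigh_le[OF v] unfolding A0(2) .
  then have "rho * A0 \<le> lam * A0" using d by linarith
  then have "rho \<le> lam" by (rule mult_right_le_imp_le) (rule A0(1))
  then show eps0: "0 \<le> eps" by (simp add: eps_def)
  define m where "m = (\<integral>x. v x \<partial>M01)"
  define r where "r = (\<lambda>x. Kstar v x - rho * v x)"
  define e where "e = (\<lambda>x. m * phi x - v x)"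
  have be: "bm e" "bm r" "bm (\<lambda>x. m * phi x)" unfolding e_def r_def by (intro bm_intros v phi_bm)+
  have rr: "ip r r \<le> s\<^sup>2"
  proof -
    have "ip r r = (\<integral>x. Kstar v x * Kstar v x - 2 * rho * (v x * Kstar v x) + rho\<^sup>2 * (v x * v x) \<partial>M01)"
      unfolding r_def by (rule integral_cong_M01) (simp add: power2_eq_square algebra_simps)
    also have "\<dots> = ip (Kstar v) (Kstar v) - 2 * rho * ip v (Kstar v) + rho\<^sup>2 * ip v v"
    proof -
      have "integrable M01 (\<lambda>x. Kstar v x * Kstar v x)" "integrable M01 (\<lambda>x. v x * Kstar v x)" "integrable M01 (\<lambda>x. v x * v x)"
        by (intro integrable_bm bm_intros v)+
      then show ?thesis by simp
    qed
    finally show ?thesis using R2 A0 by simp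
  qed
  have e1: "(\<integral>x. e x \<partial>M01) = 0"
    unfolding e_def using integrable_bm[OF v] integrable_bm[OF phi_bm] by (simp add: phi_mass m_def)
  have Ke: "lam * e x - Kstar e x = r x - eps * v x" if x: "0 < x" "x < 1" for x
    unfolding e_def using Kstar_diff[OF be(3) v x] Kstar_cmult[of m phi x] phi_eig[OF x]
    by (simp add: r_def eps_def algebra_simps)
  define E where "E = sqrt (ip e e)"
  have EE: "E\<^sup>2 = ip e e" unfolding E_def by (rule real_sqrt_pow2) (rule integral_nonneg_M01, simp)
  have E0: "0 \<le> E" unfolding E_def by simp
  have rs: "sqrt (ip r r) \<le> s" using rr s by (metis real_sqrt_le_mono real_sqrt_abs abs_of_nonneg)
  have re: "\<bar>ip r e\<bar> \<le> s * E" using cauchy_schwarz[OF be(2,1)] rs E0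
    unfolding E_def[symmetric] by (meson mult_right_mono order_trans)
  have ve: "\<bar>ip v e\<bar> \<le> sqrt A0 * E" using cauchy_schwarz[OF v be(1)] A0 unfolding E_def by simp
  have "lam * E\<^sup>2 - ip e (Kstar e) = ip r e - eps * ip v e"
  proof -
    have i: "integrable M01 (\<lambda>x. e x * e x)" "integrable M01 (\<lambda>x. e x * Kstar e x)" "integrable M01 (\<lambda>x. r x * e x)" "integrable M01 (\<lambda>x. v x * e x)"
      by (intro integrable_bm bm_intros v be)+
    have "(\<integral>x. lam * (e x * e x) - e x * Kstar e x \<partial>M01) = (\<integral>x. r x * e x - eps * (v x * e x) \<partial>M01)"
    proof (rule integral_cong_M01)
      fix x :: real assume x: "0 < x" "x < 1"
      show "lam * (e x * e x) - e x * Kstar e x = r x * e x - eps * (v x * e x)"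
        using arg_cong[OF Ke[OF x], of "\<lambda>z. e x * z"] by (simp add: algebra_simps)
    qed
    then show ?thesis using i EE by simp
  qed
  moreover have "ip e (Kstar e) \<le> cR * E\<^sup>2"
  proof -
    have "(\<integral>x. (e x)\<^sup>2 \<partial>M01) = E\<^sup>2" unfolding EE by (simp only: power2_eq_square)
    then show ?thesis using schur_R[OF be(1)] by (simp add: e1)
  qed
  moreover have vE: "- (eps * ip v e) \<le> eps * (sqrt A0 * E)"
    using mult_left_mono[of "- ip v e" "sqrt A0 * E" eps] ve eps0 by linarith
  ultimately have "(lam - cR) * E\<^sup>2 \<le> (s + eps * sqrt A0) * E"
    using re abs_ge_self[of "ip r e"] unfolding left_diff_distrib distrib_right mult.assoc by linarith
  then have "(lam - cR) * E \<le> s + eps * sqrt A0"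
  proof (cases "E = 0")
    case True
    have "0 \<le> eps * sqrt A0" using eps0 A0(1) by simp
    then show ?thesis using True s by simp
  next
    case False
    with E0 have "0 < E" by linarith
    moreover have "((lam - cR) * E) * E \<le> (s + eps * sqrt A0) * E"
      using \<open>(lam - cR) * E\<^sup>2 \<le> _\<close> by (simp only: power2_eq_square mult.assoc)
    ultimately show ?thesis by (rule mult_right_le_imp_le[rotated])
  qed
  moreover have "(rho - cR) * E \<le> (lam - cR) * E" using \<open>rho \<le> lam\<close> E0 by (intro mult_right_mono) auto
  ultimately have E: "(rho - cR) * E \<le> s + eps * sqrt A0" by simp
  have "eps * (A0 + ip v e) = d + ip r e"
  proof -
    have i: "integrable M01 (\<lambda>x. v x * v x)" "integrable M01 (\<lambda>x. r x * v x)" "integrable M01 (\<lambda>x. r x * e x)" "integrable M01 (\<lambda>x. v x * e x)"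
       "integrable M01 (\<lambda>x. v x * Kstar v x)"
      by (intro integrable_bm bm_intros v be)+
    have mphi: "m * phi x = v x + e x" for x by (simp add: e_def)
    have "ip v (Kstar (\<lambda>x. m * phi x)) = ip (Kstar v) (\<lambda>x. m * phi x)" by (rule Kstar_sym[OF v be(3)])
    moreover have "ip v (Kstar (\<lambda>x. m * phi x)) = (\<integral>x. lam * (v x * v x + v x * e x) \<partial>M01)"
      by (rule integral_cong_M01) (simp add: Kstar_cmult phi_eig e_def algebra_simps)
    moreover have "\<dots> = lam * (A0 + ip v e)" using i A0 by simp
    moreover have "ip (Kstar v) (\<lambda>x. m * phi x) = (\<integral>x. rho * (v x * v x + v x * e x) + (v x * Kstar v x - rho * (v x * v x)) + r x * e x \<partial>M01)"
      unfolding mphi by (rule integral_cong_M01) (simp add: r_def algebra_simps)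
    moreover have "\<dots> = rho * (A0 + ip v e) + d + ip r e" using i A0 d by simp
    ultimately show ?thesis by (simp add: eps_def algebra_simps)
  qed
  then have "eps * A0 \<le> d + s * E + eps * (sqrt A0 * E)"
    using re vE abs_ge_self[of "ip r e"] unfolding distrib_left by linarith
  then have "eps * A0 \<le> d + (s + eps * sqrt A0) * E" unfolding distrib_right mult.assoc by linarith
  then have "eps * A0 * (rho - cR) \<le> (d + (s + eps * sqrt A0) * E) * (rho - cR)"
    using rho by (intro mult_right_mono) auto
  also have "\<dots> = d * (rho - cR) + (s + eps * sqrt A0) * ((rho - cR) * E)" unfolding distrib_right[of d] by (simp only: mult_ac)
  also have "\<dots> \<le> d * (rho - cR) + (s + eps * sqrt A0) * (s + eps * sqrt A0)"
    using E s eps0 A0(1) by (intro add_left_mono mult_left_mono) auto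
  also have "\<dots> = d * (rho - cR) + s\<^sup>2 + (2 * s + eps * sqrt A0) * (eps * sqrt A0)"
  proof -
    have "(s + z) * (s + z) = s\<^sup>2 + (2 * s + z) * z" for z :: real by (simp add: power2_eq_square algebra_simps)
    then show ?thesis by simp
  qed
  finally show "eps * A0 * (rho - cR) \<le> d * (rho - cR) + s\<^sup>2 + (2 * s + eps * sqrt A0) * (eps * sqrt A0)" .
qed

end

section \<open>Existence and maximality of the Perron eigenvalue\<close>

text \<open>The iterates \<open>R\<^sup>n 1\<close> of the constant function under the remainder \<open>R f = K f - \<integral> f\<close>.\<close>
primrec neumann :: "nat \<Rightarrow> real \<Rightarrow> real" where
  "neumann 0 = (\<lambda>_. 1)"
| "neumann (Suc n) = (\<lambda>x. Kstar (neumann n) x - (\<integral>y. neumann n y \<partial>M01))"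

lemma neumann_bounds:
  "bm (neumann n) \<and> (\<forall>x. 0 < x \<longrightarrow> x < 1 \<longrightarrow> 1 \<le> neumann n x \<and> neumann n x \<le> cR ^ n)"
proof (induction n)
  case 0 then show ?case by auto
next
  case (Suc n)
  then have b: "bm (neumann n)" and lo: "\<And>x. 0 < x \<Longrightarrow> x < 1 \<Longrightarrow> 1 \<le> neumann n x"
    and hi: "\<And>x. 0 < x \<Longrightarrow> x < 1 \<Longrightarrow> neumann n x \<le> cR ^ n" by auto
  have i: "integrable M01 (neumann n)" using b by (rule integrable_bm)
  have "1 \<le> neumann (Suc n) x" "neumann (Suc n) x \<le> cR ^ Suc n" if x: "0 < x" "x < 1" for x
  proof -
    have "(\<integral>y. neumann n y - 1 \<partial>M01) \<le> Kstar (\<lambda>y. neumann n y - 1) x"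
      using b lo x by (intro integral_le_Kstar bm_diff bm_const) auto
    also have "\<dots> = Kstar (neumann n) x - Kstar (\<lambda>_. 1) x" using b x by (intro Kstar_diff) auto
    finally show "1 \<le> neumann (Suc n) x" using i Kstar_one_ge[OF x] by simp
    have "(\<integral>y. cR ^ n * 1 - neumann n y \<partial>M01) \<le> Kstar (\<lambda>y. cR ^ n * 1 - neumann n y) x"
      using integral_le_Kstar[of "\<lambda>y. cR ^ n - neumann n y" x] b hi x by (simp add: bm_diff)
    also have "\<dots> = cR ^ n * Kstar (\<lambda>_. 1) x - Kstar (neumann n) x"
      unfolding Kstar_diff[OF bm_mult[OF bm_const bm_const] b x] Kstar_cmult[of "cR ^ n" "\<lambda>_. 1"] ..
    finally have "Kstar (neumann n) x - (\<integral>y. neumann n y \<partial>M01) \<le> cR ^ n * (Kstar (\<lambda>_. 1) x - 1)"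
      using i by (simp add: algebra_simps)
    also have "\<dots> \<le> cR ^ n * cR" using Kstar_one_le[OF x] cR_bounds(1) by (intro mult_left_mono) (simp_all add: cR_def[symmetric], simp add: cR_def)
    finally show "neumann (Suc n) x \<le> cR ^ Suc n" by (simp add: mult.commute)
  qed
  moreover have "bm (neumann (Suc n))" unfolding neumann.simps by (intro bm_intros b)
  ultimately show ?case by blast
qed

lemmas bm_neumann = neumann_bounds[THEN conjunct1]
lemma neumann_ge: "0 < x \<Longrightarrow> x < 1 \<Longrightarrow> 1 \<le> neumann n x" using neumann_bounds by blast
lemma neumann_le: "0 < x \<Longrightarrow> x < 1 \<Longrightarrow> neumann n x \<le> cR ^ n" using neumann_bounds by blast

text \<open>The moments \<open>\<integral> R\<^sup>n 1\<close>. A function \<open>\<Sum>n. t ^ (n + 1) R\<^sup>n 1\<close> solves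
  \<open>K phi = phi / t\<close> exactly when its total mass is 1, which is a scalar equation for \<open>t\<close>.\<close>
definition mass :: "nat \<Rightarrow> real" where "mass n = (\<integral>x. neumann n x \<partial>M01)"

lemma mass_bounds: "1 \<le> mass n" "mass n \<le> cR ^ n"
  using integral_mono_M01[OF bm_const bm_neumann, of 1 n] integral_mono_M01[OF bm_neumann bm_const, of n "cR ^ n"]
  by (auto simp: mass_def neumann_ge neumann_le)

lemma geometric_bound:
  assumes "0 \<le> t" "t \<le> 1/2"
  shows "summable (\<lambda>n. cR ^ n * t ^ Suc n)" "(\<Sum>n. cR ^ n * t ^ Suc n) = t / (1 - cR * t)"
proof -
  have "cR * t \<le> (1829/1000) * (1/2)" using assms cR_bounds by (intro mult_mono) auto
  moreover have "0 \<le> cR * t" using assms cR_bounds by auto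
  ultimately have "norm (cR * t) < 1" by simp
  from sums_mult[OF geometric_sums[OF this], of t]
  have "(\<lambda>n. cR ^ n * t ^ Suc n) sums (t / (1 - cR * t))" by (simp add: power_mult_distrib mult_ac)
  then show "summable (\<lambda>n. cR ^ n * t ^ Suc n)" "(\<Sum>n. cR ^ n * t ^ Suc n) = t / (1 - cR * t)" by (auto simp: sums_iff)
qed

lemma summable_mass:
  assumes "0 \<le> t" "t \<le> 1/2"
  shows "summable (\<lambda>n. mass n * t ^ Suc n)"
proof (rule summable_comparison_test'[OF geometric_bound(1)[OF assms], of 0])
  fix n show "norm (mass n * t ^ Suc n) \<le> cR ^ n * t ^ Suc n"
    using mass_bounds[of n] assms by (auto simp: abs_mult intro!: mult_right_mono)
qed

text \<open>The mass is a continuous increasing power series in \<open>t\<close>. Because every moment lies between 1 and the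
  corresponding power of \<^term>\<open>cR\<close>, comparison with two geometric series shows that it is at most 1 at the left endpoint and
  at least 1 at the right one.\<close>
lemma exists_mass_root: "\<exists>t. 1 / (2 * sqrt 2) \<le> t \<and> t \<le> 1/2 \<and> (\<Sum>n. mass n * t ^ Suc n) = 1"
proof -
  let ?g = "\<lambda>t::real. \<Sum>n. mass n * t ^ Suc n"
  let ?a = "1 / (2 * sqrt 2) :: real"
  have a: "0 \<le> ?a" "?a \<le> 1/2" by (auto simp: field_simps)
  \<comment> \<open>The left endpoint is where the majorizing geometric series sums to exactly 1.\<close>
  have ga: "?g ?a \<le> 1"
  proof -
    have "?g ?a \<le> (\<Sum>n. cR ^ n * ?a ^ Suc n)"
      using mass_bounds a by (intro suminf_le summable_mass geometric_bound(1) mult_right_mono) auto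
    also have "\<dots> = 1" unfolding geometric_bound(2)[OF a] by (simp add: cR_def field_simps)
    finally show ?thesis .
  qed
  have gb: "1 \<le> ?g (1/2)"
  proof -
    have "(\<Sum>n. (1/2::real) ^ Suc n) = 1" using sums_unique[OF power_half_series] by simp
    moreover have "(\<Sum>n. (1/2::real) ^ Suc n) \<le> ?g (1/2)"
    proof (rule suminf_le)
      show "summable (\<lambda>n. (1/2::real) ^ Suc n)" using power_half_series by (auto simp: sums_iff)
      show "(1/2::real) ^ Suc n \<le> mass n * (1/2) ^ Suc n" for n
        using mult_right_mono[OF mass_bounds(1)[of n], of "(1/2)^Suc n"] by simp
    qed (rule summable_mass, auto)
    ultimately show ?thesis by simp
  qed
  have "continuous_on {?a..1/2} ?g"
  proof (rule uniform_limit_theorem)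
    show "uniform_limit {?a..1/2} (\<lambda>N t. \<Sum>n<N. mass n * t ^ Suc n) ?g sequentially"
    proof (rule Weierstrass_m_test[OF _ geometric_bound(1)[of "1/2"]])
      fix n t assume "t \<in> {?a..1/2}"
      then have t: "0 \<le> t" "t \<le> 1/2" using a(1) order_trans[OF a(1)] by auto
      then have "t ^ Suc n \<le> (1/2) ^ Suc n" by (intro power_mono) auto
      then show "norm (mass n * t ^ Suc n) \<le> cR ^ n * (1/2) ^ Suc n"
        using mass_bounds[of n] t by (auto simp: abs_mult simp del: power_Suc intro!: mult_mono)
    qed auto
    show "\<forall>\<^sub>F N in sequentially. continuous_on {?a..1/2} (\<lambda>t. \<Sum>n<N. mass n * t ^ Suc n)"
      by (intro always_eventually allI continuous_intros)
  qed auto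
  from IVT'[OF ga gb a(2) this] show ?thesis by auto
qed

text \<open>The Neumann series with the parameter \<open>t\<close> chosen so that the mass is 1: applying \<open>K = R + \<integral>\<close> termwise
  shifts the series by one and puts the missing first term back through the mass.\<close>
lemma perron_exists: "\<exists>lam phi t. perron lam phi t"
proof -
  from exists_mass_root obtain t where t: "1 / (2 * sqrt 2) \<le> t" "t \<le> 1/2" and g: "(\<Sum>n. mass n * t ^ Suc n) = 1" by auto
  have t0: "0 < t" using t(1) by (rule less_le_trans[rotated]) simp
  define u where "u = (\<lambda>n x. neumann n x * t ^ Suc n)"
  define phi where "phi = (\<lambda>x. \<Sum>n. u n x)"
  have gs: "summable (\<lambda>n. cR ^ n * t ^ Suc n)" using geometric_bound(1) t t0 by auto
  have bu: "bm (u n)" for n unfolding u_def by (intro bm_mult bm_neumann bm_const)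
  have u0: "0 \<le> u n x" "u n x \<le> cR ^ n * t ^ Suc n" if "0 < x" "x < 1" for n x
    using neumann_ge[OF that, of n] neumann_le[OF that, of n] t0 by (auto simp: u_def intro!: mult_right_mono)
  have su: "summable (\<lambda>n. u n x)" if "0 < x" "x < 1" for x
    by (rule summable_comparison_test'[OF gs, of 0]) (use u0[OF that] in auto)
  have uS: "Kstar (u n) x = (u (Suc n) x) / t + mass n * t ^ Suc n" for n x
    using t0 Kstar_cmult[of "t ^ Suc n" "neumann n" x] by (simp add: u_def mass_def mult.commute field_simps)
  have phi_le: "\<bar>phi x\<bar> \<le> (\<Sum>n. cR ^ n * t ^ Suc n)" if "0 < x" "x < 1" for x
    using suminf_le[OF u0(2)[OF that] su[OF that] gs] suminf_nonneg[OF su[OF that] u0(1)[OF that]] by (simp add: phi_def)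
  have phi_bm: "bm phi"
  proof (rule bmI[OF _ phi_le])
    have [measurable]: "\<And>n. u n \<in> borel_measurable M01" using bu by (auto simp: bm_def)
    show "phi \<in> borel_measurable M01" unfolding phi_def by measurable
  qed
  have phi_ge: "t \<le> phi x" if x: "0 < x" "x < 1" for x
  proof -
    have "(\<Sum>n\<in>{0}. u n x) \<le> phi x" unfolding phi_def using su[OF x] u0(1)[OF x] by (intro sum_le_suminf) auto
    then show ?thesis by (simp add: u_def)
  qed
  have mass_u: "(\<integral>x. u n x \<partial>M01) = mass n * t ^ Suc n" for n by (simp add: u_def mass_def)
  have phi_mass: "(\<integral>x. phi x \<partial>M01) = 1"
  proof -
    have "(\<integral>x. (\<Sum>n. u n x) \<partial>M01) = (\<Sum>n. \<integral>x. u n x \<partial>M01)"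
    proof (rule integral_suminf)
      show "AE x in M01. summable (\<lambda>n. norm (u n x))" using su u0 by (intro AE_I2) auto
      have "(\<integral>x. norm (u n x) \<partial>M01) = mass n * t ^ Suc n" for n
        unfolding mass_u[symmetric] by (rule integral_cong_M01) (use u0 in auto)
      then show "summable (\<lambda>n. \<integral>x. norm (u n x) \<partial>M01)" using summable_mass[of t] t t0 by simp
    qed (use bu in auto)
    then show ?thesis using g by (simp add: phi_def mass_u)
  qed
  have eig: "Kstar phi x = (1/t) * phi x" if x: "0 < x" "x < 1" for x
  proof -
    have sS: "summable (\<lambda>n. u (Suc n) x)" using summable_ignore_initial_segment[OF su[OF x], of 1] by simp
    have ku: "summable (\<lambda>n. Kstar (u n) x)"
      unfolding uS using sS summable_mass[of t] t t0
      by (intro summable_add summable_divide) auto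
    have "Kstar phi x = (\<integral>y. (\<Sum>n. ker x y * u n y) \<partial>M01)"
      unfolding Kstar_ker phi_def by (rule integral_cong_M01) (simp add: su suminf_mult)
    also have "\<dots> = (\<Sum>n. \<integral>y. ker x y * u n y \<partial>M01)"
    proof (rule integral_suminf)
      show "integrable M01 (\<lambda>y. ker x y * u n y)" for n using bu x by (rule integrable_ker_bm)
      show "AE y in M01. summable (\<lambda>n. norm (ker x y * u n y))" using su u0 by (intro AE_I2) (auto simp: abs_mult intro!: summable_mult)
      have "(\<integral>y. norm (ker x y * u n y) \<partial>M01) = Kstar (u n) x" for n
        unfolding Kstar_ker by (rule integral_cong_M01) (use u0 in \<open>auto simp: abs_mult\<close>)
      then show "summable (\<lambda>n. \<integral>y. norm (ker x y * u n y) \<partial>M01)" using ku by simp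
    qed
    also have "\<dots> = (\<Sum>n. u (Suc n) x / t + mass n * t ^ Suc n)" by (simp add: uS flip: Kstar_ker)
    also have "\<dots> = (\<Sum>n. u (Suc n) x / t) + (\<Sum>n. mass n * t ^ Suc n)"
      using sS summable_mass[of t] t t0
      by (intro suminf_add[symmetric] summable_divide) auto
    also have "(\<Sum>n. u (Suc n) x / t) = (\<Sum>n. u (Suc n) x) / t"
      using sS by (rule suminf_divide)
    also have "(\<Sum>n. u (Suc n) x) = phi x - t" using suminf_split_head[OF su[OF x]] by (simp add: phi_def u_def)
    also have "(phi x - t) / t + (\<Sum>n. mass n * t ^ Suc n) = (1/t) * phi x" using t0 g by (simp add: field_simps)
    finally show ?thesis .
  qed
  have "perron (1/t) phi t"
  proof
    \<comment> \<open>The eigenvalue is the reciprocal of the root, so the bounds on the root turn into the bounds on it.\<close>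
    show "2 \<le> 1 / t" using t t0 by (simp add: field_simps)
    show "1 / t \<le> 2 * sqrt 2" using t t0 by (simp add: field_simps)
  qed (use phi_bm t0 phi_ge phi_mass eig in auto)
  then show ?thesis by blast
qed

context perron begin

lemma lam_eigenvalue: "L2_eigenvalue Kstar lam"
  unfolding L2_eigenvalue_def
proof (intro bexI[of _ phi] conjI)
  show "phi \<in> L2_01" using phi_bm unfolding L2_01_def using integrable_bm[OF bm_power2[OF phi_bm]] by (simp add: bm_measurable[OF phi_bm])
  show "\<not> (AE x in M01. phi x = 0)"
  proof
    assume "AE x in M01. phi x = 0"
    then have "(\<integral>x. phi x \<partial>M01) = (\<integral>x. 0 \<partial>M01)" using phi_bm by (intro integral_cong_AE) auto
    then show False using phi_mass by simp
  qed
  show "AE x in M01. Kstar phi x = lam * phi x" by (intro AE_I2) (auto simp: phi_eig)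
qed

text \<open>If \<open>K f = mu f\<close>, pair \<open>|mu| |f| \<le> K |f|\<close> with the Perron function and move \<open>K\<close> across with
  Tonelli: \<open>|mu| \<langle>|f|, phi\<rangle> \<le> lam \<langle>|f|, phi\<rangle>\<close>, and the pairing is positive and finite.\<close>
lemma eigenvalue_le:
  assumes "L2_eigenvalue Kstar mu"
  shows "mu \<le> lam"
proof -
  from assms obtain f where f: "f \<in> L2_01" "\<not> (AE x in M01. f x = 0)" "AE x in M01. Kstar f x = mu * f x"
    by (auto simp: L2_eigenvalue_def)
  have fm [measurable]: "f \<in> borel_measurable M01" using f by (simp add: L2_01_def)
  have pm [measurable]: "phi \<in> borel_measurable M01" using phi_bm by (simp add: bm_def)
  have if1: "integrable M01 f"
  proof (rule Bochner_Integration.integrable_bound[of _ "\<lambda>x. (f x)\<^sup>2 + 1"])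
    show "integrable M01 (\<lambda>x. (f x)\<^sup>2 + 1)" using f by (simp add: L2_01_def)
    have "\<bar>z\<bar> \<le> z\<^sup>2 + 1" for z :: real
    proof -
      have "0 \<le> (\<bar>z\<bar> - 1/2)\<^sup>2" by (rule zero_le_power2)
      then show ?thesis by (simp add: power2_eq_square algebra_simps)
    qed
    then show "AE x in M01. norm (f x) \<le> norm ((f x)\<^sup>2 + 1)" by (intro AE_I2) (auto intro: order_trans)
  qed auto
  have p0: "0 \<le> phi x" if "0 < x" "x < 1" for x using phi_ge[OF that] t0 by linarith
  define I where "I = (\<integral>\<^sup>+x. ennreal (phi x * \<bar>f x\<bar>) \<partial>M01)"
  have lam0: "0 \<le> lam" using lam_ge_2 by simp
  have "ennreal \<bar>mu\<bar> * I = (\<integral>\<^sup>+x. ennreal \<bar>mu\<bar> * ennreal (phi x * \<bar>f x\<bar>) \<partial>M01)"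
    unfolding I_def by (rule nn_integral_cmult[symmetric]) auto
  also have "\<dots> \<le> (\<integral>\<^sup>+x. (\<integral>\<^sup>+y. ennreal (phi x * ker x y * \<bar>f y\<bar>) \<partial>M01) \<partial>M01)"
  proof (rule nn_integral_mono_AE)
    show "AE x in M01. ennreal \<bar>mu\<bar> * ennreal (phi x * \<bar>f x\<bar>) \<le> (\<integral>\<^sup>+y. ennreal (phi x * ker x y * \<bar>f y\<bar>) \<partial>M01)"
      using f(3) AE_space
    proof eventually_elim
      case (elim x)
      then have x: "0 < x" "x < 1" and eq: "Kstar f x = mu * f x" by auto
      have "ennreal \<bar>Kstar f x\<bar> \<le> (\<integral>\<^sup>+y. ennreal (ker x y * \<bar>f y\<bar>) \<partial>M01)"
      proof (cases "integrable M01 (\<lambda>y. ker x y * f y)")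
        case True
        then show ?thesis using integral_norm_bound_ennreal[OF True] by (simp add: Kstar_ker abs_mult)
      next
        case False then show ?thesis by (simp add: Kstar_ker not_integrable_integral_eq)
      qed
      then have "ennreal (phi x) * ennreal \<bar>Kstar f x\<bar> \<le> ennreal (phi x) * (\<integral>\<^sup>+y. ennreal (ker x y * \<bar>f y\<bar>) \<partial>M01)"
        by (rule mult_left_mono) simp
      also have "\<dots> = (\<integral>\<^sup>+y. ennreal (phi x) * ennreal (ker x y * \<bar>f y\<bar>) \<partial>M01)"
        by (rule nn_integral_cmult[symmetric]) auto
      also have "\<dots> = (\<integral>\<^sup>+y. ennreal (phi x * ker x y * \<bar>f y\<bar>) \<partial>M01)"
        using p0[OF x] by (simp add: ennreal_mult' mult.assoc)
      finally show ?case using p0[OF x] by (simp add: eq abs_mult ennreal_mult' mult_ac)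
    qed
  qed
  also have "\<dots> = (\<integral>\<^sup>+y. (\<integral>\<^sup>+x. ennreal (phi x * ker x y * \<bar>f y\<bar>) \<partial>M01) \<partial>M01)"
    by (rule MM.Fubini'[symmetric]) (simp add: split_def)
  also have "\<dots> = (\<integral>\<^sup>+y. ennreal lam * ennreal (phi y * \<bar>f y\<bar>) \<partial>M01)"
  proof (rule nn_integral_cong)
    fix y assume "y \<in> space M01"
    then have y: "0 < y" "y < 1" by auto
    have "(\<integral>\<^sup>+x. ennreal (phi x * ker x y * \<bar>f y\<bar>) \<partial>M01) = (\<integral>\<^sup>+x. ennreal (ker y x * phi x) * ennreal \<bar>f y\<bar> \<partial>M01)"
      using p0 by (intro nn_integral_cong) (simp add: ker_sym[of y] ennreal_mult'[symmetric] mult_ac)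
    also have "\<dots> = (\<integral>\<^sup>+x. ennreal (ker y x * phi x) \<partial>M01) * ennreal \<bar>f y\<bar>"
      by (rule nn_integral_multc) auto
    also have "(\<integral>\<^sup>+x. ennreal (ker y x * phi x) \<partial>M01) = ennreal (Kstar phi y)"
      unfolding Kstar_ker using p0 y phi_bm by (intro nn_integral_eq_integral integrable_ker_bm AE_I2) auto
    finally show "(\<integral>\<^sup>+x. ennreal (phi x * ker x y * \<bar>f y\<bar>) \<partial>M01) = ennreal lam * ennreal (phi y * \<bar>f y\<bar>)"
      using p0[OF y] lam0 by (simp add: phi_eig[OF y] ennreal_mult' mult.assoc)
  qed
  also have "\<dots> = ennreal lam * I" unfolding I_def by (rule nn_integral_cmult) auto
  finally have le: "ennreal \<bar>mu\<bar> * I \<le> ennreal lam * I" .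
  have "I \<noteq> 0"
  proof
    assume "I = 0"
    then have "AE x in M01. ennreal (phi x * \<bar>f x\<bar>) = 0" unfolding I_def by (subst (asm) nn_integral_0_iff_AE) auto
    then have "AE x in M01. f x = 0" using AE_space
    proof eventually_elim
      case (elim x)
      then have "0 < phi x" using phi_ge[of x] t0 by (auto intro: less_le_trans)
      then show ?case using elim by (auto simp: ennreal_eq_0_iff mult_le_0_iff)
    qed
    then show False using f(2) by simp
  qed
  moreover have "I < \<infinity>"
  proof -
    obtain C where C: "0 \<le> C" "\<And>x. x \<in> {0<..<1} \<Longrightarrow> \<bar>phi x\<bar> \<le> C" using bmD[OF phi_bm] by blast
    have "integrable M01 (\<lambda>x. phi x * \<bar>f x\<bar>)"
    proof (rule Bochner_Integration.integrable_bound[of _ "\<lambda>x. C * \<bar>f x\<bar>"])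
      show "AE x in M01. norm (phi x * \<bar>f x\<bar>) \<le> norm (C * \<bar>f x\<bar>)"
        using C by (intro AE_I2) (auto simp: abs_mult intro!: mult_right_mono)
    qed (use if1 in auto)
    then have "(\<integral>\<^sup>+x. ennreal (norm (phi x * \<bar>f x\<bar>)) \<partial>M01) < \<infinity>" by (simp add: integrable_iff_bounded)
    moreover have "I \<le> (\<integral>\<^sup>+x. ennreal (norm (phi x * \<bar>f x\<bar>)) \<partial>M01)"
      unfolding I_def by (intro nn_integral_mono) (auto intro!: ennreal_leI)
    ultimately show ?thesis by (rule le_less_trans[rotated])
  qed
  ultimately have "ennreal \<bar>mu\<bar> \<le> ennreal lam"
    using le ennreal_mult_le_mult_iff[of I "ennreal \<bar>mu\<bar>" "ennreal lam"] by (auto simp: mult.commute)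
  then show ?thesis using lam0 by (simp add: ennreal_le_iff)
qed

lemma lambda_star_eq: "lambda_star = lam"
  unfolding lambda_star_def by (rule Greatest_equality) (auto intro: lam_eigenvalue eigenvalue_le)

end

section \<open>Integrals over the triangle below the diagonal\<close>

text \<open>The density \<open>(x - y) powr e * x powr a * (1 - y) powr b\<close> on the triangle \<open>y < x\<close>. The reflection
  \<open>(x, y) \<mapsto> (1 - y, 1 - x)\<close> of the triangle exchanges \<open>a\<close> and \<open>b\<close>.\<close>
definition Hf :: "real \<Rightarrow> real \<Rightarrow> real \<Rightarrow> real \<times> real \<Rightarrow> real" where
  "Hf e a b p = tk e (fst p) (snd p) * fst p powr a * (1 - snd p) powr b"

definition Fint :: "real \<Rightarrow> real \<Rightarrow> real \<Rightarrow> real" where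
  "Fint e a b = (\<integral>p. Hf e a b p \<partial>(M01 \<Otimes>\<^sub>M M01))"

lemma Hf_nonneg [simp]: "0 \<le> Hf e a b p" by (simp add: Hf_def)

lemma Hf_measurable [measurable]: "Hf e a b \<in> borel_measurable (M01 \<Otimes>\<^sub>M M01)"
  unfolding Hf_def by measurable

lemma space_MM: "space (M01 \<Otimes>\<^sub>M M01) = {0<..<1} \<times> {0<..<1}"
  by (simp add: space_pair_measure)

lemma nn_Hf_x_first:
  "(\<integral>\<^sup>+p. ennreal (Hf e a b p) \<partial>(M01 \<Otimes>\<^sub>M M01)) = (\<integral>\<^sup>+y. ennreal ((1 - y) powr b) * (\<integral>\<^sup>+x. ennreal (tk e x y * x powr a) \<partial>M01) \<partial>M01)"
proof -
  have "(\<integral>\<^sup>+p. ennreal (Hf e a b p) \<partial>(M01 \<Otimes>\<^sub>M M01)) = (\<integral>\<^sup>+y. (\<integral>\<^sup>+x. ennreal (Hf e a b (x, y)) \<partial>M01) \<partial>M01)"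
    by (rule MM.nn_integral_snd[symmetric]) measurable
  also have "\<dots> = (\<integral>\<^sup>+y. ennreal ((1 - y) powr b) * (\<integral>\<^sup>+x. ennreal (tk e x y * x powr a) \<partial>M01) \<partial>M01)"
    by (intro nn_integral_cong, subst nn_integral_cmult[symmetric])
       (auto simp: Hf_def ennreal_mult'[symmetric] mult_ac intro!: borel_measurable_M01 nn_integral_cong)
  finally show ?thesis .
qed

lemma nn_Hf_y_first:
  "(\<integral>\<^sup>+p. ennreal (Hf e a b p) \<partial>(M01 \<Otimes>\<^sub>M M01)) = (\<integral>\<^sup>+x. ennreal (x powr a) * (\<integral>\<^sup>+y. ennreal (tk e x y * (1 - y) powr b) \<partial>M01) \<partial>M01)"
proof -
  have "(\<integral>\<^sup>+p. ennreal (Hf e a b p) \<partial>(M01 \<Otimes>\<^sub>M M01)) = (\<integral>\<^sup>+x. (\<integral>\<^sup>+y. ennreal (Hf e a b (x, y)) \<partial>M01) \<partial>M01)"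
    by (rule M01.nn_integral_fst[symmetric]) measurable
  also have "\<dots> = (\<integral>\<^sup>+x. ennreal (x powr a) * (\<integral>\<^sup>+y. ennreal (tk e x y * (1 - y) powr b) \<partial>M01) \<partial>M01)"
    by (intro nn_integral_cong, subst nn_integral_cmult[symmetric])
       (auto simp: Hf_def ennreal_mult'[symmetric] mult_ac intro!: borel_measurable_M01 nn_integral_cong)
  finally show ?thesis .
qed

lemma nn_Hf_sym:
  "(\<integral>\<^sup>+p. ennreal (Hf e a b p) \<partial>(M01 \<Otimes>\<^sub>M M01)) = (\<integral>\<^sup>+p. ennreal (Hf e b a p) \<partial>(M01 \<Otimes>\<^sub>M M01))"
proof -
  have inner: "(\<integral>\<^sup>+x. ennreal (tk e x (1 - y) * x powr a) \<partial>M01) = (\<integral>\<^sup>+x. ennreal (tk e y x * (1 - x) powr a) \<partial>M01)" for y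
    by (subst nn_integral_M01_reflect) (auto simp: tk_reflect)
  have m: "(\<lambda>y. \<integral>\<^sup>+x. ennreal (tk e x y * x powr a) \<partial>M01) \<in> borel_measurable borel"
    by (rule M01.borel_measurable_nn_integral)
       (auto simp: tk_def split_def intro!: measurable_If)
  show ?thesis
    unfolding nn_Hf_x_first[of e a b] nn_Hf_y_first[of e b a]
    by (subst nn_integral_M01_reflect) (auto simp: inner intro!: borel_measurable_times_ennreal m)
qed

text \<open>Conditions under which the triangle integral is shown to converge. The first three concern the diagonal and the corners
  \<open>(0, 0)\<close> and \<open>(1, 1)\<close>. The last two allow a reduction, by trading powers, to a density with separately integrable factors.\<close>
definition dom :: "real \<Rightarrow> real \<Rightarrow> real \<Rightarrow> bool" where
  "dom e a b \<longleftrightarrow> e > -1 \<and> a + e > -2 \<and> b + e > -2 \<and> a + b + e > -2 \<and> (a + e > -1 \<or> b + e > -1)"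

lemma Beta_1_right: "Beta 1 (c::real) = 1 / c" if "c > 0"
proof -
  have "Gamma (c + 1) = c * Gamma c" using that by (intro Gamma_plus1) (auto elim!: nonpos_Ints_cases)
  moreover have "Gamma c \<noteq> 0" using less_imp_neq[OF Gamma_real_pos[OF that]] by metis
  ultimately show ?thesis using that by (simp add: Beta_def add.commute)
qed

lemma nn_tk:
  assumes "e > -1" "0 < y" "y < 1"
  shows "(\<integral>\<^sup>+x. ennreal (tk e x y) \<partial>M01) = ennreal ((1 - y) powr (e + 1) / (e + 1))"
proof -
  have "Beta (e + 1) 1 = 1 / (e + 1)" using Beta_1_right[of "e + 1"] assms by (simp add: Beta_commute)
  have "(\<integral>\<^sup>+x. ennreal (tk e x y) \<partial>M01) = (\<integral>\<^sup>+x. ennreal (tk e (1 - y) x * x powr 0) \<partial>M01)"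
    by (subst nn_integral_M01_reflect) (auto simp: tk_reflect'[of _ _ y] intro!: nn_integral_cong)
  also have "\<dots> = ennreal (Beta (e + 1) (0 + 1) * (1 - y) powr (0 + e + 1))"
    using assms by (intro nn_integral_tk_powr) auto
  finally show ?thesis using \<open>Beta (e + 1) 1 = _\<close> by simp
qed

lemma integrable_Hf_base:
  assumes "e > -1" "a \<ge> 0" "b > -1"
  shows "integrable (M01 \<Otimes>\<^sub>M M01) (Hf e a b)"
proof (rule integrableI_nonneg)
  have "(\<integral>\<^sup>+p. ennreal (Hf e a b p) \<partial>(M01 \<Otimes>\<^sub>M M01)) \<le> (\<integral>\<^sup>+y. ennreal ((1/(e+1)) * (y powr 0 * (1 - y) powr (b + e + 1))) \<partial>M01)"
    unfolding nn_Hf_x_first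
  proof (rule nn_integral_mono)
    fix y assume "y \<in> space M01"
    then have y: "0 < y" "y < 1" by auto
    have "(\<integral>\<^sup>+x. ennreal (tk e x y * x powr a) \<partial>M01) \<le> (\<integral>\<^sup>+x. ennreal (tk e x y) \<partial>M01)"
      using assms by (intro nn_integral_mono ennreal_leI) (auto intro!: mult_left_le powr_le1)
    then have "ennreal ((1 - y) powr b) * (\<integral>\<^sup>+x. ennreal (tk e x y * x powr a) \<partial>M01) \<le> ennreal ((1 - y) powr b) * ennreal ((1 - y) powr (e + 1) / (e + 1))"
      unfolding nn_tk[OF assms(1) y] by (rule mult_left_mono) simp
    also have "\<dots> = ennreal ((1/(e+1)) * (y powr 0 * (1 - y) powr (b + e + 1)))"
      using assms y by (simp add: ennreal_mult'[symmetric] powr_add[of _ b] add.assoc)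
    finally show "ennreal ((1 - y) powr b) * (\<integral>\<^sup>+x. ennreal (tk e x y * x powr a) \<partial>M01) \<le> \<dots>" .
  qed
  also have "\<dots> = ennreal (1/(e+1)) * (\<integral>\<^sup>+y. ennreal (y powr 0 * (1 - y) powr (b + e + 1)) \<partial>M01)"
    using assms by (subst nn_integral_cmult[symmetric]) (auto simp: ennreal_mult'[symmetric] intro!: nn_integral_cong)
  also have "\<dots> = ennreal (1/(e+1)) * ennreal (Beta (0 + 1) (b + e + 1 + 1))"
    using assms by (subst nn_integral_Beta) auto
  also have "\<dots> < \<infinity>" by (simp add: ennreal_mult_less_top)
  finally show "(\<integral>\<^sup>+p. ennreal (Hf e a b p) \<partial>(M01 \<Otimes>\<^sub>M M01)) < \<infinity>" .
qed auto

text \<open>Powers of \<open>x - y\<close> can be traded for powers of \<open>x\<close> or of \<open>1 - y\<close>, since \<open>x - y\<close> is below both on the triangle. This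
  reduces integrability to a case with nonnegative exponents and bounds the remainders of the recursion.\<close>
lemma Hf_antimono:
  assumes "p \<in> space (M01 \<Otimes>\<^sub>M M01)" "0 \<le> i" "0 \<le> j"
  shows "Hf (e + i + j) (a - i) (b - j) p \<le> Hf e a b p"
proof -
  obtain x y where p: "p = (x, y)" "0 < x" "x < 1" "0 < y" "y < 1" using assms by (auto simp: space_MM)
  show ?thesis
  proof (cases "y < x")
    case True
    have 1: "(x - y) powr i * x powr (a - i) \<le> x powr a"
    proof -
      have "(x - y) powr i * x powr (a - i) \<le> x powr i * x powr (a - i)"
        using p assms True by (intro mult_right_mono powr_mono2) auto
      then show ?thesis by (simp flip: powr_add)
    qed
    have 2: "(x - y) powr j * (1 - y) powr (b - j) \<le> (1 - y) powr b"
    proof -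
      have "(x - y) powr j * (1 - y) powr (b - j) \<le> (1 - y) powr j * (1 - y) powr (b - j)"
        using p assms True by (intro mult_right_mono powr_mono2) auto
      then show ?thesis by (simp flip: powr_add)
    qed
    have "Hf (e + i + j) (a - i) (b - j) p = (x - y) powr e * (((x - y) powr i * x powr (a - i)) * ((x - y) powr j * (1 - y) powr (b - j)))"
      using True p by (simp add: Hf_def tk_def powr_add mult_ac)
    also have "\<dots> \<le> (x - y) powr e * (x powr a * (1 - y) powr b)"
      using 1 2 by (intro mult_left_mono mult_mono) auto
    also have "\<dots> = Hf e a b p" using True p by (simp add: Hf_def tk_def)
    finally show ?thesis .
  qed (simp add: p Hf_def tk_def)
qed

lemma integrable_Hf_aux:
  assumes d: "e > -1" "a + e > -1" "b + e > -2" "a + b + e > -2"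
  shows "integrable (M01 \<Otimes>\<^sub>M M01) (Hf e a b)"
proof -
  \<comment> \<open>Lower the exponent \<open>e\<close> by \<open>i + j\<close> to make \<open>a\<close> nonnegative and \<open>b\<close> larger than \<open>-1\<close>.\<close>
  define i where "i = max 0 (-a)"
  have "max 0 (-1 - b) < e + 1 - i" using d by (auto simp: i_def max_def)
  then obtain j where j: "max 0 (-1 - b) < j" "j < e + 1 - i" using dense by blast
  have "integrable (M01 \<Otimes>\<^sub>M M01) (Hf (e - i - j) (a + i) (b + j))"
    using j by (intro integrable_Hf_base) (auto simp: i_def)
  then show ?thesis
  proof (rule Bochner_Integration.integrable_bound)
    have "norm (Hf e a b p) \<le> norm (Hf (e - i - j) (a + i) (b + j) p)" if "p \<in> space (M01 \<Otimes>\<^sub>M M01)" for p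
      using Hf_antimono[OF that, of i j "e - i - j" "a + i" "b + j"] j by (simp add: i_def)
    then show "AE p in M01 \<Otimes>\<^sub>M M01. norm (Hf e a b p) \<le> norm (Hf (e - i - j) (a + i) (b + j) p)" by (rule AE_I2)
  qed auto
qed

lemma integrable_Hf:
  assumes "dom e a b"
  shows "integrable (M01 \<Otimes>\<^sub>M M01) (Hf e a b)"
proof (cases "a + e > -1")
  case True
  then show ?thesis using assms by (intro integrable_Hf_aux) (auto simp: dom_def)
next
  case False
  then have "integrable (M01 \<Otimes>\<^sub>M M01) (Hf e b a)" using assms by (intro integrable_Hf_aux) (auto simp: dom_def)
  then show ?thesis using nn_Hf_sym[of e a b] by (simp add: integrable_iff_bounded)
qed

lemma ennreal_Fint: "dom e a b \<Longrightarrow> (\<integral>\<^sup>+p. ennreal (Hf e a b p) \<partial>(M01 \<Otimes>\<^sub>M M01)) = ennreal (Fint e a b)"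
  unfolding Fint_def by (intro nn_integral_eq_integral integrable_Hf) auto

lemma Fint_nonneg [simp]: "0 \<le> Fint e a b"
  unfolding Fint_def by (rule integral_nonneg_AE) auto

lemma Fint_sym: assumes "dom e a b" shows "Fint e a b = Fint e b a"
proof -
  have "dom e b a" using assms by (auto simp: dom_def)
  then show ?thesis using nn_Hf_sym[of e a b] ennreal_Fint[OF assms] ennreal_Fint[of e b a] by simp
qed

lemma Fint_antimono:
  assumes "dom e a b" "0 \<le> i" "0 \<le> j"
  shows "Fint (e + i + j) (a - i) (b - j) \<le> Fint e a b"
  unfolding Fint_def
proof (rule integral_mono)
  show "integrable (M01 \<Otimes>\<^sub>M M01) (Hf (e + i + j) (a - i) (b - j))"
    using assms by (intro integrable_Hf) (auto simp: dom_def)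
qed (use assms in \<open>auto intro!: integrable_Hf Hf_antimono\<close>)

definition Jint :: "real \<Rightarrow> real \<Rightarrow> real \<Rightarrow> real" where
  "Jint e a y = (\<integral>x. tk e x y * x powr a \<partial>M01)"

lemma integrable_tk_powr:
  assumes "e > -1" "0 < y" "y < 1"
  shows "integrable M01 (\<lambda>x. tk e x y * x powr a)"
proof (rule Bochner_Integration.integrable_bound[of _ "\<lambda>x. max 1 (y powr a) * tk e x y"])
  have "integrable M01 (\<lambda>x. tk e x y)"
    by (rule integrableI_nonneg) (auto intro!: borel_measurable_M01 simp: nn_tk[OF assms])
  then show "integrable M01 (\<lambda>x. max 1 (y powr a) * tk e x y)" by simp
  have "x powr a \<le> max 1 (y powr a)" if "y < x" "x < 1" for x
  proof (cases "0 \<le> a")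
    case True then show ?thesis using that assms by (auto simp: le_max_iff_disj intro!: disjI1 powr_le1)
  next
    case False then show ?thesis using that assms powr_mono2'[of a y x] by (auto simp: le_max_iff_disj)
  qed
  then show "AE x in M01. norm (tk e x y * x powr a) \<le> norm (max 1 (y powr a) * tk e x y)"
    by (intro AE_I2) (auto simp: tk_def abs_mult mult.commute intro!: mult_right_mono)
qed (auto intro!: borel_measurable_M01)

lemma has_integral_M01:
  fixes f :: "real \<Rightarrow> real"
  assumes "integrable M01 f"
  shows "(f has_integral (\<integral>x. f x \<partial>M01)) {0<..<1}"
proof -
  have "set_integrable lborel {0<..<1} f"
    using assms integrable_restrict_space[of "{0<..<1::real}" lborel f] by (simp add: set_integrable_def)
  then have "(f has_integral (LINT x:{0<..<1}|lborel. f x)) {0<..<1}"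
    using set_borel_integral_eq_integral[of "{0<..<1}" f] by (auto simp: has_integral_iff)
  then show ?thesis
    by (subst integral_restrict_space) (auto simp: set_lebesgue_integral_def)
qed


lemma integral_powr_reflect:
  assumes "c > -1"
  shows "integrable M01 (\<lambda>y. (1 - y) powr c)" "(\<integral>y. (1 - y) powr c \<partial>M01) = 1 / (c + 1)"
proof -
  have "(\<integral>\<^sup>+y. ennreal ((1 - y) powr c) \<partial>M01) = (\<integral>\<^sup>+y. ennreal (y powr 0 * (1 - y) powr c) \<partial>M01)"
    by (intro nn_integral_cong) auto
  also have "\<dots> = ennreal (1 / (c + 1))"
    using assms nn_integral_Beta[of 0 c] Beta_1_right[of "c + 1"] by simp
  finally have *: "(\<integral>\<^sup>+y. ennreal ((1 - y) powr c) \<partial>M01) = ennreal (1 / (c + 1))" .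
  show "integrable M01 (\<lambda>y. (1 - y) powr c)" by (rule integrableI_nonneg) (auto simp: *)
  show "(\<integral>y. (1 - y) powr c \<partial>M01) = 1 / (c + 1)"
    using assms by (subst integral_eq_nn_integral) (auto simp: *)
qed

text \<open>Integration by parts, as the fundamental theorem for \<open>x powr a * (x - y) powr (e + 1)\<close> on \<open>[y, 1]\<close>.\<close>
lemma Jint_peel:
  assumes e: "e > -1" and y: "0 < y" "y < 1"
  shows "(e + 1) * Jint e a y + a * Jint (e + 1) (a - 1) y = (1 - y) powr (e + 1)"
proof -
  let ?g = "\<lambda>x. (e + 1) * (tk e x y * x powr a) + a * (tk (e + 1) x y * x powr (a - 1))"
  have i: "integrable M01 (\<lambda>x. tk e x y * x powr a)" "integrable M01 (\<lambda>x. tk (e + 1) x y * x powr (a - 1))"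
    using e y by (auto intro!: integrable_tk_powr)
  have "(?g has_integral (\<integral>x. ?g x \<partial>M01)) {0<..<1}"
    using i by (intro has_integral_M01) auto
  moreover have "(\<integral>x. ?g x \<partial>M01) = (e + 1) * Jint e a y + a * Jint (e + 1) (a - 1) y"
    using i by (simp add: Jint_def)
  moreover have "(?g has_integral (1 - y) powr (e + 1)) {0<..<1}"
  proof -
    let ?f = "\<lambda>x. x powr a * (x - y) powr (e + 1)"
    have "(?g has_integral (?f 1 - ?f y)) {y..1}"
    proof (rule fundamental_theorem_of_calculus_interior)
      show "continuous_on {y..1} ?f" using e y by (intro continuous_on_mult continuous_on_powr' continuous_intros) auto
      fix x assume x: "x \<in> {y<..<1}"
      have "(?f has_real_derivative (a * x powr (a - 1) * (x - y) powr (e + 1) + ((e + 1) * (x - y) powr e) * x powr a)) (at x)"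
        using x y by (auto intro!: derivative_eq_intros)
      then show "(?f has_vector_derivative ?g x) (at x)"
        using x by (simp add: tk_def has_real_derivative_iff_has_vector_derivative[symmetric] mult_ac add_ac)
    qed (use y in auto)
    then have "(?g has_integral ((1 - y) powr (e + 1))) {y<..<1}" by (simp add: has_integral_Icc_iff_Ioo)
    then have "((\<lambda>x. if x \<in> {y<..<1} then ?g x else 0) has_integral ((1 - y) powr (e + 1))) UNIV"
      by (simp only: has_integral_restrict_UNIV)
    moreover have "(\<lambda>x. if x \<in> {y<..<1} then ?g x else 0) = (\<lambda>x. if x \<in> {0<..<1} then ?g x else 0)"
      using y by (auto simp: tk_def fun_eq_iff)
    ultimately show ?thesis by (simp only: has_integral_restrict_UNIV)
  qed
  ultimately show ?thesis using has_integral_unique[of ?g "\<integral>x. ?g x \<partial>M01" "{0<..<1}" "(1 - y) powr (e + 1)"] by simp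
qed

lemma Fint_Jint:
  assumes "dom e a b"
  shows "integrable M01 (\<lambda>y. (1 - y) powr b * Jint e a y)" "Fint e a b = (\<integral>y. (1 - y) powr b * Jint e a y \<partial>M01)"
proof -
  have eq: "(\<integral>x. Hf e a b (x, y) \<partial>M01) = (1 - y) powr b * Jint e a y" for y
    by (simp add: Jint_def Hf_def mult.commute[of _ "(1 - y) powr b"])
  have i: "integrable (M01 \<Otimes>\<^sub>M M01) (\<lambda>(x, y). Hf e a b (x, y))" using integrable_Hf[OF assms] by simp
  show "integrable M01 (\<lambda>y. (1 - y) powr b * Jint e a y)" using MM.integrable_snd[OF i] by (simp add: eq)
  show "Fint e a b = (\<integral>y. (1 - y) powr b * Jint e a y \<partial>M01)" using MM.integral_snd[OF i] by (simp add: eq Fint_def)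
qed

lemma dom_peel: "dom e a b \<Longrightarrow> dom (e + 1) (a - 1) b" "dom e a b \<Longrightarrow> dom (e + 1) a (b - 1)"
  "dom e a b \<Longrightarrow> dom (e + 1) a b" "dom e a b \<Longrightarrow> dom e (a + 1) b" "dom e a b \<Longrightarrow> dom e a (b + 1)" "dom e a b \<Longrightarrow> dom e b a"
  by (auto simp: dom_def)

lemma Fint_peel:
  assumes "dom e a b"
  shows "(e + 1) * Fint e a b + a * Fint (e + 1) (a - 1) b = 1 / (b + e + 2)"
proof -
  have e: "e > -1" and be: "b + e + 1 > -1" using assms by (auto simp: dom_def)
  note i = Fint_Jint[OF assms] Fint_Jint[OF dom_peel(1)[OF assms]]
  have "(e + 1) * Fint e a b + a * Fint (e + 1) (a - 1) b = (\<integral>y. (e + 1) * ((1 - y) powr b * Jint e a y) + a * ((1 - y) powr b * Jint (e + 1) (a - 1) y) \<partial>M01)"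
    using i by simp
  also have "\<dots> = (\<integral>y. (1 - y) powr (b + e + 1) \<partial>M01)"
  proof (rule Bochner_Integration.integral_cong)
    fix y assume "y \<in> space M01"
    then have y: "0 < y" "y < 1" by auto
    have "(e + 1) * ((1 - y) powr b * Jint e a y) + a * ((1 - y) powr b * Jint (e + 1) (a - 1) y) = (1 - y) powr b * ((e + 1) * Jint e a y + a * Jint (e + 1) (a - 1) y)"
      by (simp add: algebra_simps)
    also have "\<dots> = (1 - y) powr (b + e + 1)" unfolding Jint_peel[OF e y] by (simp add: powr_add[symmetric] add.assoc)
    finally show "(e + 1) * ((1 - y) powr b * Jint e a y) + a * ((1 - y) powr b * Jint (e + 1) (a - 1) y) = (1 - y) powr (b + e + 1)" .
  qed simp
  also have "\<dots> = 1 / (b + e + 2)" using integral_powr_reflect(2)[OF be] by (simp add: add.assoc)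
  finally show ?thesis .
qed

lemma Fint_peel':
  assumes "dom e a b"
  shows "(e + 1) * Fint e a b + b * Fint (e + 1) a (b - 1) = 1 / (a + e + 2)"
  using Fint_peel[OF dom_peel(6)[OF assms]] Fint_sym[OF assms] Fint_sym[OF dom_peel(2)[OF assms]] by simp

text \<open>From \<open>x - y = x + (1 - y) - 1\<close>.\<close>
lemma Fint_raise:
  assumes "dom e a b"
  shows "Fint (e + 1) a b = Fint e (a + 1) b - Fint e a b + Fint e a (b + 1)"
proof -
  note i = integrable_Hf[OF assms] integrable_Hf[OF dom_peel(4)[OF assms]] integrable_Hf[OF dom_peel(5)[OF assms]]
  have "Fint e (a + 1) b - Fint e a b + Fint e a (b + 1) = (\<integral>p. Hf e (a + 1) b p - Hf e a b p + Hf e a (b + 1) p \<partial>(M01 \<Otimes>\<^sub>M M01))"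
    using i by (simp add: Fint_def)
  also have "\<dots> = Fint (e + 1) a b"
    unfolding Fint_def
  proof (rule Bochner_Integration.integral_cong)
    fix p assume "p \<in> space (M01 \<Otimes>\<^sub>M M01)"
    then obtain x y where p: "p = (x, y)" "0 < x" "x < 1" "0 < y" "y < 1" by (auto simp: space_MM)
    show "Hf e (a + 1) b p - Hf e a b p + Hf e a (b + 1) p = Hf (e + 1) a b p"
      using p by (auto simp: Hf_def tk_def powr_add algebra_simps)
  qed simp
  finally show ?thesis by simp
qed

text \<open>Eliminate the integrals with exponent \<open>e + 1\<close> between the two integrations by parts and the identity
  \<open>x - y = x + (1 - y) - 1\<close>. The resulting recursion raises \<open>b\<close> alone and fills whole tables from four initial columns.\<close>
lemma Fint_rec:
  assumes "dom e a b"
  shows "(a + b + e + 3) * Fint e a (b + 1) = (b + 1) * Fint e a b + 1 / (b + e + 2)"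
proof -
  have pos: "e + 1 > 0" "a + e + 2 > 0" "b + e + 2 > 0" using assms by (auto simp: dom_def)
  define E F Fa Fb u v where "E = Fint (e + 1) a b" "F = Fint e a b" "Fa = Fint e (a + 1) b" "Fb = Fint e a (b + 1)"
    "u = 1 / (a + e + 2)" "v = 1 / (b + e + 2)"
  note ds = this
  have 1: "(e + 1) * Fa + (a + 1) * E = v"
    using Fint_peel[OF dom_peel(4)[OF assms]] by (simp add: ds)
  have 2: "(e + 1) * Fb + (b + 1) * E = u"
    using Fint_peel'[OF dom_peel(5)[OF assms]] by (simp add: ds)
  have 3: "E = Fa - F + Fb" using Fint_raise[OF assms] by (simp add: ds)
  have u: "(a + e + 2) * u = 1" and v: "(b + e + 2) * v = 1" using pos by (simp_all add: ds)
  have "(e + 1) * ((a + b + e + 3) * Fb) = (e + 1) * ((b + 1) * F + v)"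
  proof -
    have "(e + 1) * E = (e + 1) * Fa - (e + 1) * F + (e + 1) * Fb" unfolding 3 by (simp add: algebra_simps)
    then have "(a + b + e + 3) * E = u + v - (e + 1) * F" using 1 2 by (simp add: algebra_simps)
    then have "(b + 1) * ((a + b + e + 3) * E) = (b + 1) * (u + v - (e + 1) * F)" by simp
    moreover have "(a + b + e + 3) * ((e + 1) * Fb + (b + 1) * E) = (a + b + e + 3) * u" using 2 by simp
    ultimately have "(a + b + e + 3) * ((e + 1) * Fb) = (a + e + 2) * u - (b + 1) * v + (b + 1) * ((e + 1) * F)"
      by (simp add: algebra_simps)
    also have "\<dots> = (b + e + 2) * v - (b + 1) * v + (b + 1) * ((e + 1) * F)" unfolding u v ..
    finally show ?thesis by (simp add: algebra_simps)
  qed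
  then have "(a + b + e + 3) * Fb = (b + 1) * F + v" using pos by simp
  then show ?thesis by (simp add: ds)
qed

text \<open>The normalization \<open>(e + 1) Fint e a b\<close> extends continuously to \<open>e = -1\<close>, where the density concentrates on the
  diagonal and leaves a Beta integral. With it, Beta values and the singular integrals obey the same recursions and one
  algorithm computes both.\<close>
definition Gf :: "real \<Rightarrow> real \<Rightarrow> real \<Rightarrow> real" where
  "Gf e a b = (if e = -1 then Beta (a + 1) (b + 1) else (e + 1) * Fint e a b)"

lemma Gf_rec:
  assumes "e = -1 \<and> a > -1 \<and> b > -1 \<or> dom e a b"
  shows "(a + b + e + 3) * Gf e a (b + 1) = (b + 1) * Gf e a b + (e + 1) / (b + e + 2)"
proof (cases "e = -1")
  case True
  then have "a > -1" "b > -1" using assms by (auto simp: dom_def)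
  moreover have "b + 1 \<notin> \<int>\<^sub>\<le>\<^sub>0" using \<open>b > -1\<close> by (auto elim!: nonpos_Ints_cases)
  from Beta_plus1_right[OF this, of "a + 1"] have "(a + b + 2) * Beta (a + 1) (b + 1 + 1) = (b + 1) * Beta (a + 1) (b + 1)"
    by (simp add: add_ac)
  ultimately show ?thesis using True by (simp add: Gf_def add_ac)
next
  case False
  then have "dom e a b" using assms by auto
  then have "(e + 1) * ((a + b + e + 3) * Fint e a (b + 1)) = (e + 1) * ((b + 1) * Fint e a b + 1 / (b + e + 2))"
    by (simp only: Fint_rec)
  then have "(a + b + e + 3) * ((e + 1) * Fint e a (b + 1)) = (b + 1) * ((e + 1) * Fint e a b) + (e + 1) / (b + e + 2)"
    by (simp only: distrib_left[of "e + 1" "(b + 1) * Fint e a b"] mult.left_commute[of "e + 1"] times_divide_eq_right mult_1_right)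
  then show ?thesis using False by (simp only: Gf_def if_False)
qed

text \<open>One integration by parts in each variable. The factor in front of the remainder is about \<open>1/4\<close> when iterated, so
  the expansion converges geometrically.\<close>
lemma Gf_peel2:
  assumes "dom e a b"
  shows "Gf e a b = 1 / (b + e + 2) - a / ((e + 2) * (a + e + 2)) + a * b / ((e + 2) * (e + 3)) * Gf (e + 2) (a - 1) (b - 1)"
proof -
  have pos: "e > -1" "a + e + 2 > 0" using assms by (auto simp: dom_def)
  have 1: "(e + 1) * Fint e a b + a * Fint (e + 1) (a - 1) b = 1 / (b + e + 2)" by (rule Fint_peel[OF assms])
  have 2: "(e + 2) * Fint (e + 1) (a - 1) b + b * Fint (e + 2) (a - 1) (b - 1) = 1 / (a + e + 2)"
    using Fint_peel'[OF dom_peel(1)[OF assms]] by (simp add: add_ac)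
  then have "Fint (e + 1) (a - 1) b = (1 / (a + e + 2) - b * Fint (e + 2) (a - 1) (b - 1)) / (e + 2)"
  proof -
    have "(e + 2) * Fint (e + 1) (a - 1) b = 1 / (a + e + 2) - b * Fint (e + 2) (a - 1) (b - 1)" using 2 by linarith
    moreover have "e + 2 \<noteq> 0" using pos by linarith
    ultimately show ?thesis by (metis nonzero_mult_div_cancel_left)
  qed
  with 1 have "(e + 1) * Fint e a b = 1 / (b + e + 2) - a * ((1 / (a + e + 2) - b * Fint (e + 2) (a - 1) (b - 1)) / (e + 2))"
    by simp
  also have "\<dots> = 1 / (b + e + 2) - a / ((e + 2) * (a + e + 2)) + a * b / ((e + 2) * (e + 3)) * ((e + 3) * Fint (e + 2) (a - 1) (b - 1))"
    using pos by (simp add: divide_simps) (simp add: algebra_simps)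
  finally show ?thesis using pos by (simp add: Gf_def add_ac)
qed

text \<open>The boundary case \<open>e = -1\<close>, where the first integration by parts has to be replaced by the exact value of
  the inner integral.\<close>
lemma Gf_peel2_Beta:
  assumes a: "0 < a" and b: "b > -1"
  shows "Gf (-1) a b = 1 / (b + 1) - a / (a + 1) + a * b / 2 * Gf 1 (a - 1) (b - 1)"
    and "Fint 0 (a - 1) b \<le> 1 / (a * (b + 1))"
proof -
  have d: "dom 0 (a - 1) b" using a b by (auto simp: dom_def)
  have J: "Jint 0 (a - 1) y = (1 - y powr a) / a" if y: "0 < y" "y < 1" for y
  proof -
    have "integrable M01 (\<lambda>x. tk 0 x y * x powr (a - 1))" using y by (intro integrable_tk_powr) auto
    from has_integral_M01[OF this] have 1: "((\<lambda>x. tk 0 x y * x powr (a - 1)) has_integral Jint 0 (a - 1) y) {0<..<1}" by (simp add: Jint_def)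
    let ?g = "\<lambda>x. tk 0 x y * x powr (a - 1)"
    have "((\<lambda>x. x powr (a - 1)) has_integral (1 powr a / a - y powr a / a)) {y..1}"
    proof (rule fundamental_theorem_of_calculus)
      fix x assume "x \<in> {y..1}"
      then have "((\<lambda>x. x powr a / a) has_real_derivative x powr (a - 1)) (at x within {y..1})"
        using y a by (auto intro!: derivative_eq_intros)
      then show "((\<lambda>x. x powr a / a) has_vector_derivative x powr (a - 1)) (at x within {y..1})"
        by (simp add: has_real_derivative_iff_has_vector_derivative)
    qed (use y in auto)
    then have "((\<lambda>x. x powr (a - 1)) has_integral ((1 - y powr a) / a)) {y<..<1}"
      by (simp add: has_integral_Icc_iff_Ioo diff_divide_distrib)
    then have "((\<lambda>x. if x \<in> {y<..<1} then x powr (a - 1) else 0) has_integral ((1 - y powr a) / a)) UNIV"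
      by (simp only: has_integral_restrict_UNIV)
    moreover have "(\<lambda>x. if x \<in> {y<..<1} then x powr (a - 1) else 0) = (\<lambda>x. if x \<in> {0<..<1} then ?g x else 0)"
      using y by (auto simp: tk_def fun_eq_iff)
    ultimately have "(?g has_integral ((1 - y powr a) / a)) {0<..<1}"
      by (simp only: has_integral_restrict_UNIV)
    with 1 show ?thesis by (rule has_integral_unique)
  qed
  have iB: "integrable M01 (\<lambda>x. x powr a * (1 - x) powr b)" "(\<integral>x. x powr a * (1 - x) powr b \<partial>M01) = Beta (a + 1) (b + 1)"
  proof -
    have n: "(\<integral>\<^sup>+x. ennreal (x powr a * (1 - x) powr b) \<partial>M01) = ennreal (Beta (a + 1) (b + 1))"
      using a b by (intro nn_integral_Beta) auto
    show "integrable M01 (\<lambda>x. x powr a * (1 - x) powr b)" by (rule integrableI_nonneg) (auto simp: n)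
    have "0 \<le> Beta (a + 1) (b + 1)" using a b by (simp add: Beta_def Gamma_real_pos less_imp_le)
    then show "(\<integral>x. x powr a * (1 - x) powr b \<partial>M01) = Beta (a + 1) (b + 1)"
      by (subst integral_eq_nn_integral) (auto simp: n)
  qed
  have "Fint 0 (a - 1) b = (\<integral>y. (1 - y) powr b * ((1 - y powr a) / a) \<partial>M01)"
    unfolding Fint_Jint(2)[OF d] by (rule Bochner_Integration.integral_cong) (auto simp: J)
  also have "\<dots> = (\<integral>y. ((1 - y) powr b - y powr a * (1 - y) powr b) / a \<partial>M01)"
    by (rule Bochner_Integration.integral_cong) (auto simp: field_simps)
  also have "\<dots> = (1 / (b + 1) - Beta (a + 1) (b + 1)) / a"
    using iB integral_powr_reflect[OF b] by simp
  finally have F0: "Fint 0 (a - 1) b = (1 / (b + 1) - Beta (a + 1) (b + 1)) / a" .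
  have "0 \<le> Beta (a + 1) (b + 1)" using a b by (simp add: Beta_def Gamma_real_pos less_imp_le)
  then show "Fint 0 (a - 1) b \<le> 1 / (a * (b + 1))"
    unfolding F0 using a b divide_right_mono[of "1 / (b + 1) - Beta (a + 1) (b + 1)" "1 / (b + 1)" a] by (simp add: mult.commute)
  have "Fint 0 (a - 1) b + b * Fint 1 (a - 1) (b - 1) = 1 / (a + 1)"
    using Fint_peel'[OF d] by simp
  moreover have "Beta (a + 1) (b + 1) = 1 / (b + 1) - a * Fint 0 (a - 1) b" using F0 a by simp
  ultimately have "Beta (a + 1) (b + 1) = 1 / (b + 1) - a * (1 / (a + 1) - b * Fint 1 (a - 1) (b - 1))" by simp
  then show "Gf (-1) a b = 1 / (b + 1) - a / (a + 1) + a * b / 2 * Gf 1 (a - 1) (b - 1)"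
    by (simp add: Gf_def right_diff_distrib)
qed

section \<open>Inner products of fractional integrals of powers\<close>

lemma integral_M01_reflect: "(\<integral>x. f (1 - x) \<partial>M01) = (\<integral>x. f x \<partial>M01)" for f :: "real \<Rightarrow> real"
proof -
  have "(\<integral>x. f x \<partial>M01) = (\<integral>x. indicator {0<..<1} x *\<^sub>R f x \<partial>lborel)"
    by (rule integral_restrict_space) auto
  also have "\<dots> = (\<integral>x. indicator {0<..<1} (1 + (-1) * x) *\<^sub>R f (1 + (-1) * x) \<partial>lborel)"
    by (subst lborel_integral_real_affine[of "-1" _ 1]) auto
  also have "\<dots> = (\<integral>x. indicator {0<..<1} x *\<^sub>R f (1 - x) \<partial>lborel)"
    by (rule Bochner_Integration.integral_cong) (auto split: split_indicator)
  also have "\<dots> = (\<integral>x. f (1 - x) \<partial>M01)"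
    by (rule integral_restrict_space[symmetric]) auto
  finally show ?thesis by simp
qed

lemma bm_reflect [bm_intros]: assumes "bm f" shows "bm (\<lambda>x. f (1 - x))"
proof -
  obtain C where C: "\<And>x. x \<in> {0<..<1} \<Longrightarrow> \<bar>f x\<bar> \<le> C" using bmD[OF assms] by blast
  have "(\<lambda>x. 1 - x) \<in> measurable M01 M01"
    by (rule measurable_restrict_space2) auto
  from measurable_compose[OF this bm_measurable[OF assms]] show ?thesis using C by (intro bmI[of _ C]) auto
qed

lemma bm_powr [bm_intros]: "a \<ge> 0 \<Longrightarrow> bm (\<lambda>x. x powr a)"
  by (rule bmI[of _ 1]) (auto intro: powr_le1)

lemma integral_of_nn:
  assumes "f \<in> borel_measurable M01" "\<And>x. 0 < x \<Longrightarrow> x < 1 \<Longrightarrow> 0 \<le> f x" "(\<integral>\<^sup>+x. ennreal (f x) \<partial>M01) = ennreal I" "0 \<le> I"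
  shows "(\<integral>x. f x \<partial>M01) = I"
  using assms by (subst integral_eq_nn_integral) (auto intro!: AE_I2)

lemma Beta_pos: "a > 0 \<Longrightarrow> b > 0 \<Longrightarrow> 0 < Beta a (b::real)"
  by (simp add: Beta_def Gamma_real_pos)

lemma integral_powr_powr: "a \<ge> 0 \<Longrightarrow> b \<ge> 0 \<Longrightarrow> (\<integral>x. x powr a * x powr b \<partial>M01) = 1 / (a + b + 1)"
  using integral_powr_reflect(2)[of "a + b"] integral_M01_reflect[of "\<lambda>x. x powr (a + b)"] by (simp add: powr_add)

lemma integral_powr_Beta:
  assumes "a > -1" "b > -1" shows "(\<integral>x. x powr a * (1 - x) powr b \<partial>M01) = Beta (a + 1) (b + 1)"
  using assms nn_integral_Beta[of a b] Beta_pos[of "a + 1" "b + 1"] by (intro integral_of_nn) (auto simp: less_imp_le)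

text \<open>The adjoint half-integral of a power.\<close>
abbreviation Jh :: "real \<Rightarrow> real \<Rightarrow> real" where "Jh \<equiv> Jint (-1/2)"

lemma Jh_measurable: "Jh a \<in> borel_measurable M01"
  unfolding Jint_def[abs_def] by (intro M01.borel_measurable_lebesgue_integral) (simp add: split_def tk_def)

lemma Jh_nonneg [simp]: "0 \<le> Jh a y"
  unfolding Jint_def by (rule integral_nonneg_AE) auto

lemmas Jh_nonneg' [simp] = Jh_nonneg[simplified]

lemma nn_Jh: "0 < y \<Longrightarrow> y < 1 \<Longrightarrow> (\<integral>\<^sup>+x. ennreal (kerp x y * x powr a) \<partial>M01) = ennreal (Jh a y)"
  unfolding Jint_def by (rule nn_integral_eq_integral) (auto intro!: integrable_tk_powr)

lemma bm_Jh [bm_intros]: assumes "a \<ge> 0" shows "bm (Jh a)"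
proof (rule bmI[OF Jh_measurable])
  fix y :: real assume y: "0 < y" "y < 1"
  have "ennreal (Jh a y) \<le> (\<integral>\<^sup>+x. ennreal (kerp x y) \<partial>M01)"
    unfolding nn_Jh[OF y, symmetric] using assms by (intro nn_integral_mono ennreal_leI) (auto intro!: mult_left_le powr_le1)
  also have "\<dots> = ennreal (2 * (1 - y) powr (1/2))" using nn_tk[of "-1/2" y] y by (simp add: mult.commute)
  finally have "Jh a y \<le> 2 * (1 - y) powr (1/2)" by simp
  also have "\<dots> \<le> 2 * 1" using y by (intro mult_left_mono powr_le1) auto
  finally show "\<bar>Jh a y\<bar> \<le> 2" using Jh_nonneg[of a y] by linarith
qed

lemma domW: "a \<ge> 0 \<Longrightarrow> b \<ge> -1/2 \<Longrightarrow> dom (-1/2) a b"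
  by (auto simp: dom_def)

text \<open>The only transcendental quantity besides Beta values that enters the inner products.\<close>
abbreviation Wf :: "real \<Rightarrow> real \<Rightarrow> real" where "Wf \<equiv> Fint (-1/2)"

lemma integral_powr_Jh_reflect:
  assumes "a \<ge> 0" "b \<ge> -1/2"
  shows "(\<integral>x. x powr b * Jh a (1 - x) \<partial>M01) = Wf a b"
  using Fint_Jint(2)[OF domW[OF assms]] integral_M01_reflect[of "\<lambda>x. x powr b * Jh a (1 - x)"] by simp

lemma integral_powr_Jh:
  assumes a: "a \<ge> 0" and c: "c \<ge> 0"
  shows "(\<integral>y. y powr c * Jh a y \<partial>M01) = beta c / (a + c + 3/2)"
proof (rule integral_of_nn)
  have "(\<integral>\<^sup>+y. ennreal (y powr c * Jh a y) \<partial>M01) = (\<integral>\<^sup>+y. (\<integral>\<^sup>+x. ennreal (kerp x y * x powr a * y powr c) \<partial>M01) \<partial>M01)"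
  proof (rule nn_integral_cong)
    fix y assume "y \<in> space M01"
    then have y: "0 < y" "y < 1" by auto
    have "ennreal (y powr c * Jh a y) = ennreal (y powr c) * (\<integral>\<^sup>+x. ennreal (kerp x y * x powr a) \<partial>M01)"
      by (simp only: nn_Jh[OF y] ennreal_mult'[OF powr_ge_zero])
    also have "\<dots> = (\<integral>\<^sup>+x. ennreal (y powr c) * ennreal (kerp x y * x powr a) \<partial>M01)"
      by (rule nn_integral_cmult[symmetric]) (auto intro!: borel_measurable_M01)
    finally show "ennreal (y powr c * Jh a y) = (\<integral>\<^sup>+x. ennreal (kerp x y * x powr a * y powr c) \<partial>M01)"
      by (simp add: ennreal_mult'[symmetric] mult_ac)
  qed
  also have "\<dots> = (\<integral>\<^sup>+x. (\<integral>\<^sup>+y. ennreal (kerp x y * x powr a * y powr c) \<partial>M01) \<partial>M01)"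
    by (rule MM.Fubini') (simp add: split_def tk_def)
  also have "\<dots> = (\<integral>\<^sup>+x. ennreal (beta c) * ennreal (x powr (a + c + 1/2)) \<partial>M01)"
  proof (rule nn_integral_cong)
    fix x assume "x \<in> space M01"
    then have x: "0 < x" "x < 1" by auto
    have "(\<integral>\<^sup>+y. ennreal (kerp x y * x powr a * y powr c) \<partial>M01) = (\<integral>\<^sup>+y. ennreal (x powr a) * ennreal (kerp x y * y powr c) \<partial>M01)"
      by (simp add: ennreal_mult'[symmetric] mult_ac)
    also have "\<dots> = ennreal (x powr a) * (\<integral>\<^sup>+y. ennreal (kerp x y * y powr c) \<partial>M01)"
      by (rule nn_integral_cmult) (auto intro!: borel_measurable_M01)
    also have "\<dots> = ennreal (x powr a) * ennreal (beta c * x powr (c + 1/2))"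
      using c x by (subst nn_integral_kerp_powr) auto
    also have "\<dots> = ennreal (beta c) * ennreal (x powr (a + c + 1/2))"
      using Beta_pos[of "1/2" "c + 1"] c by (simp add: ennreal_mult'[symmetric] powr_add mult_ac)
    finally show "(\<integral>\<^sup>+y. ennreal (kerp x y * x powr a * y powr c) \<partial>M01) = ennreal (beta c) * ennreal (x powr (a + c + 1/2))" .
  qed
  also have "\<dots> = ennreal (beta c) * (\<integral>\<^sup>+x. ennreal (x powr (a + c + 1/2)) \<partial>M01)"
    by (rule nn_integral_cmult) auto
  also have "(\<integral>\<^sup>+x. ennreal (x powr (a + c + 1/2)) \<partial>M01) = ennreal (1 / (a + c + 3/2))"
  proof -
    have "(\<integral>\<^sup>+x. ennreal (x powr (a + c + 1/2)) \<partial>M01) = (\<integral>\<^sup>+x. ennreal (x powr (a + c + 1/2) * (1 - x) powr 0) \<partial>M01)"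
      by (intro nn_integral_cong) auto
    then show ?thesis using a c nn_integral_Beta[of "a + c + 1/2" 0] Beta_1_right[of "a + c + 3/2"] by (simp add: Beta_commute add_ac)
  qed
  also have "ennreal (beta c) * ennreal (1 / (a + c + 3/2)) = ennreal (beta c / (a + c + 3/2))"
    using Beta_pos[of "1/2" "c + 1"] c a by (simp add: ennreal_mult'[symmetric])
  finally show "(\<integral>\<^sup>+y. ennreal (y powr c * Jh a y) \<partial>M01) = ennreal (beta c / (a + c + 3/2))" .
  show "0 \<le> beta c / (a + c + 3/2)" using Beta_pos[of "1/2" "c + 1"] c a by simp
qed (use Jh_measurable in auto)


text \<open>Homogeneity: scaling all variables by \<open>z\<close> multiplies the product of two kernels by \<open>1 / z\<close>, which the
  Jacobian compensates.\<close>
lemma nn_kk_scale: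
  assumes z: "0 < z" "z < 1" and s: "0 < s" "s < 1"
  shows "(\<integral>\<^sup>+y. ennreal (kerp (z * s) y * kerp z y) \<partial>M01) = (\<integral>\<^sup>+t. ennreal (kerp s t * (1 - t) powr (-1/2)) \<partial>M01)"
proof -
  have "(\<integral>\<^sup>+y. ennreal (kerp (z * s) y * kerp z y) \<partial>M01) = (\<integral>\<^sup>+y. ennreal (kerp (z * s) y * kerp z y) * indicator {..<z} y \<partial>M01)"
    using s z by (intro nn_integral_cong) (auto simp: tk_def split: split_indicator)
  also have "\<dots> = ennreal z * (\<integral>\<^sup>+t. ennreal (kerp (z * s) (z * t) * kerp z (z * t)) \<partial>M01)"
    using z by (intro nn_integral_M01_scale) auto
  also have "\<dots> = (\<integral>\<^sup>+t. ennreal z * ennreal (kerp (z * s) (z * t) * kerp z (z * t)) \<partial>M01)"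
    by (rule nn_integral_cmult[symmetric]) (auto simp: tk_def)
  also have "\<dots> = (\<integral>\<^sup>+t. ennreal (kerp s t * (1 - t) powr (-1/2)) \<partial>M01)"
  proof (rule nn_integral_cong)
    fix t assume "t \<in> space M01"
    then have t: "0 < t" "t < 1" by auto
    have "z * (kerp (z * s) (z * t) * kerp z (z * t)) = kerp s t * (1 - t) powr (-1/2)"
    proof (cases "t < s")
      case True
      have "z * s - z * t = z * (s - t)" "z - z * t = z * (1 - t)" by (simp_all add: algebra_simps)
      then have "kerp (z * s) (z * t) * kerp z (z * t) = (z powr (-1/2) * z powr (-1/2)) * ((s - t) powr (-1/2) * (1 - t) powr (-1/2))"
        using True t s z by (simp add: tk_def powr_mult mult_ac)
      also have "z powr (-1/2) * z powr (-1/2) = 1 / z" using z by (simp add: powr_minus_divide flip: powr_add)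
      finally show ?thesis using True z by (simp add: tk_def)
    qed (use z in \<open>simp add: tk_def\<close>)
    then show "ennreal z * ennreal (kerp (z * s) (z * t) * kerp z (z * t)) = ennreal (kerp s t * (1 - t) powr (-1/2))"
      using z by (simp add: ennreal_mult'[symmetric])
  qed
  finally show ?thesis .
qed

lemma nn_kk_measurable [measurable]:
  "(\<lambda>x. \<integral>\<^sup>+y. ennreal (kerp x y * kerp z y) \<partial>M01) \<in> borel_measurable borel"
  by (rule M01.borel_measurable_nn_integral) (auto simp: tk_def split_def intro!: measurable_If)

lemmas nn_kk_measurable' [measurable] = nn_kk_measurable[simplified]

text \<open>On \<open>x < z\<close> the product of two half-integral kernels is homogeneous, so the substitution \<open>x = z s\<close> separates the variables
  and the outer integral becomes elementary.\<close>
lemma nn_half: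
  assumes a: "a \<ge> 0" and b: "b \<ge> 0"
  shows "(\<integral>\<^sup>+z. ennreal (z powr b) * (\<integral>\<^sup>+x. ennreal (x powr a) * (\<integral>\<^sup>+y. ennreal (kerp x y * kerp z y) \<partial>M01) * indicator {..<z} x \<partial>M01) \<partial>M01)
    = ennreal (Wf a (-1/2) / (a + b + 2))"
proof -
  let ?U = "\<integral>\<^sup>+s. ennreal (s powr a) * (\<integral>\<^sup>+t. ennreal (kerp s t * (1 - t) powr (-1/2)) \<partial>M01) \<partial>M01"
  have U: "?U = ennreal (Wf a (-1/2))"
    using a by (subst nn_Hf_y_first[symmetric]) (intro ennreal_Fint domW, auto)
  have "(\<integral>\<^sup>+x. ennreal (x powr a) * (\<integral>\<^sup>+y. ennreal (kerp x y * kerp z y) \<partial>M01) * indicator {..<z} x \<partial>M01) = ennreal (z powr (a + 1)) * ?U"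
    if z: "0 < z" "z < 1" for z
  proof -
    have "(\<integral>\<^sup>+x. ennreal (x powr a) * (\<integral>\<^sup>+y. ennreal (kerp x y * kerp z y) \<partial>M01) * indicator {..<z} x \<partial>M01)
       = ennreal z * (\<integral>\<^sup>+s. ennreal ((z * s) powr a) * (\<integral>\<^sup>+y. ennreal (kerp (z * s) y * kerp z y) \<partial>M01) \<partial>M01)"
      using z by (intro nn_integral_M01_scale borel_measurable_times_ennreal nn_kk_measurable) auto
    also have "(\<integral>\<^sup>+s. ennreal ((z * s) powr a) * (\<integral>\<^sup>+y. ennreal (kerp (z * s) y * kerp z y) \<partial>M01) \<partial>M01)
       = (\<integral>\<^sup>+s. ennreal (z powr a) * (ennreal (s powr a) * (\<integral>\<^sup>+t. ennreal (kerp s t * (1 - t) powr (-1/2)) \<partial>M01)) \<partial>M01)"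
    proof (rule nn_integral_cong)
      fix s assume "s \<in> space M01"
      then have s: "0 < s" "s < 1" by auto
      have "(z * s) powr a = z powr a * s powr a" using z s by (simp add: powr_mult)
      then show "ennreal ((z * s) powr a) * (\<integral>\<^sup>+y. ennreal (kerp (z * s) y * kerp z y) \<partial>M01)
         = ennreal (z powr a) * (ennreal (s powr a) * (\<integral>\<^sup>+t. ennreal (kerp s t * (1 - t) powr (-1/2)) \<partial>M01))"
        by (simp only: nn_kk_scale[OF z s] ennreal_mult'[OF powr_ge_zero] mult.assoc)
    qed
    also have "\<dots> = ennreal (z powr a) * ?U"
      by (rule nn_integral_cmult) (auto simp: tk_def split_def intro!: borel_measurable_times_ennreal M01.borel_measurable_nn_integral)
    also have "ennreal z * (ennreal (z powr a) * ?U) = ennreal (z powr (a + 1)) * ?U"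
      using z by (simp add: powr_add mult.assoc[symmetric] ennreal_mult'[symmetric] mult.commute)
    finally show ?thesis .
  qed
  then have "(\<integral>\<^sup>+z. ennreal (z powr b) * (\<integral>\<^sup>+x. ennreal (x powr a) * (\<integral>\<^sup>+y. ennreal (kerp x y * kerp z y) \<partial>M01) * indicator {..<z} x \<partial>M01) \<partial>M01)
     = (\<integral>\<^sup>+z. ennreal (z powr b) * (ennreal (z powr (a + 1)) * ?U) \<partial>M01)"
    by (intro nn_integral_cong) simp
  also have "\<dots> = (\<integral>\<^sup>+z. ennreal (z powr (a + b + 1) * (1 - z) powr 0) * ?U \<partial>M01)"
    by (intro nn_integral_cong) (simp add: mult.assoc[symmetric] ennreal_mult'[symmetric] powr_add[symmetric] add_ac)
  also have "\<dots> = (\<integral>\<^sup>+z. ennreal (z powr (a + b + 1) * (1 - z) powr 0) \<partial>M01) * ?U"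
    by (rule nn_integral_multc) auto
  also have "\<dots> = ennreal (1 / (a + b + 2)) * ennreal (Wf a (-1/2))"
    using a b nn_integral_Beta[of "a + b + 1" 0] Beta_1_right[of "a + b + 2"] U by (simp add: Beta_commute add_ac)
  finally show ?thesis using a b by (simp add: ennreal_mult'[symmetric])
qed

text \<open>Split the square at its diagonal; each half is evaluated by scaling.\<close>
lemma integral_Jh_Jh:
  assumes a: "a \<ge> 0" and b: "b \<ge> 0"
  shows "(\<integral>y. Jh a y * Jh b y \<partial>M01) = (Wf a (-1/2) + Wf b (-1/2)) / (a + b + 2)"
proof (rule integral_of_nn)
  let ?k = "\<lambda>x z. \<integral>\<^sup>+y. ennreal (kerp x y * kerp z y) \<partial>M01"
  have k2: "(\<lambda>p. ?k (fst p) (snd p)) \<in> borel_measurable (M01 \<Otimes>\<^sub>M M01)" "(\<lambda>p. ?k (snd p) (fst p)) \<in> borel_measurable (M01 \<Otimes>\<^sub>M M01)"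
    by (rule M01.borel_measurable_nn_integral; auto simp: tk_def split_def intro!: measurable_If)+
  note [measurable] = k2 k2[simplified]
  have [measurable]: "(\<lambda>x. ?k x z) \<in> borel_measurable M01" for z by (rule borel_measurable_M01[OF nn_kk_measurable])
  have [measurable]: "(\<lambda>z. ?k x z) \<in> borel_measurable M01" for x
    using borel_measurable_M01[OF nn_kk_measurable[of x]] by (simp add: mult.commute)
  have "(\<integral>\<^sup>+y. ennreal (Jh a y * Jh b y) \<partial>M01) = (\<integral>\<^sup>+y. (\<integral>\<^sup>+z. (\<integral>\<^sup>+x. ennreal (kerp x y * x powr a * (kerp z y * z powr b)) \<partial>M01) \<partial>M01) \<partial>M01)"
  proof (rule nn_integral_cong)
    fix y assume "y \<in> space M01"
    then have y: "0 < y" "y < 1" by auto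
    have "ennreal (Jh a y * Jh b y) = ennreal (Jh a y) * (\<integral>\<^sup>+z. ennreal (kerp z y * z powr b) \<partial>M01)"
      by (simp only: nn_Jh[OF y] ennreal_mult'[OF Jh_nonneg])
    also have "\<dots> = (\<integral>\<^sup>+z. ennreal (Jh a y) * ennreal (kerp z y * z powr b) \<partial>M01)"
      by (rule nn_integral_cmult[symmetric]) (auto intro!: borel_measurable_M01)
    also have "\<dots> = (\<integral>\<^sup>+z. (\<integral>\<^sup>+x. ennreal (kerp x y * x powr a * (kerp z y * z powr b)) \<partial>M01) \<partial>M01)"
    proof (rule nn_integral_cong)
      fix z :: real
      have "ennreal (Jh a y) * ennreal (kerp z y * z powr b) = (\<integral>\<^sup>+x. ennreal (kerp x y * x powr a) \<partial>M01) * ennreal (kerp z y * z powr b)"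
        by (simp only: nn_Jh[OF y])
      also have "\<dots> = (\<integral>\<^sup>+x. ennreal (kerp x y * x powr a) * ennreal (kerp z y * z powr b) \<partial>M01)"
        by (rule nn_integral_multc[symmetric]) (auto intro!: borel_measurable_M01)
      finally show "ennreal (Jh a y) * ennreal (kerp z y * z powr b) = (\<integral>\<^sup>+x. ennreal (kerp x y * x powr a * (kerp z y * z powr b)) \<partial>M01)"
        by (simp add: ennreal_mult')
    qed
    finally show "ennreal (Jh a y * Jh b y) = (\<integral>\<^sup>+z. (\<integral>\<^sup>+x. ennreal (kerp x y * x powr a * (kerp z y * z powr b)) \<partial>M01) \<partial>M01)" .
  qed
  also have "\<dots> = (\<integral>\<^sup>+z. (\<integral>\<^sup>+y. (\<integral>\<^sup>+x. ennreal (kerp x y * x powr a * (kerp z y * z powr b)) \<partial>M01) \<partial>M01) \<partial>M01)"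
    by (rule MM.Fubini') (auto simp: tk_def split_def intro!: M01.borel_measurable_nn_integral measurable_If)
  also have "\<dots> = (\<integral>\<^sup>+z. (\<integral>\<^sup>+x. (\<integral>\<^sup>+y. ennreal (kerp x y * x powr a * (kerp z y * z powr b)) \<partial>M01) \<partial>M01) \<partial>M01)"
    by (intro nn_integral_cong MM.Fubini') (auto simp: tk_def split_def)
  also have "\<dots> = (\<integral>\<^sup>+z. (\<integral>\<^sup>+x. ennreal (z powr b) * (ennreal (x powr a) * ?k x z) \<partial>M01) \<partial>M01)"
  proof (intro nn_integral_cong)
    fix z x :: real
    have "(\<integral>\<^sup>+y. ennreal (kerp x y * x powr a * (kerp z y * z powr b)) \<partial>M01) = (\<integral>\<^sup>+y. ennreal (x powr a * z powr b) * ennreal (kerp x y * kerp z y) \<partial>M01)"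
      by (simp add: ennreal_mult'[symmetric] mult_ac)
    also have "\<dots> = ennreal (x powr a * z powr b) * ?k x z"
      by (rule nn_integral_cmult) (auto intro!: borel_measurable_M01)
    finally show "(\<integral>\<^sup>+y. ennreal (kerp x y * x powr a * (kerp z y * z powr b)) \<partial>M01) = ennreal (z powr b) * (ennreal (x powr a) * ?k x z)"
      by (simp add: ennreal_mult' mult_ac)
  qed
  also have "\<dots> = (\<integral>\<^sup>+z. (\<integral>\<^sup>+x. ennreal (z powr b) * (ennreal (x powr a) * ?k x z * indicator {..<z} x) + ennreal (z powr b) * (ennreal (x powr a) * ?k x z * indicator {..<x} z) \<partial>M01) \<partial>M01)"
  proof (rule nn_integral_cong, rule nn_integral_cong_AE)
    fix z :: real
    show "AE x in M01. ennreal (z powr b) * (ennreal (x powr a) * ?k x z) = ennreal (z powr b) * (ennreal (x powr a) * ?k x z * indicator {..<z} x) + ennreal (z powr b) * (ennreal (x powr a) * ?k x z * indicator {..<x} z)"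
      using AE_neq[of z] by eventually_elim (auto split: split_indicator)
  qed
  also have "\<dots> = (\<integral>\<^sup>+z. (\<integral>\<^sup>+x. ennreal (z powr b) * (ennreal (x powr a) * ?k x z * indicator {..<z} x) \<partial>M01) + (\<integral>\<^sup>+x. ennreal (z powr b) * (ennreal (x powr a) * ?k x z * indicator {..<x} z) \<partial>M01) \<partial>M01)"
    by (intro nn_integral_cong nn_integral_add) (auto simp: indicator_def)
  also have "\<dots> = (\<integral>\<^sup>+z. (\<integral>\<^sup>+x. ennreal (z powr b) * (ennreal (x powr a) * ?k x z * indicator {..<z} x) \<partial>M01) \<partial>M01) + (\<integral>\<^sup>+z. (\<integral>\<^sup>+x. ennreal (z powr b) * (ennreal (x powr a) * ?k x z * indicator {..<x} z) \<partial>M01) \<partial>M01)"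
    by (intro nn_integral_add M01.borel_measurable_nn_integral) (auto simp: indicator_def split_def of_bool_def)
  also have "(\<integral>\<^sup>+z. (\<integral>\<^sup>+x. ennreal (z powr b) * (ennreal (x powr a) * ?k x z * indicator {..<x} z) \<partial>M01) \<partial>M01) = (\<integral>\<^sup>+x. (\<integral>\<^sup>+z. ennreal (z powr b) * (ennreal (x powr a) * ?k x z * indicator {..<x} z) \<partial>M01) \<partial>M01)"
    by (rule MM.Fubini') (auto simp: indicator_def split_def of_bool_def)
  also have "\<dots> = (\<integral>\<^sup>+x. ennreal (x powr a) * (\<integral>\<^sup>+z. ennreal (z powr b) * ?k z x * indicator {..<x} z \<partial>M01) \<partial>M01)"
    by (intro nn_integral_cong, subst nn_integral_cmult[symmetric]) (auto simp: mult_ac intro!: nn_integral_cong)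
  also have "\<dots> = ennreal (Wf b (-1/2) / (b + a + 2))" by (rule nn_half[OF b a])
  also have "(\<integral>\<^sup>+z. (\<integral>\<^sup>+x. ennreal (z powr b) * (ennreal (x powr a) * ?k x z * indicator {..<z} x) \<partial>M01) \<partial>M01) = (\<integral>\<^sup>+z. ennreal (z powr b) * (\<integral>\<^sup>+x. ennreal (x powr a) * ?k x z * indicator {..<z} x \<partial>M01) \<partial>M01)"
    by (intro nn_integral_cong nn_integral_cmult) auto
  also have "\<dots> = ennreal (Wf a (-1/2) / (a + b + 2))" by (rule nn_half[OF a b])
  finally show "(\<integral>\<^sup>+y. ennreal (Jh a y * Jh b y) \<partial>M01) = ennreal ((Wf a (-1/2) + Wf b (-1/2)) / (a + b + 2))"
    using a b by (simp add: add_divide_distrib add.commute[of b] flip: ennreal_plus)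
  show "0 \<le> (Wf a (-1/2) + Wf b (-1/2)) / (a + b + 2)" using a b by simp
qed (use Jh_measurable in auto)

lemma Beta_half_half: "Beta (1/2) (1/2) = pi"
  by (simp add: Beta_def Gamma_one_half_real)

text \<open>The semigroup law of fractional integrals: two half-integrals compose to \<open>pi\<close> times an ordinary integral, because
  \<open>Beta (1/2) (1/2) = pi\<close>.\<close>
lemma nn_kerp_kerp:
  assumes y: "0 < y" and yz: "y < z" and z: "z < 1"
  shows "(\<integral>\<^sup>+x. ennreal (kerp x y * kerp z x) \<partial>M01) = ennreal pi"
proof -
  define c where "c = z - y"
  have c: "0 < c" using yz by (simp add: c_def)
  have "(\<integral>\<^sup>+x. ennreal (kerp x y * kerp z x) \<partial>M01) = (\<integral>\<^sup>+x. ennreal (kerp x y * kerp z x) * indicator {0<..<1} x \<partial>lborel)"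
    by (rule nn_integral_M01) auto
  also have "\<dots> = (\<integral>\<^sup>+x. ennreal (kerp x y * kerp z x) \<partial>lborel)"
    using y z by (intro nn_integral_cong) (auto simp: tk_def split: split_indicator)
  also have "\<dots> = \<bar>c\<bar> * (\<integral>\<^sup>+t. ennreal (kerp (y + c * t) y * kerp z (y + c * t)) \<partial>lborel)"
    using c by (subst nn_integral_real_affine[of _ c y]) auto
  also have "\<dots> = (\<integral>\<^sup>+t. ennreal \<bar>c\<bar> * ennreal (kerp (y + c * t) y * kerp z (y + c * t)) \<partial>lborel)"
    by (rule nn_integral_cmult[symmetric]) (auto simp: tk_def)
  also have "\<dots> = (\<integral>\<^sup>+t. ennreal (t powr (-1/2) * (1 - t) powr (-1/2)) * indicator {0<..<1} t \<partial>lborel)"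
  proof (rule nn_integral_cong)
    fix t :: real
    have e: "z - (y + c * t) = c * (1 - t)" by (simp add: c_def algebra_simps)
    have lt: "(y + c * t < z) = (t < 1)"
    proof -
      have "(y + c * t < z) = (c * t < c * 1)" by (auto simp: c_def)
      then show ?thesis using c by simp
    qed
    show "ennreal \<bar>c\<bar> * ennreal (kerp (y + c * t) y * kerp z (y + c * t)) = ennreal (t powr (-1/2) * (1 - t) powr (-1/2)) * indicator {0<..<1} t"
    proof (cases "0 < t \<and> t < 1")
      case True
      have "kerp (y + c * t) y * kerp z (y + c * t) = (c powr (-1/2) * c powr (-1/2)) * (t powr (-1/2) * (1 - t) powr (-1/2))"
        using True c lt by (simp add: tk_def e powr_mult mult_ac)
      also have "c powr (-1/2) * c powr (-1/2) = 1 / c" using c by (simp add: powr_minus_divide flip: powr_add)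
      finally have "c * (kerp (y + c * t) y * kerp z (y + c * t)) = t powr (-1/2) * (1 - t) powr (-1/2)" using c by simp
      then show ?thesis using True c by (simp add: ennreal_mult'[symmetric])
    next
      case False
      then show ?thesis using c lt by (auto simp: tk_def zero_less_mult_iff)
    qed
  qed
  also have "\<dots> = (\<integral>\<^sup>+t. ennreal (t powr (-1/2) * (1 - t) powr (-1/2)) \<partial>M01)"
    by (rule nn_integral_M01[symmetric]) auto
  also have "\<dots> = ennreal pi"
    using nn_integral_Beta[of "-1/2" "-1/2"] Beta_half_half by simp
  finally show ?thesis .
qed

text \<open>The semigroup law under the integral sign: the inner product of a half-integral from the left with one from the right
  collapses to an integral over a triangle.\<close>
lemma nn_conv:
  fixes f g :: "real \<Rightarrow> real"
  assumes [measurable]: "f \<in> borel_measurable borel" "g \<in> borel_measurable borel"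
    and nn: "\<And>x. 0 \<le> f x" "\<And>x. 0 \<le> g x"
  shows "(\<integral>\<^sup>+x. (\<integral>\<^sup>+y. ennreal (kerp x y * f y) \<partial>M01) * (\<integral>\<^sup>+z. ennreal (kerp z x * g z) \<partial>M01) \<partial>M01)
    = (\<integral>\<^sup>+y. (\<integral>\<^sup>+z. ennreal (pi * f y * g z) * indicator {y<..} z \<partial>M01) \<partial>M01)"
proof -
  have [measurable]: "f \<in> borel_measurable M01" "g \<in> borel_measurable M01" by (auto intro!: borel_measurable_M01)
  have "(\<integral>\<^sup>+x. (\<integral>\<^sup>+y. ennreal (kerp x y * f y) \<partial>M01) * (\<integral>\<^sup>+z. ennreal (kerp z x * g z) \<partial>M01) \<partial>M01)
    = (\<integral>\<^sup>+x. (\<integral>\<^sup>+y. (\<integral>\<^sup>+z. ennreal (kerp x y * f y * (kerp z x * g z)) \<partial>M01) \<partial>M01) \<partial>M01)"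
  proof (rule nn_integral_cong)
    fix x :: real
    have "(\<integral>\<^sup>+y. ennreal (kerp x y * f y) \<partial>M01) * (\<integral>\<^sup>+z. ennreal (kerp z x * g z) \<partial>M01)
      = (\<integral>\<^sup>+y. ennreal (kerp x y * f y) * (\<integral>\<^sup>+z. ennreal (kerp z x * g z) \<partial>M01) \<partial>M01)"
      by (rule nn_integral_multc[symmetric]) (auto intro!: borel_measurable_M01)
    also have "\<dots> = (\<integral>\<^sup>+y. (\<integral>\<^sup>+z. ennreal (kerp x y * f y * (kerp z x * g z)) \<partial>M01) \<partial>M01)"
    proof (rule nn_integral_cong)
      fix y :: real
      have "ennreal (kerp x y * f y) * (\<integral>\<^sup>+z. ennreal (kerp z x * g z) \<partial>M01) = (\<integral>\<^sup>+z. ennreal (kerp x y * f y) * ennreal (kerp z x * g z) \<partial>M01)"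
        by (rule nn_integral_cmult[symmetric]) (auto intro!: borel_measurable_M01)
      then show "ennreal (kerp x y * f y) * (\<integral>\<^sup>+z. ennreal (kerp z x * g z) \<partial>M01) = (\<integral>\<^sup>+z. ennreal (kerp x y * f y * (kerp z x * g z)) \<partial>M01)"
        using nn by (simp only: ennreal_mult'[OF mult_nonneg_nonneg[OF tk_nonneg nn(1)]])
    qed
    finally show "(\<integral>\<^sup>+y. ennreal (kerp x y * f y) \<partial>M01) * (\<integral>\<^sup>+z. ennreal (kerp z x * g z) \<partial>M01)
      = (\<integral>\<^sup>+y. (\<integral>\<^sup>+z. ennreal (kerp x y * f y * (kerp z x * g z)) \<partial>M01) \<partial>M01)" .
  qed
  also have "\<dots> = (\<integral>\<^sup>+y. (\<integral>\<^sup>+x. (\<integral>\<^sup>+z. ennreal (kerp x y * f y * (kerp z x * g z)) \<partial>M01) \<partial>M01) \<partial>M01)"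
    by (rule MM.Fubini') (auto simp: tk_def split_def intro!: M01.borel_measurable_nn_integral measurable_If)
  also have "\<dots> = (\<integral>\<^sup>+y. (\<integral>\<^sup>+z. (\<integral>\<^sup>+x. ennreal (kerp x y * f y * (kerp z x * g z)) \<partial>M01) \<partial>M01) \<partial>M01)"
    by (intro nn_integral_cong MM.Fubini') (auto simp: tk_def split_def)
  also have "\<dots> = (\<integral>\<^sup>+y. (\<integral>\<^sup>+z. ennreal (pi * f y * g z) * indicator {y<..} z \<partial>M01) \<partial>M01)"
  proof (intro nn_integral_cong)
    fix y z assume "y \<in> space M01" "z \<in> space M01"
    then have yz: "0 < y" "z < 1" by auto
    have "(\<integral>\<^sup>+x. ennreal (kerp x y * f y * (kerp z x * g z)) \<partial>M01) = (\<integral>\<^sup>+x. ennreal (f y * g z) * ennreal (kerp x y * kerp z x) \<partial>M01)"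
      using nn by (simp add: ennreal_mult'[symmetric] mult_ac)
    also have "\<dots> = ennreal (f y * g z) * (\<integral>\<^sup>+x. ennreal (kerp x y * kerp z x) \<partial>M01)"
      by (rule nn_integral_cmult) (auto intro!: borel_measurable_M01)
    also have "\<dots> = ennreal (pi * f y * g z) * indicator {y<..} z"
    proof (cases "y < z")
      case True
      then show ?thesis using nn nn_kerp_kerp[OF yz(1) True yz(2)] by (simp only:) (simp add: ennreal_mult'[symmetric] mult_ac)
    next
      case False
      then have "(\<integral>\<^sup>+x. ennreal (kerp x y * kerp z x) \<partial>M01) = (\<integral>\<^sup>+x. 0 \<partial>M01)"
        by (intro nn_integral_cong) (auto simp: tk_def)
      then show ?thesis using False by (simp only:) simp
    qed
    finally show "(\<integral>\<^sup>+x. ennreal (kerp x y * f y * (kerp z x * g z)) \<partial>M01) = ennreal (pi * f y * g z) * indicator {y<..} z" .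
  qed
  finally show ?thesis .
qed

section \<open>Action of the operator on symmetrized powers\<close>

text \<open>Trial functions are built from these because the kernel is invariant under \<open>x \<mapsto> 1 - x\<close> and the Perron function is
  symmetric.\<close>
definition ub :: "real \<Rightarrow> real \<Rightarrow> real" where "ub a x = x powr a + (1 - x) powr a"

text \<open>The half-integral of a symmetrized power from the left; the one from the right is its reflection.\<close>
definition Gp :: "real \<Rightarrow> real \<Rightarrow> real" where "Gp a x = beta a * x powr (a + 1/2) + Jh a (1 - x)"

lemma ub_reflect [simp]: "ub a (1 - x) = ub a x" by (simp add: ub_def)

lemma ub_nonneg [simp]: "0 \<le> ub a x" by (simp add: ub_def)

lemma ub_measurable [measurable]: "ub a \<in> borel_measurable borel" unfolding ub_def by measurable

lemma bm_ub [bm_intros]: assumes "a \<ge> 0" shows "bm (ub a)"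
  unfolding ub_def by (intro bm_intros bm_reflect[of "\<lambda>x. x powr a"] assms)

lemma beta_pos: "a \<ge> 0 \<Longrightarrow> 0 < beta a" by (rule Beta_pos) auto

lemma bm_Gp [bm_intros]: assumes "a \<ge> 0" shows "bm (Gp a)"
  unfolding Gp_def using assms by (intro bm_intros bm_reflect[of "Jh a"]) auto

lemma Gp_nonneg: "a \<ge> 0 \<Longrightarrow> 0 \<le> Gp a x"
  using beta_pos[of a] by (simp add: Gp_def)

lemma nn_kerp_ub:
  assumes a: "a \<ge> 0" and x: "0 < x" "x < 1"
  shows "(\<integral>\<^sup>+y. ennreal (kerp x y * ub a y) \<partial>M01) = ennreal (Gp a x)"
proof -
  have "(\<integral>\<^sup>+y. ennreal (kerp x y * ub a y) \<partial>M01) = (\<integral>\<^sup>+y. ennreal (kerp x y * y powr a) + ennreal (kerp x y * (1 - y) powr a) \<partial>M01)"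
    by (simp add: ub_def distrib_left)
  also have "\<dots> = (\<integral>\<^sup>+y. ennreal (kerp x y * y powr a) \<partial>M01) + (\<integral>\<^sup>+y. ennreal (kerp x y * (1 - y) powr a) \<partial>M01)"
    by (rule nn_integral_add) (auto intro!: borel_measurable_M01)
  also have "(\<integral>\<^sup>+y. ennreal (kerp x y * (1 - y) powr a) \<partial>M01) = (\<integral>\<^sup>+y. ennreal (kerp y (1 - x) * y powr a) \<partial>M01)"
    by (subst nn_integral_M01_reflect) (auto simp: tk_def algebra_simps intro!: nn_integral_cong)
  also have "\<dots> = ennreal (Jh a (1 - x))" using x by (intro nn_Jh) auto
  also have "(\<integral>\<^sup>+y. ennreal (kerp x y * y powr a) \<partial>M01) = ennreal (beta a * x powr (a + 1/2))"
    using a x by (intro nn_integral_kerp_powr) auto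
  finally show ?thesis using beta_pos[OF a] by (simp add: Gp_def flip: ennreal_plus)
qed

lemma nn_kerp_ub':
  assumes a: "a \<ge> 0" and x: "0 < x" "x < 1"
  shows "(\<integral>\<^sup>+y. ennreal (kerp y x * ub a y) \<partial>M01) = ennreal (Gp a (1 - x))"
proof -
  have "(\<integral>\<^sup>+y. ennreal (kerp y x * ub a y) \<partial>M01) = (\<integral>\<^sup>+y. ennreal (kerp (1 - x) y * ub a y) \<partial>M01)"
    by (subst nn_integral_M01_reflect) (auto simp: tk_reflect'[of _ _ x])
  then show ?thesis using nn_kerp_ub[OF a, of "1 - x"] x by simp
qed

lemma Kstar_ub:
  assumes a: "a \<ge> 0" and x: "0 < x" "x < 1"
  shows "Kstar (ub a) x = Gp a x + Gp a (1 - x)"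
  unfolding Kstar_ker
proof (rule integral_of_nn)
  have "(\<integral>\<^sup>+y. ennreal (ker x y * ub a y) \<partial>M01) = (\<integral>\<^sup>+y. ennreal (kerp x y * ub a y) + ennreal (kerp y x * ub a y) \<partial>M01)"
    by (simp add: ker_eq_kerp distrib_right)
  also have "\<dots> = (\<integral>\<^sup>+y. ennreal (kerp x y * ub a y) \<partial>M01) + (\<integral>\<^sup>+y. ennreal (kerp y x * ub a y) \<partial>M01)"
    by (rule nn_integral_add) (auto intro!: borel_measurable_M01)
  also have "\<dots> = ennreal (Gp a x + Gp a (1 - x))"
    unfolding nn_kerp_ub[OF assms] nn_kerp_ub'[OF assms] using Gp_nonneg[OF a] by (simp flip: ennreal_plus)
  finally show "(\<integral>\<^sup>+y. ennreal (ker x y * ub a y) \<partial>M01) = ennreal (Gp a x + Gp a (1 - x))" .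
  have "bm (ub a)" by (intro bm_intros a)
  then show "(\<lambda>y. ker x y * ub a y) \<in> borel_measurable M01" by measurable
qed (use Gp_nonneg[OF a] in auto)

lemma integral_reflect_powr: "(\<integral>x. f (1 - x) * g x \<partial>M01) = (\<integral>x. f x * g (1 - x) \<partial>M01)" for f g :: "real \<Rightarrow> real"
  using integral_M01_reflect[of "\<lambda>x. f x * g (1 - x)"] by simp

lemma integral_ub: assumes "a \<ge> 0" shows "(\<integral>x. ub a x \<partial>M01) = 2 / (a + 1)"
proof -
  have "integrable M01 (\<lambda>x. x powr a)" by (intro integrable_bm bm_intros assms)
  moreover have "integrable M01 (\<lambda>x. (1 - x) powr a)" using assms by (intro integral_powr_reflect) auto
  ultimately show ?thesis
    using integral_powr_reflect(2)[of a] integral_M01_reflect[of "\<lambda>x. x powr a"] assms by (simp add: ub_def)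
qed

lemma ip_ub_ub:
  assumes a: "a \<ge> 0" and b: "b \<ge> 0"
  shows "(\<integral>x. ub a x * ub b x \<partial>M01) = 2 * (1 / (a + b + 1) + Beta (a + 1) (b + 1))"
proof -
  note r = bm_reflect[of "\<lambda>x. x powr _"]
  have i: "integrable M01 (\<lambda>x. x powr a * x powr b)" "integrable M01 (\<lambda>x. x powr a * (1 - x) powr b)"
     "integrable M01 (\<lambda>x. (1 - x) powr a * x powr b)" "integrable M01 (\<lambda>x. (1 - x) powr a * (1 - x) powr b)"
    by (intro integrable_bm bm_intros r a b)+
  have "(\<integral>x. ub a x * ub b x \<partial>M01) = (\<integral>x. x powr a * x powr b + x powr a * (1 - x) powr b + ((1 - x) powr a * x powr b + (1 - x) powr a * (1 - x) powr b) \<partial>M01)"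
    by (rule Bochner_Integration.integral_cong) (auto simp: ub_def algebra_simps)
  also have "\<dots> = 1 / (a + b + 1) + Beta (a + 1) (b + 1) + (Beta (a + 1) (b + 1) + 1 / (a + b + 1))"
    using i a b integral_powr_powr[OF a b] integral_powr_Beta[of a b] integral_reflect_powr[of "\<lambda>x. x powr a" "\<lambda>x. x powr b"]
      integral_M01_reflect[of "\<lambda>x. x powr a * x powr b"] by simp
  finally show ?thesis by simp
qed

lemma ip_ub_Gp:
  assumes a: "a \<ge> 0" and b: "b \<ge> 0"
  shows "(\<integral>x. ub b x * Gp a x \<partial>M01) = beta a / (a + b + 3/2) + beta a * Beta (a + 3/2) (b + 1) + Wf a b + beta b / (a + b + 3/2)"
proof -
  note r = bm_reflect[of "\<lambda>x. x powr _"] bm_reflect[of "Jh _"]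
  have a': "a + 1/2 \<ge> 0" using a by simp
  have i: "integrable M01 (\<lambda>x. x powr b * x powr (a + 1/2))" "integrable M01 (\<lambda>x. x powr (a + 1/2) * (1 - x) powr b)"
     "integrable M01 (\<lambda>x. x powr b * Jh a (1 - x))" "integrable M01 (\<lambda>x. (1 - x) powr b * Jh a (1 - x))"
    by (intro integrable_bm bm_intros r a b a')+
  have "(\<integral>x. ub b x * Gp a x \<partial>M01) = (\<integral>x. beta a * (x powr b * x powr (a + 1/2)) + beta a * (x powr (a + 1/2) * (1 - x) powr b) + x powr b * Jh a (1 - x) + (1 - x) powr b * Jh a (1 - x) \<partial>M01)"
    by (rule Bochner_Integration.integral_cong) (auto simp: ub_def Gp_def algebra_simps)
  also have "\<dots> = beta a * (1 / (b + (a + 1/2) + 1)) + beta a * Beta (a + 1/2 + 1) (b + 1) + Wf a b + beta b / (a + b + 3/2)"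
    using i integral_powr_powr[OF b a'] integral_powr_Beta[of "a + 1/2" b] integral_powr_Jh_reflect[OF a, of b] integral_powr_Jh[OF a b]
      integral_M01_reflect[of "\<lambda>x. x powr b * Jh a x"] a b by simp
  finally show ?thesis by (simp add: add_ac)
qed

lemma ip_ub_Kub:
  assumes a: "a \<ge> 0" and b: "b \<ge> 0"
  shows "(\<integral>x. ub b x * Kstar (ub a) x \<partial>M01) = 2 * ((beta a + beta b) / (a + b + 3/2) + beta a * Beta (a + 3/2) (b + 1) + Wf a b)"
proof -
  have i: "integrable M01 (\<lambda>x. ub b x * Gp a x)" "integrable M01 (\<lambda>x. ub b x * Gp a (1 - x))"
    by (intro integrable_bm bm_intros bm_reflect[of "Gp a"] a b)+
  have "(\<integral>x. ub b x * Kstar (ub a) x \<partial>M01) = (\<integral>x. ub b x * Gp a x + ub b x * Gp a (1 - x) \<partial>M01)"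
    by (rule Bochner_Integration.integral_cong) (auto simp: Kstar_ub[OF a] distrib_left)
  also have "\<dots> = 2 * (\<integral>x. ub b x * Gp a x \<partial>M01)"
    using i integral_M01_reflect[of "\<lambda>x. ub b x * Gp a x"] by simp
  finally show ?thesis unfolding ip_ub_Gp[OF a b] by (simp add: add_divide_distrib)
qed

lemma ip_Gp_Gp:
  assumes a: "a \<ge> 0" and b: "b \<ge> 0"
  shows "(\<integral>x. Gp a x * Gp b x \<partial>M01) = beta a * beta b / (a + b + 2) + beta a * Wf b (a + 1/2) + beta b * Wf a (b + 1/2) + (Wf a (-1/2) + Wf b (-1/2)) / (a + b + 2)"
proof -
  note r = bm_reflect[of "Jh _"]
  have h: "a + 1/2 \<ge> 0" "b + 1/2 \<ge> 0" using a b by auto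
  have i: "integrable M01 (\<lambda>x. x powr (a + 1/2) * x powr (b + 1/2))" "integrable M01 (\<lambda>x. x powr (a + 1/2) * Jh b (1 - x))"
     "integrable M01 (\<lambda>x. x powr (b + 1/2) * Jh a (1 - x))" "integrable M01 (\<lambda>x. Jh a (1 - x) * Jh b (1 - x))"
    by (intro integrable_bm bm_intros r a b h)+
  have "(\<integral>x. Gp a x * Gp b x \<partial>M01) = (\<integral>x. beta a * beta b * (x powr (a + 1/2) * x powr (b + 1/2)) + beta a * (x powr (a + 1/2) * Jh b (1 - x)) + beta b * (x powr (b + 1/2) * Jh a (1 - x)) + Jh a (1 - x) * Jh b (1 - x) \<partial>M01)"
    by (rule Bochner_Integration.integral_cong) (auto simp: Gp_def algebra_simps)
  also have "\<dots> = beta a * beta b * (1 / (a + 1/2 + (b + 1/2) + 1)) + beta a * Wf b (a + 1/2) + beta b * Wf a (b + 1/2) + (Wf a (-1/2) + Wf b (-1/2)) / (a + b + 2)"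
    using i integral_powr_powr[OF h] integral_powr_Jh_reflect[OF a, of "b + 1/2"] integral_powr_Jh_reflect[OF b, of "a + 1/2"] integral_Jh_Jh[OF a b]
      integral_M01_reflect[of "\<lambda>x. Jh a x * Jh b x"] a b by simp
  finally show ?thesis by (simp add: add_ac)
qed

text \<open>By the semigroup law this pairing is an integral over the triangle \<open>y < z\<close>, and exchanging \<open>a\<close> and \<open>b\<close> gives
  the complementary triangle. The pairing is symmetric, so it is half the integral over the square, which factors.\<close>
lemma ip_Gp_Gp_reflect:
  assumes a: "a \<ge> 0" and b: "b \<ge> 0"
  shows "(\<integral>x. Gp a x * Gp b (1 - x) \<partial>M01) = pi / 2 * (2 / (a + 1)) * (2 / (b + 1))"
proof -
  define X where "X = (\<lambda>a b. \<integral>x. Gp a x * Gp b (1 - x) \<partial>M01)"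
  define T where "T = (\<lambda>a b. \<integral>\<^sup>+y. (\<integral>\<^sup>+z. ennreal (pi * ub a y * ub b z) * indicator {y<..} z \<partial>M01) \<partial>M01)"
  have XT: "ennreal (X a b) = T a b" if a: "a \<ge> 0" and b: "b \<ge> 0" for a b
  proof -
    have i: "integrable M01 (\<lambda>x. Gp a x * Gp b (1 - x))" by (intro integrable_bm bm_intros bm_reflect[of "Gp b"] a b)
    have "ennreal (X a b) = (\<integral>\<^sup>+x. ennreal (Gp a x * Gp b (1 - x)) \<partial>M01)"
      unfolding X_def using Gp_nonneg[OF a] Gp_nonneg[OF b] by (intro nn_integral_eq_integral[symmetric] i) auto
    also have "\<dots> = (\<integral>\<^sup>+x. (\<integral>\<^sup>+y. ennreal (kerp x y * ub a y) \<partial>M01) * (\<integral>\<^sup>+z. ennreal (kerp z x * ub b z) \<partial>M01) \<partial>M01)"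
    proof (rule nn_integral_cong)
      fix x assume "x \<in> space M01"
      then have x: "0 < x" "x < 1" by auto
      show "ennreal (Gp a x * Gp b (1 - x)) = (\<integral>\<^sup>+y. ennreal (kerp x y * ub a y) \<partial>M01) * (\<integral>\<^sup>+z. ennreal (kerp z x * ub b z) \<partial>M01)"
        unfolding nn_kerp_ub[OF a x] nn_kerp_ub'[OF b x] by (rule ennreal_mult'[OF Gp_nonneg[OF a]])
    qed
    also have "\<dots> = T a b" unfolding T_def by (rule nn_conv) auto
    finally show ?thesis .
  qed
  have sym: "X b a = X a b"
    unfolding X_def using integral_reflect_powr[of "Gp a" "Gp b"] by (simp add: mult.commute)
  have X0: "0 \<le> X a b" unfolding X_def using Gp_nonneg[OF a] Gp_nonneg[OF b] by (intro integral_nonneg_AE AE_I2) auto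
  have mu [measurable]: "ub c \<in> borel_measurable M01" for c by (rule borel_measurable_M01) auto
  have "T b a = (\<integral>\<^sup>+z. (\<integral>\<^sup>+y. ennreal (pi * ub b y * ub a z) * indicator {y<..} z \<partial>M01) \<partial>M01)"
    unfolding T_def by (rule MM.Fubini') (auto simp: split_def indicator_def of_bool_def)
  also have "\<dots> = (\<integral>\<^sup>+y. (\<integral>\<^sup>+z. ennreal (pi * ub a y * ub b z) * indicator {..<y} z \<partial>M01) \<partial>M01)"
    by (intro nn_integral_cong) (auto simp: mult_ac split: split_indicator)
  finally have Tba: "T b a = \<dots>" .
  have "ennreal (X a b) + ennreal (X b a) = (\<integral>\<^sup>+y. (\<integral>\<^sup>+z. ennreal (pi * ub a y * ub b z) * indicator {y<..} z \<partial>M01) + (\<integral>\<^sup>+z. ennreal (pi * ub a y * ub b z) * indicator {..<y} z \<partial>M01) \<partial>M01)"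
    unfolding XT[OF a b] XT[OF b a] Tba unfolding T_def
    by (intro nn_integral_add[symmetric] M01.borel_measurable_nn_integral) (auto simp: split_def indicator_def of_bool_def)
  also have "\<dots> = (\<integral>\<^sup>+y. (\<integral>\<^sup>+z. ennreal (pi * ub a y) * ennreal (ub b z) \<partial>M01) \<partial>M01)"
  proof (rule nn_integral_cong)
    fix y :: real
    have "(\<integral>\<^sup>+z. ennreal (pi * ub a y * ub b z) * indicator {y<..} z \<partial>M01) + (\<integral>\<^sup>+z. ennreal (pi * ub a y * ub b z) * indicator {..<y} z \<partial>M01)
      = (\<integral>\<^sup>+z. ennreal (pi * ub a y * ub b z) * indicator {y<..} z + ennreal (pi * ub a y * ub b z) * indicator {..<y} z \<partial>M01)"
      by (rule nn_integral_add[symmetric]) auto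
    also have "\<dots> = (\<integral>\<^sup>+z. ennreal (pi * ub a y) * ennreal (ub b z) \<partial>M01)"
    proof (rule nn_integral_cong_AE)
      show "AE z in M01. ennreal (pi * ub a y * ub b z) * indicator {y<..} z + ennreal (pi * ub a y * ub b z) * indicator {..<y} z = ennreal (pi * ub a y) * ennreal (ub b z)"
        using AE_neq[of y] by eventually_elim (auto simp: ennreal_mult'[symmetric] split: split_indicator)
    qed
    finally show "(\<integral>\<^sup>+z. ennreal (pi * ub a y * ub b z) * indicator {y<..} z \<partial>M01) + (\<integral>\<^sup>+z. ennreal (pi * ub a y * ub b z) * indicator {..<y} z \<partial>M01)
      = (\<integral>\<^sup>+z. ennreal (pi * ub a y) * ennreal (ub b z) \<partial>M01)" .
  qed
  also have "\<dots> = (\<integral>\<^sup>+y. ennreal (pi * ub a y) * ennreal (2 / (b + 1)) \<partial>M01)"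
  proof (rule nn_integral_cong)
    fix y :: real
    have "(\<integral>\<^sup>+z. ennreal (ub b z) \<partial>M01) = ennreal (2 / (b + 1))"
      unfolding integral_ub[OF b, symmetric] by (intro nn_integral_eq_integral integrable_bm bm_intros b) auto
    then show "(\<integral>\<^sup>+z. ennreal (pi * ub a y) * ennreal (ub b z) \<partial>M01) = ennreal (pi * ub a y) * ennreal (2 / (b + 1))"
      by (subst nn_integral_cmult) auto
  qed
  also have "\<dots> = (\<integral>\<^sup>+y. ennreal (pi * ub a y) \<partial>M01) * ennreal (2 / (b + 1))"
    by (rule nn_integral_multc) auto
  also have "(\<integral>\<^sup>+y. ennreal (pi * ub a y) \<partial>M01) = ennreal (pi * (2 / (a + 1)))"
    unfolding integral_ub[OF a, symmetric] integral_mult_right_zero[symmetric]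
    by (intro nn_integral_eq_integral integrable_bm bm_intros a) auto
  also have "\<dots> * ennreal (2 / (b + 1)) = ennreal (pi * (2 / (a + 1)) * (2 / (b + 1)))"
    using a b by (simp add: ennreal_mult'[symmetric])
  finally have "ennreal (2 * X a b) = ennreal (pi * (2 / (a + 1)) * (2 / (b + 1)))"
    using X0 unfolding sym by (simp flip: ennreal_plus)
  moreover have "0 \<le> pi * (2 / (a + 1)) * (2 / (b + 1))" using a b by simp
  ultimately have "2 * X a b = pi * (2 / (a + 1)) * (2 / (b + 1))" using X0 by (subst (asm) ennreal_inj) auto
  then show ?thesis unfolding X_def by simp
qed

text \<open>The cross terms between the two halves of the operator are elementary by the semigroup law, so the square of
  the operator needs no integrals beyond those in its first power.\<close>
lemma ip_Kub_Kub:
  assumes a: "a \<ge> 0" and b: "b \<ge> 0"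
  shows "(\<integral>x. Kstar (ub a) x * Kstar (ub b) x \<partial>M01) = 2 * (beta a * beta b / (a + b + 2) + beta a * Wf b (a + 1/2) + beta b * Wf a (b + 1/2) + (Wf a (-1/2) + Wf b (-1/2)) / (a + b + 2))
     + pi * (2 / (a + 1)) * (2 / (b + 1))"
proof -
  note r = bm_reflect[of "Gp _"]
  have i: "integrable M01 (\<lambda>x. Gp a x * Gp b x)" "integrable M01 (\<lambda>x. Gp a x * Gp b (1 - x))"
    "integrable M01 (\<lambda>x. Gp a (1 - x) * Gp b x)" "integrable M01 (\<lambda>x. Gp a (1 - x) * Gp b (1 - x))"
    by (intro integrable_bm bm_intros r a b)+
  have "(\<integral>x. Kstar (ub a) x * Kstar (ub b) x \<partial>M01) = (\<integral>x. Gp a x * Gp b x + Gp a x * Gp b (1 - x) + (Gp a (1 - x) * Gp b x + Gp a (1 - x) * Gp b (1 - x)) \<partial>M01)"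
    by (rule Bochner_Integration.integral_cong) (auto simp: Kstar_ub a b algebra_simps)
  also have "\<dots> = 2 * (\<integral>x. Gp a x * Gp b x \<partial>M01) + 2 * (\<integral>x. Gp a x * Gp b (1 - x) \<partial>M01)"
    using i integral_reflect_powr[of "Gp a" "Gp b"] integral_M01_reflect[of "\<lambda>x. Gp a x * Gp b x"] by simp
  finally show ?thesis unfolding ip_Gp_Gp[OF a b] ip_Gp_Gp_reflect[OF a b] by simp
qed

section \<open>Integer arithmetic\<close>

text \<open>Doubling with and without a carry. On binary numerals these steps only attach a low bit, so rewriting performs them
  without an addition.\<close>
definition tw :: "int \<Rightarrow> int" where "tw x = 2 * x"
definition tw1 :: "int \<Rightarrow> int" where "tw1 x = 2 * x + 1"

primrec sdsel :: "bool \<Rightarrow> int \<Rightarrow> int \<Rightarrow> int \<Rightarrow> int \<times> int" where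
  "sdsel True d q s = (tw q, s)"
| "sdsel False d q s = (tw1 q, s - d)"

fun sdp :: "int \<Rightarrow> int \<times> int \<Rightarrow> int \<times> int" where "sdp d (q, r) = sdsel (tw r < d) d q (tw r)"
fun sdp1 :: "int \<Rightarrow> int \<times> int \<Rightarrow> int \<times> int" where "sdp1 d (q, r) = sdsel (tw1 r < d) d q (tw1 r)"

text \<open>Binary long division. It recurses on the dividend from the top bit and only compares and subtracts, so it
  runs by rewriting with few steps per bit.\<close>
fun sdm :: "num \<Rightarrow> int \<Rightarrow> int \<times> int" where
  "sdm num.One d = sdsel (1 < d) d 0 1"
| "sdm (num.Bit0 n) d = sdp d (sdm n d)"
| "sdm (num.Bit1 n) d = sdp1 d (sdm n d)"

lemma sdsel_correct:
  assumes "n = q * d + r" "0 \<le> r" "r < d" "b = 0 \<or> b = 1"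
  shows "case sdsel (2 * r + b < d) d q (2 * r + b) of (q', r') \<Rightarrow> 2 * n + b = q' * d + r' \<and> 0 \<le> r' \<and> r' < d"
proof (cases "2 * r + b < d")
  case True
  have "2 * n + b = (2 * q) * d + (2 * r + b)" using assms(1) by (simp add: algebra_simps)
  moreover have "0 \<le> 2 * r + b" using assms by linarith
  ultimately show ?thesis using True by (simp add: tw_def)
next
  case False
  have "2 * n + b = (2 * q + 1) * d + (2 * r + b - d)" using assms(1) by (simp add: algebra_simps)
  moreover have "0 \<le> 2 * r + b - d" "2 * r + b - d < d" using assms False by linarith+
  ultimately show ?thesis using False by (simp add: tw1_def)
qed

lemma sdm_correct: "0 < d \<Longrightarrow> case sdm x d of (q, r) \<Rightarrow> numeral x = q * d + r \<and> 0 \<le> r \<and> r < d"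
proof (induction x)
  case One
  show ?case using sdsel_correct[of 0 0 d 0 1] One by simp
next
  case (Bit0 x)
  obtain q r where qr: "sdm x d = (q, r)" by (cases "sdm x d")
  then have "numeral x = q * d + r" "0 \<le> r" "r < d" using Bit0 by simp_all
  from sdsel_correct[OF this, of 0] show ?case by (simp add: qr tw_def numeral_Bit0[of x])
next
  case (Bit1 x)
  obtain q r where qr: "sdm x d = (q, r)" by (cases "sdm x d")
  then have "numeral x = q * d + r" "0 \<le> r" "r < d" using Bit1 by simp_all
  from sdsel_correct[OF this, of 1] show ?case by (simp add: qr tw1_def numeral_Bit1[of x])
qed

definition idiv :: "int \<Rightarrow> int \<Rightarrow> int" where "idiv x d = x div d"

lemma idiv_numeral: "idiv (numeral x) (numeral d) = fst (sdm x (numeral d))"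
proof -
  obtain q r where qr: "sdm x (numeral d) = (q, r)" by (cases "sdm x (numeral d)")
  then have "numeral x = q * numeral d + r" "0 \<le> r" "r < (numeral d :: int)"
    using sdm_correct[of "numeral d" x] by auto
  then have "numeral x div numeral d = q" by (intro int_div_pos_eq[of _ _ _ r]) (auto simp: mult.commute)
  then show ?thesis by (simp add: idiv_def qr)
qed

lemma tw_eval: "tw 0 = 0" "tw 1 = 2" "tw (numeral n) = numeral (num.Bit0 n)"
  "tw1 0 = 1" "tw1 1 = 3" "tw1 (numeral n) = numeral (num.Bit1 n)"
  by (simp_all add: tw_def tw1_def numeral_Bit0[of n] numeral_Bit1[of n])

text \<open>Multiplication that reads two bits of the second factor at a time. The multiples \<open>a = x\<close>, \<open>b = 2 x\<close>, \<open>c = 3 x\<close> are passed along and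
  computed once.\<close>
fun mulw :: "num \<Rightarrow> num \<Rightarrow> num \<Rightarrow> num \<Rightarrow> num" where
  "mulw a b c num.One = a"
| "mulw a b c (num.Bit0 num.One) = b"
| "mulw a b c (num.Bit1 num.One) = c"
| "mulw a b c (num.Bit0 (num.Bit0 y)) = num.Bit0 (num.Bit0 (mulw a b c y))"
| "mulw a b c (num.Bit1 (num.Bit0 y)) = a + num.Bit0 (num.Bit0 (mulw a b c y))"
| "mulw a b c (num.Bit0 (num.Bit1 y)) = b + num.Bit0 (num.Bit0 (mulw a b c y))"
| "mulw a b c (num.Bit1 (num.Bit1 y)) = c + num.Bit0 (num.Bit0 (mulw a b c y))"

lemma mulw_correct: "mulw x (num.Bit0 x) (x + num.Bit0 x) y = x * y"
proof -
  have "nat_of_num (mulw a b c y) = nat_of_num x * nat_of_num y"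
    if "a = x" "b = num.Bit0 x" "c = x + num.Bit0 x" for a b c
    using that
    by (induction a b c y rule: mulw.induct) (simp_all add: nat_of_num_add nat_of_num_mult algebra_simps)
  then show ?thesis by (simp add: num_eq_iff nat_of_num_mult)
qed

lemma numeral_mult_eval:
  "(numeral x :: int) * numeral y = numeral (mulw x (num.Bit0 x) (x + num.Bit0 x) y)"
  "- (numeral x :: int) * numeral y = - numeral (mulw x (num.Bit0 x) (x + num.Bit0 x) y)"
  "(numeral x :: int) * - numeral y = - numeral (mulw x (num.Bit0 x) (x + num.Bit0 x) y)"
  "- (numeral x :: int) * - numeral y = numeral (mulw x (num.Bit0 x) (x + num.Bit0 x) y)"
  by (simp_all only: mulw_correct numeral_times_numeral mult_minus_left mult_minus_right minus_minus)

text \<open>A complete rewrite system for integer numerals. Used with \<open>simp only\<close>, it evaluates the closed integer terms below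
  inside the kernel.\<close>
lemmas int_eval = dbl_simps dbl_inc_simps dbl_dec_simps add_num_simps sub_num_simps add_numeral_special
  add_neg_numeral_special diff_numeral_special diff_numeral_simps add_neg_numeral_simps
  numeral_plus_numeral mult_zero_left mult_zero_right mult_1_left mult_1_right add_0_left add_0_right minus_zero
  mult_minus1 mult_minus1_right minus_minus diff_0_right diff_0
  rel_simps if_True if_False prod.case fst_conv BitM.simps numeral_One
  tw_eval sdsel.simps sdp.simps sdp1.simps sdm.simps idiv_numeral mulw.simps numeral_mult_eval pred_numeral_simps

section \<open>Fixed-point recursions for Beta values and singular integrals\<close>

text \<open>The scale of all fixed-point numbers. A power of 4 is used because the double peeling gains a factor of 4 per step.\<close>
definition prec :: int where "prec = 98079714615416886934934209737619787751599303819750539264"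

lemma prec_eq: "prec = 4 ^ 93" by (simp add: prec_def)

definition quarter :: "int \<Rightarrow> int" where "quarter x = x div 4"

lemma quarter_eval: "quarter (numeral (num.Bit0 (num.Bit0 n))) = numeral n" "quarter 1 = 0"
proof -
  have "numeral (num.Bit0 (num.Bit0 n)) = 4 * (numeral n :: int)"
    by (simp only: numeral_Bit0[of n] numeral_Bit0[of "num.Bit0 n"])
  then show "quarter (numeral (num.Bit0 (num.Bit0 n))) = numeral n" by (simp only: quarter_def)
qed (simp add: quarter_def)

text \<open>One double integration by parts in fixed-point form. Parameters are quarter-integers, kept integral by
  \<open>c = 4 e + 8\<close>, \<open>a = r / 4\<close>, \<open>b = s / 4\<close>. The scale \<open>p\<close> drops by a factor of 4 from each level to the next, matching the decay of the
  coefficient of the remainder; numbers at the deep levels are short.\<close>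
definition peel_step :: "int \<Rightarrow> int \<Rightarrow> int \<Rightarrow> int \<Rightarrow> int \<Rightarrow> int \<Rightarrow> int" where
  "peel_step c r s n p X = idiv (4 * (c + 8 * n + 4) * ((r + c + 4 * n) * (c + 8 * n) - (r - 4 * n) * (s + c + 4 * n)) * p
      + (4 * ((r - 4 * n) * (s - 4 * n)) * ((s + c + 4 * n) * (r + c + 4 * n))) * X)
     ((s + c + 4 * n) * (r + c + 4 * n) * ((c + 8 * n) * (c + 8 * n + 4)))"

primrec base_value :: "int \<Rightarrow> int \<Rightarrow> int \<Rightarrow> nat \<Rightarrow> int \<Rightarrow> int \<Rightarrow> int" where
  "base_value c r s 0 n p = 0"
| "base_value c r s (Suc m) n p = peel_step c r s n p (base_value c r s m (n + 1) (quarter p))"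

lemma base_value_eval: "base_value c r s (numeral k) n p = peel_step c r s n p (base_value c r s (pred_numeral k) (n + 1) (quarter p))"
  "base_value c r s 1 n p = peel_step c r s n p 0"
  by (simp_all add: numeral_eq_Suc)

text \<open>The recursion that raises \<open>b\<close> by 1, in the same quarter-integer units.\<close>
definition shift_step :: "int \<Rightarrow> int \<Rightarrow> int \<Rightarrow> int \<Rightarrow> int" where
  "shift_step c j l X = idiv ((l + 4) * (l + c) * X + 4 * (c - 4) * prec) ((j + l + c + 4) * (l + c))"

text \<open>Successive table entries \<open>l, l + 1, ...\<close>. The queue \<open>q\<close> holds four entries because the recursion connects entries at
  distance 4.\<close>
primrec table_column :: "int \<Rightarrow> int \<Rightarrow> nat \<Rightarrow> int \<Rightarrow> int list \<Rightarrow> int list" where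
  "table_column c r 0 l q = []"
| "table_column c r (Suc m) l q = hd q # table_column c r m (l + 1) (tl q @ [shift_step c r l (hd q)])"

lemma table_column_eval: "table_column c r (numeral k) l (x # q) = x # table_column c r (pred_numeral k) (l + 1) (q @ [shift_step c r l x])" "table_column c r 1 l (x # q) = [x]"
  by (simp_all add: numeral_eq_Suc)

text \<open>The scalar product of \<open>fs\<close> with the table entries \<open>l, l + 4, ...\<close> of row \<open>j\<close>, which are generated on the way.\<close>
primrec row_dot :: "int \<Rightarrow> int \<Rightarrow> int list \<Rightarrow> int \<Rightarrow> int \<Rightarrow> int" where
  "row_dot c j [] l X = 0"
| "row_dot c j (f # fs) l X = f * X + row_dot c j fs (l + 4) (shift_step c j l X)"

definition Gq :: "int \<Rightarrow> int \<Rightarrow> int \<Rightarrow> real" where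
  "Gq c j l = Gf ((c - 8) / 4) (j / 4) (l / 4)"

definition apx :: "real \<Rightarrow> int \<Rightarrow> int \<Rightarrow> int \<Rightarrow> int \<Rightarrow> bool" where
  "apx E c j l X \<longleftrightarrow> \<bar>X - prec * Gq c j l\<bar> \<le> E"

lemma idiv_bounds:
  assumes "0 < d" shows "\<bar>real_of_int (idiv x d) - x / d\<bar> \<le> 1"
proof -
  have "\<lfloor>real_of_int x / real_of_int d\<rfloor> = x div d" by (rule floor_divide_of_int_eq)
  then show ?thesis unfolding idiv_def by linarith
qed

lemma Gq_rec:
  assumes c: "c = 4 \<or> c = 6" and j: "j \<ge> 0" and l: "l \<ge> 0"
  shows "(j + l + c + 4) * Gq c j (l + 4) = (l + 4) * Gq c j l + 4 * (c - 4) / (l + c)"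
proof -
  let ?e = "(real_of_int c - 8) / 4 :: real" and ?a = "j / 4 :: real" and ?b = "l / 4 :: real"
  have "?e = -1 \<and> ?a > -1 \<and> ?b > -1 \<or> dom ?e ?a ?b"
    using c j l by (auto simp: dom_def)
  note rec = Gf_rec[OF this]
  have "4 * u * G = 4 * w * H + 4 * z" if "u * G = w * H + z" for u w z G H :: real
    using that by (simp add: algebra_simps)
  from this[OF rec] have "4 * (?a + ?b + ?e + 3) * Gf ?e ?a (?b + 1) = 4 * (?b + 1) * Gf ?e ?a ?b + 4 * ((?e + 1) / (?b + ?e + 2))" .
  moreover have "?b + 1 = real_of_int (l + 4) / 4" by simp
  ultimately have "4 * (?a + ?b + ?e + 3) * Gq c j (l + 4) = 4 * (?b + 1) * Gq c j l + 4 * ((?e + 1) / (?b + ?e + 2))"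
    by (simp only: Gq_def)
  moreover have "4 * (?a + ?b + ?e + 3) = real_of_int (j + l + c + 4)" "4 * (?b + 1) = real_of_int (l + 4)" by (simp_all add: diff_divide_distrib)
  moreover have "4 * ((?e + 1) / (?b + ?e + 2)) = 4 * real_of_int (c - 4) / (l + c)"
    using c l by (auto simp: field_simps)
  ultimately show ?thesis by (simp only: of_int_add of_int_diff of_int_numeral)
qed

text \<open>The coefficient of the previous entry is below 1, so an error is not amplified and each step only adds its rounding
  error.\<close>
lemma shift_step_apx:
  assumes c: "c = 4 \<or> c = 6" and j: "j \<ge> 0" and l: "l \<ge> 0" and X: "apx E c j l X"
  shows "apx (E + 1) c j (l + 4) (shift_step c j l X)"
proof -
  define N where "N = real_of_int ((l + 4) * (l + c) * X + 4 * (c - 4) * prec)"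
  define D where "D = real_of_int ((j + l + c + 4) * (l + c))"
  have pos: "0 < real_of_int (j + l + c + 4)" "0 < real_of_int (l + c)" using c j l by auto
  have D: "0 < D" using c j l by (auto simp: D_def)
  have g: "D * Gq c j (l + 4) = (l + c) * ((l + 4) * Gq c j l) + 4 * (c - 4)"
  proof -
    have "D * Gq c j (l + 4) = (l + c) * ((j + l + c + 4) * Gq c j (l + 4))" by (simp add: D_def)
    also have "\<dots> = (l + c) * ((l + 4) * Gq c j l + 4 * (c - 4) / (l + c))" using Gq_rec[OF c j l] by simp
    also have "\<dots> = (l + c) * ((l + 4) * Gq c j l) + 4 * (c - 4)"
    proof -
      have "u * (x + y / u) = u * x + y" if "0 < u" for u x y :: real using that by (simp add: field_simps)
      from this[OF pos(2)] show ?thesis .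
    qed
    finally show ?thesis .
  qed
  have "N - prec * (D * Gq c j (l + 4)) = (l + 4) * (l + c) * (X - prec * Gq c j l)"
    unfolding g by (simp add: N_def algebra_simps)
  then have "\<bar>N - prec * (D * Gq c j (l + 4))\<bar> = ((l + 4) * (l + c)) * \<bar>X - prec * Gq c j l\<bar>"
    using c l by (auto simp: abs_mult)
  also have "\<dots> \<le> D * E"
    using X c j l unfolding apx_def D_def by (intro mult_mono) auto
  finally have "\<bar>N - D * (prec * Gq c j (l + 4))\<bar> \<le> D * E" by (simp add: mult_ac)
  moreover have "N / D - prec * Gq c j (l + 4) = (N - D * (prec * Gq c j (l + 4))) / D" using D by (simp add: field_simps)
  ultimately have "\<bar>N / D - prec * Gq c j (l + 4)\<bar> \<le> E" using D by (simp add: abs_divide pos_divide_le_eq mult.commute)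
  moreover have "\<bar>real_of_int (shift_step c j l X) - N / D\<bar> \<le> 1"
    unfolding shift_step_def N_def D_def using c j l by (intro idiv_bounds) auto
  ultimately show ?thesis unfolding apx_def by linarith
qed

text \<open>The value reached after \<open>n\<close> double integrations by parts.\<close>
definition Gn :: "int \<Rightarrow> int \<Rightarrow> int \<Rightarrow> nat \<Rightarrow> real" where
  "Gn c r s n = Gf ((c - 8) / 4 + 2 * n) (r / 4 - n) (s / 4 - n)"

lemma Gn_step:
  assumes c: "c = 4 \<or> c = 6" and r: "r \<in> {1..3}" and s: "s \<in> {1..3}"
  shows "Gn c r s n = 4 / (s + c + 4 * n) - 4 * (r - 4 * n) / ((c + 8 * n) * (r + c + 4 * n)) + (r - 4 * n) * (s - 4 * n) / ((c + 8 * n) * (c + 8 * n + 4)) * Gn c r s (Suc n)"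
proof -
  let ?e = "(real_of_int c - 8) / 4 + 2 * real n" and ?a = "r / 4 - n :: real" and ?b = "s / 4 - n :: real"
  have *: "Gf ?e ?a ?b = 1 / (?b + ?e + 2) - ?a / ((?e + 2) * (?a + ?e + 2)) + ?a * ?b / ((?e + 2) * (?e + 3)) * Gf (?e + 2) (?a - 1) (?b - 1)"
  proof (cases "c = 4 \<and> n = 0")
    case True
    then show ?thesis using Gf_peel2_Beta(1)[of ?a ?b] r s by (simp add: add.commute)
  next
    case False
    have "dom ?e ?a ?b"
    proof -
      have "real n \<ge> 1" if "c = 4" using False that by simp
      then show ?thesis using c r s by (auto simp: dom_def)
    qed
    then show ?thesis by (rule Gf_peel2)
  qed
  have e: "?e + 2 = (c + 8 * n) / 4" "?e + 3 = (c + 8 * n + 4) / 4" "?b + ?e + 2 = (s + c + 4 * n) / 4" "?a + ?e + 2 = (r + c + 4 * n) / 4"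
    "?a = (r - 4 * n) / 4" "?b = (s - 4 * n) / 4" by (simp_all add: diff_divide_distrib add_divide_distrib)
  have S: "Gf (?e + 2) (?a - 1) (?b - 1) = Gn c r s (Suc n)" by (simp add: Gn_def algebra_simps)
  have "Gn c r s n = 1 / (?b + ?e + 2) - ?a / ((?e + 2) * (?a + ?e + 2)) + ?a * ?b / ((?e + 2) * (?e + 3)) * Gn c r s (Suc n)"
    using * unfolding S Gn_def .
  also have "\<dots> = 4 / (s + c + 4 * n) - 4 * (r - 4 * n) / ((c + 8 * n) * (r + c + 4 * n)) + (r - 4 * n) * (s - 4 * n) / ((c + 8 * n) * (c + 8 * n + 4)) * Gn c r s (Suc n)"
  proof -
    have q: "1 / (u / 4) = 4 / u" "x / 4 / (y / 4 * (z / 4)) = 4 * x / (y * z)" "x / 4 * (w / 4) / (y / 4 * (z / 4)) = x * w / (y * z)"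
      for u w x y z :: real by simp_all
    show ?thesis unfolding e(1-4) unfolding e(5,6) q by simp
  qed
  finally show ?thesis by simp
qed

text \<open>Monotonicity in the exponents compares the remainder with the first member of the chain.\<close>
lemma Gn_bound:
  assumes c: "c = 4 \<or> c = 6" and r: "r \<in> {1..3}" and s: "s \<in> {1..3}" and n: "0 < n"
  shows "0 \<le> Gn c r s n" "Gn c r s n \<le> 4 * (2 * n + 1)"
proof -
  let ?e = "(real_of_int c - 8) / 4 + 2 * real n" and ?a = "r / 4 - n :: real" and ?b = "s / 4 - n :: real"
  have n1: "real n \<ge> 1" using n by simp
  have e: "?e + 1 \<ge> 0" "?e + 1 \<le> 2 * n + 1" "?e \<noteq> -1" using c n1 by auto
  have F: "Fint ?e ?a ?b \<le> 4"
  proof (cases "c = 4")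
    case True
    have "Fint (0 + (real n - 1) + n) ((r / 4 - 1) - (real n - 1)) (s / 4 - n) \<le> Fint 0 (r / 4 - 1) (s / 4)"
      using r s n1 by (intro Fint_antimono) (auto simp: dom_def)
    also have "\<dots> \<le> 1 / (r / 4 * (s / 4 + 1))" using r s by (intro Gf_peel2_Beta(2)) auto
    also have "\<dots> \<le> 4"
    proof -
      have "1 / 4 * 1 \<le> (r / 4 * (s / 4 + 1) :: real)" using r s by (intro mult_mono) auto
      then show ?thesis by (simp add: divide_le_eq)
    qed
    finally show ?thesis using True by (simp add: algebra_simps)
  next
    case False
    then have c6: "c = 6" using c by simp
    have d: "dom (-1/2) (r / 4) (s / 4)" using r s by (auto simp: dom_def)
    have "Fint (-1/2 + n + n) (r / 4 - n) (s / 4 - n) \<le> Fint (-1/2) (r / 4) (s / 4)"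
      by (rule Fint_antimono[OF d]) auto
    also have "(1/2) * Fint (-1/2) (r / 4) (s / 4) \<le> 1 / (s / 4 - 1/2 + 2)"
    proof -
      have "0 \<le> r / 4 * Fint (-1/2 + 1) (r / 4 - 1) (s / 4)" using r by (intro mult_nonneg_nonneg Fint_nonneg) auto
      then show ?thesis using Fint_peel[OF d] by simp
    qed
    then have "Fint (-1/2) (r / 4) (s / 4) \<le> 2 * (1 / (s / 4 - 1/2 + 2))" by simp
    also have "\<dots> \<le> 4" using s by (simp add: field_simps)
    finally show ?thesis using c6 by (simp add: algebra_simps)
  qed
  have G: "Gn c r s n = (?e + 1) * Fint ?e ?a ?b" using e(3) by (simp add: Gn_def Gf_def)
  show "0 \<le> Gn c r s n" unfolding G using e by (intro mult_nonneg_nonneg Fint_nonneg) auto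
  have "(?e + 1) * Fint ?e ?a ?b \<le> real (2 * n + 1) * 4" using e F by (intro mult_mono Fint_nonneg) auto
  then show "Gn c r s n \<le> 4 * (2 * n + 1)" unfolding G by (simp add: mult.commute)
qed

lemma peel_step_apx:
  assumes c: "c = 4 \<or> c = 6" and r: "r \<in> {1..3}" and s: "s \<in> {1..3}"
    and X: "\<bar>X - p / 4 * Gn c r s (Suc n)\<bar> \<le> E"
  shows "\<bar>peel_step c r s n p X - p * Gn c r s n\<bar> \<le> 4 * ((r - 4 * n) * (s - 4 * n)) / ((c + 8 * n) * (c + 8 * n + 4)) * E + 1"
proof -
  define a b where ab: "a = real_of_int (r - 4 * int n)" "b = real_of_int (s - 4 * int n)"
  define u v where uv: "u = real_of_int (s + c + 4 * int n)" "v = real_of_int (r + c + 4 * int n)"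
  define w z where wz: "w = real_of_int (c + 8 * int n)" "z = real_of_int (c + 8 * int n + 4)"
  note d = ab uv wz
  have pos: "0 < u" "0 < v" "0 < w" "0 < z" using c r s by (auto simp: d)
  have ab0: "0 \<le> a * b"
  proof (cases "n = 0")
    case True then show ?thesis using r s by (auto simp: d)
  next
    case False
    then have "real n \<ge> 1" by simp
    then have "a \<le> 0" "b \<le> 0" using r s by (auto simp: d)
    then show ?thesis by (rule mult_nonpos_nonpos)
  qed
  define N D where ND: "N = 4 * z * (v * w - a * u) * p + 4 * (a * b) * (u * v) * X" "D = u * v * (w * z)"
  have D: "0 < D" using pos by (simp add: ND)
  have G: "Gn c r s n = 4 / u - 4 * a / (w * v) + a * b / (w * z) * Gn c r s (Suc n)"
    using Gn_step[OF c r s, of n] by (simp add: d)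
  have *: "N / D - p * Gn c r s n = 4 * (a * b) / (w * z) * (X - p / 4 * Gn c r s (Suc n))"
    unfolding G ND using pos by (simp add: field_simps)
  have "\<bar>N / D - p * Gn c r s n\<bar> = 4 * (a * b) / (w * z) * \<bar>X - p / 4 * Gn c r s (Suc n)\<bar>"
  proof -
    have "0 \<le> 4 * (a * b) / (w * z)" using ab0 pos by simp
    then show ?thesis by (simp only: * abs_mult[of "4 * (a * b) / (w * z)"] abs_of_nonneg[of "4 * (a * b) / (w * z)"])
  qed
  also have "\<dots> \<le> 4 * (a * b) / (w * z) * E" using X ab0 pos by (intro mult_left_mono) auto
  finally have 1: "\<bar>N / D - p * Gn c r s n\<bar> \<le> 4 * (a * b) / (w * z) * E" .
  have "\<bar>real_of_int (peel_step c r s n p X) - N / D\<bar> \<le> 1"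
  proof -
    define Di where "Di = (s + c + 4 * int n) * (r + c + 4 * int n) * ((c + 8 * int n) * (c + 8 * int n + 4))"
    define Ni where "Ni = 4 * (c + 8 * int n + 4) * ((r + c + 4 * int n) * (c + 8 * int n) - (r - 4 * int n) * (s + c + 4 * int n)) * p
      + (4 * ((r - 4 * int n) * (s - 4 * int n)) * ((s + c + 4 * int n) * (r + c + 4 * int n))) * X"
    have ri: "real_of_int Di = D" "real_of_int Ni = N" by (simp_all add: Di_def Ni_def ND d)
    have "0 < Di" using D unfolding ri(1)[symmetric] by simp
    from idiv_bounds[OF this, of Ni] show ?thesis unfolding ri by (simp add: peel_step_def Ni_def Di_def)
  qed
  with 1 have "\<bar>peel_step c r s n p X - p * Gn c r s n\<bar> \<le> 4 * (a * b) / (w * z) * E + 1" by linarith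
  then show ?thesis by (simp add: d)
qed

text \<open>For \<open>n \<ge> 1\<close> the remainder coefficient, multiplied by 4 for the change of scale, is at most 1. Errors therefore
  only accumulate additively: the crude bound for the neglected tail plus one rounding per level.\<close>
lemma base_value_apx:
  assumes c: "c = 4 \<or> c = 6" and r: "r \<in> {1..3}" and s: "s \<in> {1..3}" and n: "0 < n"
  shows "\<bar>base_value c r s m n (4 ^ m) - 4 ^ m * Gn c r s n\<bar> \<le> 4 * (2 * (n + m) + 1) + m"
  using n
proof (induction m arbitrary: n)
  case 0
  then show ?case using Gn_bound[OF c r s, of n] by simp
next
  case (Suc m)
  have X: "\<bar>base_value c r s m (Suc n) (4 ^ m) - (4 ^ Suc m) / 4 * Gn c r s (Suc n)\<bar> \<le> 4 * (2 * (n + Suc m) + 1) + m"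
    using Suc.IH[of "Suc n"] by simp
  have q: "quarter (4 ^ Suc m) = 4 ^ m" by (simp add: quarter_def)
  have step: "\<bar>peel_step c r s n (4 ^ Suc m) (base_value c r s m (Suc n) (4 ^ m)) - (4 ^ Suc m) * Gn c r s n\<bar> \<le> 4 * ((r - 4 * n) * (s - 4 * n)) / ((c + 8 * n) * (c + 8 * n + 4)) * (4 * (2 * (n + Suc m) + 1) + m) + 1"
    using peel_step_apx[OF c r s, of "base_value c r s m (Suc n) (4 ^ m)" "4 ^ Suc m" n] X by simp
  have coef: "4 * ((r - 4 * n) * (s - 4 * n)) / ((c + 8 * n) * (c + 8 * n + 4)) \<le> (1 :: real)"
  proof -
    have n1: "real n \<ge> 1" using Suc.prems by simp
    define x y z m where d: "x = real_of_int r" "y = real_of_int s" "z = real_of_int c" "m = real n"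
    have b: "1 \<le> x" "x \<le> 3" "1 \<le> y" "y \<le> 3" "4 \<le> z" "1 \<le> m" using c r s n1 by (auto simp: d)
    have "(4 * m - x) * (4 * m - y) \<le> (4 * m) * (4 * m)" using b by (intro mult_mono) auto
    moreover have "(8 * m) * (8 * m) \<le> (z + 8 * m) * (z + 8 * m + 4)" using b by (intro mult_mono) auto
    ultimately have "4 * ((4 * m - x) * (4 * m - y)) \<le> (z + 8 * m) * (z + 8 * m + 4)" by linarith
    moreover have "(4 * m - x) * (4 * m - y) = (x - 4 * m) * (y - 4 * m)" by (simp add: algebra_simps)
    moreover have "0 < (z + 8 * m) * (z + 8 * m + 4)" using b by (intro mult_pos_pos) auto
    ultimately have "4 * ((x - 4 * m) * (y - 4 * m)) / ((z + 8 * m) * (z + 8 * m + 4)) \<le> 1" by (simp only: divide_le_eq_1) simp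
    then show ?thesis by (simp add: d)
  qed
  have "x \<le> E + 1" if "x \<le> k * E + 1" "k \<le> 1" "0 \<le> E" for x k E :: real
    using that mult_right_mono[of k 1 E] by linarith
  from this[OF step coef]
  have "\<bar>peel_step c r s n (4 ^ Suc m) (base_value c r s m (Suc n) (4 ^ m)) - (4 ^ Suc m) * Gn c r s n\<bar> \<le> 4 * (2 * (n + Suc m) + 1) + m + 1"
    by simp
  then show ?case using q by (simp add: add.commute)
qed

text \<open>With 93 levels the scale has run from \<open>4 ^ 93\<close> down to 1, and the tail is neglected there.\<close>
lemma base_apx:
  assumes c: "c = 4 \<or> c = 6" and r: "r \<in> {1..3}" and s: "s \<in> {1..3}"
  shows "apx 1000 c r s (base_value c r s 93 0 prec)"
proof -
  have X: "\<bar>base_value c r s 92 (Suc 0) (4 ^ 92) - (4 ^ 93) / 4 * Gn c r s (Suc 0)\<bar> \<le> 840"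
    using base_value_apx[OF c r s, of "Suc 0" 92] by simp
  have g: "base_value c r s 93 0 prec = peel_step c r s 0 (4 ^ 93) (base_value c r s 92 1 (4 ^ 92))"
    by (simp add: base_value_eval prec_def quarter_def)
  have "\<bar>peel_step c r s 0 (4 ^ 93) (base_value c r s 92 1 (4 ^ 92)) - (4 ^ 93) * Gn c r s 0\<bar> \<le> 4 * (r * s) / (c * (c + 4)) * 840 + 1"
    using peel_step_apx[OF c r s, of "base_value c r s 92 1 (4 ^ 92)" "4 ^ 93" 0 840] X by simp
  also have "\<dots> \<le> 1000"
  proof -
    have "real_of_int r * real_of_int s \<le> 3 * 3" using r s by (intro mult_mono) auto
    then show ?thesis using c by auto
  qed
  finally show ?thesis unfolding g unfolding apx_def prec_eq by (simp add: Gn_def Gq_def)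
qed

section \<open>Moments of a trial function\<close>

text \<open>The Beta values and the half-normalized singular integrals at quarter-integer exponents.\<close>
definition qB :: "nat \<Rightarrow> nat \<Rightarrow> real" where "qB j l = Gq 4 (int j) (int l)"
definition qY :: "nat \<Rightarrow> nat \<Rightarrow> real" where "qY j l = Gq 6 (int j) (int l)"
text \<open>The value of \<^term>\<open>beta (k / 4)\<close>, read off the Beta table.\<close>
definition bt :: "nat \<Rightarrow> real" where "bt k = (k + 6) / 2 * qB 2 k"
text \<open>The value of the singular integral with second exponent \<open>-1/2\<close>, one recursion step below the table.\<close>
definition wu :: "nat \<Rightarrow> real" where "wu k = (k + 8) * qY 2 k - 2"

lemma qB_Beta: "qB j l = Beta (j / 4 + 1) (l / 4 + 1)"
  by (simp add: qB_def Gq_def Gf_def)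

lemma dom_half: "a \<ge> 0 \<Longrightarrow> b > -1 \<Longrightarrow> dom (-1/2) a b" by (simp add: dom_def)

lemma qY_Wf: "Wf (j / 4) (l / 4) = 2 * qY j l"
proof -
  have e: "(real_of_int 6 - 8) / 4 = -1/2" by simp
  show ?thesis unfolding qY_def Gq_def e by (simp add: Gf_def)
qed

lemma qB_sym: "qB j l = qB l j" by (simp add: qB_Beta Beta_commute)

lemma qY_sym: "qY j l = qY l j"
  using Fint_sym[OF dom_half, of "j / 4" "l / 4"] qY_Wf[of j l] qY_Wf[of l j] by simp

lemma beta_bt: "beta (k / 4) = bt k"
proof -
  have "1 / 2 \<notin> (\<int>\<^sub>\<le>\<^sub>0 :: real set)" by (auto elim!: nonpos_Ints_cases)
  from Beta_plus1_left[OF this, of "k / 4 + 1"]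
  have "(1/2 + (k / 4 + 1)) * Beta (3/2) (k / 4 + 1) = 1/2 * Beta (1/2) (k / 4 + 1)" by simp
  then have "Beta (1/2) (k / 4 + 1) = (k + 6) / 2 * Beta (3/2) (k / 4 + 1)" by (simp add: field_simps)
  then show ?thesis unfolding bt_def qB_Beta by simp
qed

lemma wu_Wf: "Wf (k / 4) (-1/2) = wu k"
proof -
  have "(k / 4 + (-1/2) + (-1/2) + 3) * Wf (k / 4) (-1/2 + 1) = (-1/2 + 1) * Wf (k / 4) (-1/2) + 1 / (-1/2 + -1/2 + 2)"
    by (intro Fint_rec dom_half) auto
  then have "(k / 4 + 2) * Wf (k / 4) (real 2 / 4) = 1/2 * Wf (k / 4) (-1/2) + 1" by (simp add: add.commute)
  then show ?thesis unfolding qY_Wf wu_def using qY_sym[of k 2] by (simp add: field_simps)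
qed

lemma pi_qB: "pi = 8 * qB 2 2"
proof -
  have "1 / 2 \<notin> (\<int>\<^sub>\<le>\<^sub>0 :: real set)" by (auto elim!: nonpos_Ints_cases)
  then have "Gamma (3/2 :: real) = 1/2 * sqrt pi" using Gamma_plus1[of "1/2 :: real"] Gamma_one_half_real by (simp add: add.commute)
  moreover have "Gamma (3 :: real) = 2" using Gamma_fact[of 2, where 'a = real] by (simp add: fact_numeral)
  ultimately have "Beta (3/2 :: real) (3/2) = (1/2 * sqrt pi) * (1/2 * sqrt pi) / 2" by (simp only: Beta_def) simp
  then have "Beta (3/2 :: real) (3/2) = pi / 8" by simp
  then show ?thesis by (simp add: qB_Beta)
qed

lemma qB_bounds: "0 \<le> qB j l" "qB j l \<le> 1"
proof -
  have "ennreal (Beta (j / 4 + 1) (l / 4 + 1)) = (\<integral>\<^sup>+x. ennreal (x powr (j / 4) * (1 - x) powr (l / 4)) \<partial>M01)"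
    by (subst nn_integral_Beta) auto
  also have "\<dots> \<le> (\<integral>\<^sup>+x. ennreal 1 \<partial>M01)"
    by (intro nn_integral_mono ennreal_leI mult_le_one powr_le1) auto
  also have "\<dots> = ennreal 1" by (simp add: emeasure_restrict_space)
  finally have "Beta (j / 4 + 1) (l / 4 + 1) \<le> (1 :: real)" by (subst (asm) ennreal_le_iff) auto
  then show "qB j l \<le> 1" by (simp add: qB_Beta)
  show "0 \<le> qB j l" unfolding qB_Beta by (intro less_imp_le Beta_pos) auto
qed

lemma qY_bounds: "0 \<le> qY j l" "qY j l \<le> 1"
proof -
  show "0 \<le> qY j l" using qY_Wf[of j l] Fint_nonneg[of "-1/2" "j / 4" "l / 4"] by simp
  have "(-1/2 + 1) * Fint (-1/2) (j / 4) (l / 4) + j / 4 * Fint (-1/2 + 1) (j / 4 - 1) (l / 4) = 1 / (l / 4 + -1/2 + 2)"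
    by (intro Fint_peel dom_half) auto
  then have "qY j l + j / 4 * Fint (-1/2 + 1) (j / 4 - 1) (l / 4) = 1 / (l / 4 + 3/2)" by (simp add: qY_Wf[simplified] add.commute)
  moreover have "0 \<le> j / 4 * Fint (-1/2 + 1) (j / 4 - 1) (l / 4)" by (intro mult_nonneg_nonneg Fint_nonneg) auto
  moreover have "1 / (l / 4 + 3/2) \<le> (1 :: real)" by (simp add: divide_le_eq)
  ultimately show "qY j l \<le> 1" by linarith
qed

definition trial :: "(nat \<Rightarrow> real) \<Rightarrow> nat \<Rightarrow> real \<Rightarrow> real" where
  "trial F n x = (\<Sum>k<n. F k * ub (k / 4) x)"

text \<open>The inner sums of the quadratic forms. Shifting an exponent by \<open>1/2\<close> or by 1 moves the index by 2 or by 4, so all three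
  quadratic forms use the same few sums.\<close>
definition sC :: "(nat \<Rightarrow> real) \<Rightarrow> nat \<Rightarrow> nat \<Rightarrow> real" where
  "sC F n j = (\<Sum>l<n. F l * (4 / (j + l + 4)))"
definition sB :: "(nat \<Rightarrow> real) \<Rightarrow> nat \<Rightarrow> nat \<Rightarrow> real" where
  "sB F n j = (\<Sum>l<n. F l * qB j l)"
definition sY :: "(nat \<Rightarrow> real) \<Rightarrow> nat \<Rightarrow> nat \<Rightarrow> real" where
  "sY F n j = (\<Sum>l<n. F l * qY j l)"
definition sG :: "(nat \<Rightarrow> real) \<Rightarrow> nat \<Rightarrow> nat \<Rightarrow> real" where
  "sG F n k = (\<Sum>l<n. F l * (4 * bt l / (k + l + 8)))"

lemma bm_trial: "bm (trial F n)"
  unfolding trial_def by (intro bm_intros) auto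

lemma Kstar_trial: "0 < x \<Longrightarrow> x < 1 \<Longrightarrow> Kstar (trial F n) x = (\<Sum>k<n. F k * Kstar (ub (k / 4)) x)"
  unfolding trial_def by (subst Kstar_sum) (auto simp: Kstar_cmult intro!: bm_intros)

lemma integral_sum_sum:
  assumes "\<And>k. k < n \<Longrightarrow> bm (f k)" "\<And>k. k < n \<Longrightarrow> bm (g k)"
  shows "(\<integral>x. (\<Sum>k<n. F k * f k x) * (\<Sum>l<n. F l * g l x) \<partial>M01) = (\<Sum>k<n. \<Sum>l<n. F k * F l * (\<integral>x. f k x * g l x \<partial>M01))"
proof -
  have i: "integrable M01 (\<lambda>x. f k x * g l x)" if "k < n" "l < n" for k l using that assms by (intro integrable_bm bm_intros) auto
  have "(\<integral>x. (\<Sum>k<n. F k * f k x) * (\<Sum>l<n. F l * g l x) \<partial>M01) = (\<integral>x. (\<Sum>k<n. \<Sum>l<n. F k * F l * (f k x * g l x)) \<partial>M01)"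
    by (simp add: sum_product mult_ac)
  also have "\<dots> = (\<Sum>k<n. \<Sum>l<n. F k * F l * (\<integral>x. f k x * g l x \<partial>M01))"
    using i by (subst Bochner_Integration.integral_sum, (intro Bochner_Integration.integrable_sum integrable_mult_right i; simp),
      intro sum.cong refl, subst Bochner_Integration.integral_sum) auto
  finally show ?thesis .
qed

text \<open>Both summands contribute equally after exchanging the indices.\<close>
lemma sum_symmetrize:
  fixes h :: "nat \<Rightarrow> nat \<Rightarrow> real"
  assumes "\<And>k l. h k l = h l k"
  shows "(\<Sum>k<n. \<Sum>l<n. F k * F l * (p k * h k l + p l * h k l)) = 2 * (\<Sum>k<n. F k * p k * (\<Sum>l<n. F l * h k l))"
proof -
  have "(\<Sum>k<n. \<Sum>l<n. F k * F l * (p l * h k l)) = (\<Sum>k<n. \<Sum>l<n. F k * F l * (p k * h k l))"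
    by (subst sum.swap) (simp add: assms[of _ "_ :: nat"] mult_ac)
  then show ?thesis by (simp add: distrib_left sum.distrib sum_distrib_left mult_ac)
qed

lemma norm_trial: "ip (trial F n) (trial F n) = 2 * ((\<Sum>k<n. F k * sC F n k) + (\<Sum>k<n. F k * sB F n k))"
proof -
  have *: "(\<integral>x. ub (k / 4) x * ub (l / 4) x \<partial>M01) = 2 * (4 / (k + l + 4) + qB k l)" for k l :: nat
    by (subst ip_ub_ub) (auto simp: qB_Beta field_simps)
  have "ip (trial F n) (trial F n) = (\<Sum>k<n. \<Sum>l<n. F k * F l * (2 * (4 / (k + l + 4) + qB k l)))"
    unfolding trial_def by (subst integral_sum_sum) (auto simp: * intro!: bm_intros)
  also have "\<dots> = 2 * ((\<Sum>k<n. F k * sC F n k) + (\<Sum>k<n. F k * sB F n k))"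
    by (simp add: sC_def sB_def sum_distrib_left sum.distrib[symmetric] algebra_simps)
  finally show ?thesis .
qed

lemma form_trial: "ip (trial F n) (Kstar (trial F n)) =
    2 * (2 * (\<Sum>k<n. F k * bt k * sC F n (k + 2)) + (\<Sum>k<n. F k * bt k * sB F n (k + 2)) + 2 * (\<Sum>k<n. F k * sY F n k))"
proof -
  let ?h = "\<lambda>k l. 4 / (k + l + 6) :: real"
  have *: "(\<integral>x. Kstar (ub (k / 4)) x * ub (l / 4) x \<partial>M01) = 2 * (bt k * ?h k l + bt l * ?h k l) + (2 * (bt k * qB (k + 2) l) + 4 * qY k l)" for k l :: nat
  proof -
    have "(\<integral>x. Kstar (ub (k / 4)) x * ub (l / 4) x \<partial>M01) = 2 * ((bt k + bt l) / (k / 4 + l / 4 + 3/2) + bt k * Beta (k / 4 + 3/2) (l / 4 + 1) + 2 * qY k l)"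
      using ip_ub_Kub[of "k / 4" "l / 4"] by (simp add: beta_bt qY_Wf[simplified] mult.commute)
    moreover have "Beta (k / 4 + 3/2) (l / 4 + 1) = qB (k + 2) l" by (simp add: qB_Beta add_divide_distrib add.commute)
    moreover have "(bt k + bt l) / (k / 4 + l / 4 + 3/2) = bt k * ?h k l + bt l * ?h k l"
    proof -
      have "(x + y) / (m / 4) = x * (4 / m) + y * (4 / m)" for x y m :: real by (simp add: add_divide_distrib distrib_left)
      moreover have "k / 4 + l / 4 + 3/2 = (k + l + 6) / 4" by simp
      ultimately show ?thesis by (simp only: of_nat_add of_nat_numeral)
    qed
    ultimately show ?thesis by (simp only:) (simp add: algebra_simps)
  qed
  have "ip (trial F n) (Kstar (trial F n)) = (\<integral>x. (\<Sum>k<n. F k * Kstar (ub (k / 4)) x) * (\<Sum>l<n. F l * ub (l / 4) x) \<partial>M01)"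
    by (intro integral_cong_M01) (simp add: Kstar_trial mult.commute, simp add: trial_def)
  also have "\<dots> = (\<Sum>k<n. \<Sum>l<n. F k * F l * (2 * (bt k * ?h k l + bt l * ?h k l) + (2 * (bt k * qB (k + 2) l) + 4 * qY k l)))"
    by (subst integral_sum_sum) (auto simp: * intro!: bm_intros)
  also have "\<dots> = 2 * (\<Sum>k<n. \<Sum>l<n. F k * F l * (bt k * ?h k l + bt l * ?h k l))
     + ((\<Sum>k<n. \<Sum>l<n. F k * F l * (2 * (bt k * qB (k + 2) l))) + (\<Sum>k<n. \<Sum>l<n. F k * F l * (4 * qY k l)))"
    by (simp only: distrib_left sum.distrib sum_distrib_left mult.left_commute[of _ "2 :: real"] mult.assoc)
  also have "(\<Sum>k<n. \<Sum>l<n. F k * F l * (bt k * ?h k l + bt l * ?h k l)) = 2 * (\<Sum>k<n. F k * bt k * (\<Sum>l<n. F l * ?h k l))"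
    by (rule sum_symmetrize) (simp add: add.commute)
  also have "(\<Sum>k<n. F k * bt k * (\<Sum>l<n. F l * ?h k l)) = (\<Sum>k<n. F k * bt k * sC F n (k + 2))"
    by (simp add: sC_def add_ac)
  also have "(\<Sum>k<n. \<Sum>l<n. F k * F l * (2 * (bt k * qB (k + 2) l))) = 2 * (\<Sum>k<n. F k * bt k * sB F n (k + 2))"
    by (simp add: sB_def sum_distrib_left mult_ac)
  also have "(\<Sum>k<n. \<Sum>l<n. F k * F l * (4 * qY k l)) = 4 * (\<Sum>k<n. F k * sY F n k)"
    by (simp add: sY_def sum_distrib_left mult_ac)
  finally show ?thesis by simp
qed

lemma square_trial: "ip (Kstar (trial F n)) (Kstar (trial F n)) =
    2 * ((\<Sum>k<n. F k * bt k * sG F n k) + 4 * (\<Sum>k<n. F k * bt k * sY F n (k + 2)) + 2 * (\<Sum>k<n. F k * wu k * sC F n (k + 4)))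
    + 8 * qB 2 2 * (2 * sC F n 0)\<^sup>2"
proof -
  let ?h = "\<lambda>k l. 4 / (k + l + 8) :: real"
  have *: "(\<integral>x. Kstar (ub (k / 4)) x * Kstar (ub (l / 4)) x \<partial>M01) = 2 * (bt k * (4 * bt l / (k + l + 8)))
      + 4 * (bt k * qY l (k + 2) + bt l * qY k (l + 2)) + 2 * (wu k * ?h k l + wu l * ?h k l)
      + 8 * qB 2 2 * (4 * (4 / (k + 4)) * (4 / (l + 4)))" for k l :: nat
  proof -
    have "(\<integral>x. Kstar (ub (k / 4)) x * Kstar (ub (l / 4)) x \<partial>M01) = 2 * (bt k * bt l / (k / 4 + l / 4 + 2) + bt k * Wf (l / 4) (k / 4 + 1/2) + bt l * Wf (k / 4) (l / 4 + 1/2)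
        + (wu k + wu l) / (k / 4 + l / 4 + 2)) + pi * (2 / (k / 4 + 1)) * (2 / (l / 4 + 1))"
      using ip_Kub_Kub[of "k / 4" "l / 4"] by (simp only: beta_bt wu_Wf)
    moreover have "k / 4 + 1/2 = real (k + 2) / 4" for k :: nat by simp
    moreover have "x / (k / 4 + l / 4 + 2) = x * (4 / (k + l + 8))" for x
    proof -
      have "x / (m / 4) = x * (4 / m)" for m :: real by simp
      moreover have "k / 4 + l / 4 + 2 = (k + l + 8) / 4" by simp
      ultimately show ?thesis by (simp only: of_nat_add of_nat_numeral)
    qed
    moreover have "2 / (k / 4 + 1) = 2 * (4 / (k + 4))" for k :: nat by (simp add: field_simps)
    ultimately show ?thesis unfolding pi_qB by (simp only: qY_Wf) (simp add: algebra_simps add_divide_distrib)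
  qed
  have "ip (Kstar (trial F n)) (Kstar (trial F n)) = (\<integral>x. (\<Sum>k<n. F k * Kstar (ub (k / 4)) x) * (\<Sum>l<n. F l * Kstar (ub (l / 4)) x) \<partial>M01)"
    by (intro integral_cong_M01) (simp add: Kstar_trial)
  also have "\<dots> = (\<Sum>k<n. \<Sum>l<n. F k * F l * (2 * (bt k * (4 * bt l / (k + l + 8)))
      + 4 * (bt k * qY l (k + 2) + bt l * qY k (l + 2)) + 2 * (wu k * ?h k l + wu l * ?h k l)
      + 8 * qB 2 2 * (4 * (4 / (k + 4)) * (4 / (l + 4)))))"
    by (subst integral_sum_sum) (auto simp: * intro!: bm_intros)
  also have "\<dots> = (\<Sum>k<n. \<Sum>l<n. F k * F l * (2 * (bt k * (4 * bt l / (k + l + 8)))))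
      + 4 * ((\<Sum>k<n. \<Sum>l<n. F k * F l * (bt k * qY l (k + 2))) + (\<Sum>k<n. \<Sum>l<n. F k * F l * (bt l * qY k (l + 2))))
      + 2 * (\<Sum>k<n. \<Sum>l<n. F k * F l * (wu k * ?h k l + wu l * ?h k l))
      + 8 * qB 2 2 * (\<Sum>k<n. \<Sum>l<n. F k * F l * (4 * (4 / (k + 4)) * (4 / (l + 4))))"
  proof -
    have "(\<Sum>k<n. \<Sum>l<n. F k * F l * (a k l + 4 * (b k l + c k l) + 2 * d k l + w * e k l)) =
      (\<Sum>k<n. \<Sum>l<n. F k * F l * a k l) + 4 * ((\<Sum>k<n. \<Sum>l<n. F k * F l * b k l) + (\<Sum>k<n. \<Sum>l<n. F k * F l * c k l))
      + 2 * (\<Sum>k<n. \<Sum>l<n. F k * F l * d k l) + w * (\<Sum>k<n. \<Sum>l<n. F k * F l * e k l)" for a b c d e :: "nat \<Rightarrow> nat \<Rightarrow> real" and w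
      by (simp only: sum_distrib_left sum.distrib[symmetric]) (intro sum.cong refl, simp add: algebra_simps)
    then show ?thesis .
  qed
  also have "(\<Sum>k<n. \<Sum>l<n. F k * F l * (2 * (bt k * (4 * bt l / (k + l + 8))))) = 2 * (\<Sum>k<n. F k * bt k * sG F n k)"
    unfolding sG_def sum_distrib_left by (intro sum.cong refl) simp
  also have "(\<Sum>k<n. \<Sum>l<n. F k * F l * (bt l * qY k (l + 2))) = (\<Sum>k<n. \<Sum>l<n. F k * F l * (bt k * qY l (k + 2)))"
    by (subst sum.swap) (simp only: mult.commute[of "F _" "F _"])
  also have "(\<Sum>k<n. \<Sum>l<n. F k * F l * (bt k * qY l (k + 2))) = (\<Sum>k<n. F k * bt k * sY F n (k + 2))"
    unfolding sY_def sum_distrib_left qY_sym[of _ "_ + 2"] by (intro sum.cong refl) (simp add: qY_sym)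
  also have "(\<Sum>k<n. \<Sum>l<n. F k * F l * (wu k * ?h k l + wu l * ?h k l)) = 2 * (\<Sum>k<n. F k * wu k * (\<Sum>l<n. F l * ?h k l))"
    by (rule sum_symmetrize) (simp add: add.commute)
  also have "(\<Sum>k<n. F k * wu k * (\<Sum>l<n. F l * ?h k l)) = (\<Sum>k<n. F k * wu k * sC F n (k + 4))"
    by (simp add: sC_def add_ac)
  also have "(\<Sum>k<n. \<Sum>l<n. F k * F l * (4 * (4 / (k + 4)) * (4 / (l + 4)))) = (2 * sC F n 0)\<^sup>2"
    by (simp add: sC_def power2_eq_square sum_product sum_distrib_left mult_ac)
  finally show ?thesis by simp
qed

section \<open>Computing the moment sums\<close>

fun cauchy_dot :: "int \<Rightarrow> int list \<Rightarrow> int list \<Rightarrow> int" where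
  "cauchy_dot m (f # fs) (b # bs) = f * idiv (4 * b) m + cauchy_dot (m + 1) fs bs"
| "cauchy_dot m [] bs = 0"
| "cauchy_dot m (f # fs) [] = 0"

primrec cauchy_dots :: "nat \<Rightarrow> int \<Rightarrow> int list \<Rightarrow> int list \<Rightarrow> int list" where
  "cauchy_dots 0 m fs bs = []"
| "cauchy_dots (Suc n) m fs bs = cauchy_dot m fs bs # cauchy_dots n (m + 1) fs bs"

lemma cauchy_dots_eval: "cauchy_dots (numeral k) m fs bs = cauchy_dot m fs bs # cauchy_dots (pred_numeral k) (m + 1) fs bs"
  "cauchy_dots 1 m fs bs = [cauchy_dot m fs bs]"
  by (simp_all add: numeral_eq_Suc)

fun dot_list :: "int list \<Rightarrow> int list \<Rightarrow> int" where
  "dot_list (x # xs) (y # ys) = x * y + dot_list xs ys"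
| "dot_list [] ys = 0"
| "dot_list (x # xs) [] = 0"

fun pmul :: "int list \<Rightarrow> int list \<Rightarrow> int list" where
  "pmul (x # xs) (y # ys) = x * y # pmul xs ys"
| "pmul [] ys = []"
| "pmul (x # xs) [] = []"

fun padd :: "int list \<Rightarrow> int list \<Rightarrow> int list" where
  "padd (x # xs) (y # ys) = (x + y) # padd xs ys"
| "padd [] ys = []"
| "padd (x # xs) [] = []"

primrec row_dots :: "int \<Rightarrow> int \<Rightarrow> int list \<Rightarrow> int \<Rightarrow> int list \<Rightarrow> int list" where
  "row_dots c j fs l [] = []"
| "row_dots c j fs l (x # xs) = row_dot c j fs l x # row_dots c (j + 1) fs l xs"

primrec zero_column :: "nat \<Rightarrow> int \<Rightarrow> int list" where
  "zero_column 0 m = []"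
| "zero_column (Suc n) m = idiv (4 * prec) m # zero_column n (m + 1)"

lemma zero_column_eval: "zero_column (numeral k) m = idiv (4 * prec) m # zero_column (pred_numeral k) (m + 1)" "zero_column 1 m = [idiv (4 * prec) m]"
  by (simp_all add: numeral_eq_Suc)

primrec blist :: "int \<Rightarrow> int list \<Rightarrow> int list" where
  "blist k [] = []"
| "blist k (x # xs) = (k + 6) * x # blist (k + 1) xs"

primrec ulist :: "int \<Rightarrow> int list \<Rightarrow> int list" where
  "ulist k [] = []"
| "ulist k (x # xs) = ((k + 8) * x - 2 * prec) # ulist (k + 1) xs"

lemma cauchy_dots_nth: "i < n \<Longrightarrow> cauchy_dots n m fs bs ! i = cauchy_dot (m + i) fs bs"
proof (induction n arbitrary: m i)
  case (Suc n) then show ?case by (cases i) (auto simp: add_ac)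
qed simp

lemma row_dots_nth: "i < length xs \<Longrightarrow> row_dots c j fs l xs ! i = row_dot c (j + i) fs l (xs ! i)"
proof (induction xs arbitrary: j i)
  case (Cons x xs) then show ?case by (cases i) (auto simp: add_ac)
qed simp

lemma length_row_dots [simp]: "length (row_dots c j fs l xs) = length xs"
  by (induction xs arbitrary: j) auto

lemma zero_column_nth: "i < n \<Longrightarrow> zero_column n m ! i = idiv (4 * prec) (m + i)"
proof (induction n arbitrary: m i)
  case (Suc n) then show ?case by (cases i) (auto simp: add_ac)
qed simp

lemma length_zero_column [simp]: "length (zero_column n m) = n"
  by (induction n arbitrary: m) auto

lemma padd_nth: "i < length xs \<Longrightarrow> i < length ys \<Longrightarrow> padd xs ys ! i = xs ! i + ys ! i"
proof (induction xs ys arbitrary: i rule: padd.induct)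
  case (1 x xs y ys) then show ?case by (cases i) auto
qed auto

lemma length_padd [simp]: "length (padd xs ys) = min (length xs) (length ys)"
  by (induction xs ys rule: padd.induct) auto

lemma pmul_nth: "i < length xs \<Longrightarrow> i < length ys \<Longrightarrow> pmul xs ys ! i = xs ! i * ys ! i"
proof (induction xs ys arbitrary: i rule: pmul.induct)
  case (1 x xs y ys) then show ?case by (cases i) auto
qed auto

lemma length_pmul [simp]: "length (pmul xs ys) = min (length xs) (length ys)"
  by (induction xs ys rule: pmul.induct) auto

lemma blist_nth: "i < length xs \<Longrightarrow> blist k xs ! i = (k + i + 6) * xs ! i"
proof (induction xs arbitrary: k i)
  case (Cons x xs) then show ?case by (cases i) (auto simp: add_ac)
qed simp

lemma length_blist [simp]: "length (blist k xs) = length xs"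
  by (induction xs arbitrary: k) auto

lemma ulist_nth: "i < length xs \<Longrightarrow> ulist k xs ! i = (k + i + 8) * xs ! i - 2 * prec"
proof (induction xs arbitrary: k i)
  case (Cons x xs) then show ?case by (cases i) (auto simp: add_ac)
qed simp

lemma length_ulist [simp]: "length (ulist k xs) = length xs"
  by (induction xs arbitrary: k) auto

lemma dot_list_sum: "length xs \<le> length ys \<Longrightarrow> dot_list xs ys = (\<Sum>i<length xs. xs ! i * ys ! i)"
proof (induction xs ys rule: dot_list.induct)
  case (1 x xs y ys)
  then show ?case by (simp add: sum.lessThan_Suc_shift del: sum.lessThan_Suc)
qed auto

lemma cauchy_dot_apx:
  fixes m :: int
  assumes "0 < m" "length fs \<le> length bs"
  shows "\<bar>real_of_int (cauchy_dot m fs bs) - (\<Sum>i<length fs. real_of_int (fs ! i) * (4 * real_of_int (bs ! i) / (m + int i)))\<bar> \<le> (\<Sum>i<length fs. \<bar>real_of_int (fs ! i)\<bar>)"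
  using assms
proof (induction m fs bs rule: cauchy_dot.induct)
  case (1 m f fs b bs)
  have IH: "\<bar>real_of_int (cauchy_dot (m + 1) fs bs) - (\<Sum>i<length fs. real_of_int (fs ! i) * (4 * real_of_int (bs ! i) / (m + 1 + int i)))\<bar> \<le> (\<Sum>i<length fs. \<bar>real_of_int (fs ! i)\<bar>)"
    using 1 by (simp add: add_ac)
  have "\<bar>real_of_int (idiv (4 * b) m) - (4 * b) / m\<bar> \<le> 1" using 1 by (intro idiv_bounds) auto
  then have "\<bar>real_of_int f\<bar> * \<bar>real_of_int (idiv (4 * b) m) - (4 * b) / m\<bar> \<le> \<bar>real_of_int f\<bar> * 1"
    by (intro mult_left_mono) auto
  then have "\<bar>f * idiv (4 * b) m - f * (4 * b / m)\<bar> \<le> \<bar>real_of_int f\<bar>"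
    by (simp add: abs_mult[symmetric] right_diff_distrib)
  with IH show ?case
    by (simp add: sum.lessThan_Suc_shift add_ac del: sum.lessThan_Suc)
qed auto

lemma row_dot_apx:
  fixes j l :: int and E :: real
  assumes c: "c = 4 \<or> c = 6" and "j \<ge> 0" "l \<ge> 0" "apx E c j l X" "0 \<le> E"
  shows "\<bar>row_dot c j fs l X - prec * (\<Sum>i<length fs. real_of_int (fs ! i) * Gq c j (l + 4 * int i))\<bar> \<le> (E + length fs) * (\<Sum>i<length fs. \<bar>real_of_int (fs ! i)\<bar>)"
  using assms(2-)
proof (induction fs arbitrary: l X E)
  case (Cons f fs)
  have IH: "\<bar>row_dot c j fs (l + 4) (shift_step c j l X) - prec * (\<Sum>i<length fs. real_of_int (fs ! i) * Gq c j (l + 4 + 4 * int i))\<bar> \<le> (E + 1 + length fs) * (\<Sum>i<length fs. \<bar>real_of_int (fs ! i)\<bar>)"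
    using Cons.prems shift_step_apx[OF c] by (intro Cons.IH) auto
  have "\<bar>real_of_int f\<bar> * \<bar>X - prec * Gq c j l\<bar> \<le> \<bar>real_of_int f\<bar> * E"
    using Cons.prems unfolding apx_def by (intro mult_left_mono) auto
  also have "\<dots> \<le> \<bar>real_of_int f\<bar> * (E + 1 + length fs)" by (intro mult_left_mono) auto
  finally have "\<bar>f * X - prec * (f * Gq c j l)\<bar> \<le> (E + 1 + length fs) * \<bar>real_of_int f\<bar>"
    by (simp add: abs_mult[symmetric] right_diff_distrib mult_ac)
  moreover have "row_dot c j (f # fs) l X - prec * (\<Sum>i<length (f # fs). real_of_int ((f # fs) ! i) * Gq c j (l + 4 * int i))
     = (f * X - prec * (f * Gq c j l)) + (row_dot c j fs (l + 4) (shift_step c j l X) - prec * (\<Sum>i<length fs. real_of_int (fs ! i) * Gq c j (l + 4 + 4 * int i)))"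
    by (simp add: sum.lessThan_Suc_shift algebra_simps del: sum.lessThan_Suc)
  moreover have "(E + length (f # fs)) * (\<Sum>i<length (f # fs). \<bar>real_of_int ((f # fs) ! i)\<bar>)
     = (E + 1 + length fs) * \<bar>real_of_int f\<bar> + (E + 1 + length fs) * (\<Sum>i<length fs. \<bar>real_of_int (fs ! i)\<bar>)"
    by (simp add: sum.lessThan_Suc_shift distrib_left add_ac del: sum.lessThan_Suc)
  ultimately show ?case using IH by linarith
qed simp

lemma apx_mono: "apx E c j l X \<Longrightarrow> E \<le> E' \<Longrightarrow> apx E' c j l X"
  by (auto simp: apx_def)

lemma length_table_column [simp]: "length (table_column c r m l q) = m"
  by (induction m arbitrary: l q) auto

lemma table_column_apx:
  fixes r l :: int and E :: real
  assumes c: "c = 4 \<or> c = 6" and "r \<ge> 0" "l \<ge> 0" "length q = 4" "\<And>i. i < 4 \<Longrightarrow> apx E c r (l + int i) (q ! i)" "i < m"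
  shows "apx (E + i) c r (l + int i) (table_column c r m l q ! i)"
  using assms(2-)
proof (induction m arbitrary: E l q i)
  case (Suc m)
  obtain x0 x1 x2 x3 where q: "q = [x0, x1, x2, x3]"
    using Suc.prems(3) by (auto simp: length_Suc_conv eval_nat_numeral)
  have a: "apx E c r l x0" "apx E c r (l + 1) x1" "apx E c r (l + 2) x2" "apx E c r (l + 3) x3"
    using Suc.prems(4)[of 0] Suc.prems(4)[of 1] Suc.prems(4)[of 2] Suc.prems(4)[of 3] by (auto simp: q)
  show ?case
  proof (cases i)
    case 0
    then show ?thesis using a by (simp add: q)
  next
    case (Suc k)
    have "apx (E + 1 + k) c r (l + 1 + int k) (table_column c r m (l + 1) [x1, x2, x3, shift_step c r l x0] ! k)"
    proof (rule Suc.IH)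
      fix i :: nat assume "i < 4"
      then consider "i = 0" | "i = 1" | "i = 2" | "i = 3" by linarith
      then show "apx (E + 1) c r (l + 1 + int i) ([x1, x2, x3, shift_step c r l x0] ! i)"
        by cases (use a shift_step_apx[OF c _ _ a(1)] Suc.prems in \<open>auto simp: add_ac intro: apx_mono\<close>)
    qed (use Suc Suc.prems in auto)
    then show ?thesis by (simp add: q Suc add_ac)
  qed
qed simp

lemma Gq_sym: assumes "c = 4 \<or> c = 6" "j \<ge> 0" "l \<ge> 0" shows "Gq c j l = Gq c l j"
  using assms qB_sym[of "nat j" "nat l"] qY_sym[of "nat j" "nat l"] by (auto simp: qB_def qY_def)

lemma Gq_0: assumes "c = 4 \<or> c = 6" "l \<ge> 0" shows "Gq c 0 l = 4 / (l + c)"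
  using assms(1)
proof
  assume c: "c = 4"
  have "Gq 4 0 l = Beta 1 (l / 4 + 1)" by (simp add: Gq_def Gf_def)
  also have "\<dots> = 4 / (l + 4)" using assms by (subst Beta_1_right) (auto simp: field_simps)
  finally show ?thesis using c by simp
next
  assume c: "c = 6"
  have e: "(real_of_int 6 - 8) / 4 = -1/2" by simp
  have "(-1/2 + 1) * Fint (-1/2) 0 (l / 4) + 0 * Fint (-1/2 + 1) (0 - 1) (l / 4) = 1 / (l / 4 + -1/2 + 2)"
    using assms by (intro Fint_peel dom_half) auto
  then have "Gq 6 0 l = 1 / (l / 4 + -1/2 + 2)" unfolding Gq_def e by (simp add: Gf_def)
  also have "\<dots> = 4 / (l + 6)" using assms by (simp add: field_simps)
  finally show ?thesis using c by simp
qed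

lemma apx_0: assumes "c = 4 \<or> c = 6" "l \<ge> 0" shows "apx 1 c 0 l (idiv (4 * prec) (l + c))"
proof -
  have "\<bar>real_of_int (idiv (4 * prec) (l + c)) - real_of_int (4 * prec) / real_of_int (l + c)\<bar> \<le> 1"
    using assms by (intro idiv_bounds) auto
  then show ?thesis unfolding apx_def Gq_0[OF assms] by (simp add: mult.commute)
qed

lemma apx_sym: "c = 4 \<or> c = 6 \<Longrightarrow> j \<ge> 0 \<Longrightarrow> l \<ge> 0 \<Longrightarrow> apx E c j l X \<longleftrightarrow> apx E c l j X"
  unfolding apx_def using Gq_sym[of c j l] by simp

text \<open>The recursion couples indices that agree modulo 4, so a row splits into four independent chains of seven.\<close>
definition residue_class :: "int list \<Rightarrow> nat \<Rightarrow> int list" where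
  "residue_class fs r = map (\<lambda>i. fs ! (4 * i + r)) [0..<7]"

lemma sum_residues: "(\<Sum>l<4 * m. h l) = (\<Sum>i<m. h (4 * i)) + (\<Sum>i<m. h (4 * i + 1)) + ((\<Sum>i<m. h (4 * i + 2)) + (\<Sum>i<m. h (4 * i + 3)))"
  for h :: "nat \<Rightarrow> real"
proof (induction m)
  case (Suc m)
  have "4 * Suc m = Suc (Suc (Suc (Suc (4 * m))))" by simp
  then have "(\<Sum>l<4 * Suc m. h l) = (\<Sum>l<4 * m. h l) + h (4 * m) + h (4 * m + 1) + h (4 * m + 2) + h (4 * m + 3)"
    by (simp add: eval_nat_numeral)
  then show ?case using Suc by simp
qed simp

definition row_sums :: "int \<Rightarrow> int list \<Rightarrow> int list \<Rightarrow> int list \<Rightarrow> int list \<Rightarrow> int list" where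
  "row_sums c fs xs ys zs = padd (padd (row_dots c 0 (residue_class fs 0) 0 (zero_column 30 c)) (row_dots c 0 (residue_class fs 1) 1 xs))
     (padd (row_dots c 0 (residue_class fs 2) 2 ys) (row_dots c 0 (residue_class fs 3) 3 zs))"

lemma row_sums_apx:
  assumes c: "c = 4 \<or> c = 6" and len: "length fs = 28" "length xs = 30" "length ys = 30" "length zs = 30"
    and x: "\<And>j. j < 30 \<Longrightarrow> apx 1030 c 1 (int j) (xs ! j)" and y: "\<And>j. j < 30 \<Longrightarrow> apx 1030 c 2 (int j) (ys ! j)" and z: "\<And>j. j < 30 \<Longrightarrow> apx 1030 c 3 (int j) (zs ! j)"
    and j: "j < 30"
  shows "\<bar>row_sums c fs xs ys zs ! j - prec * (\<Sum>l<28. real_of_int (fs ! l) * Gq c (int j) (int l))\<bar> \<le> 1040 * (\<Sum>l<28. \<bar>real_of_int (fs ! l)\<bar>)"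
proof -
  have part: "\<bar>row_dot c (int j) (residue_class fs r) (int r) X - prec * (\<Sum>i<7. real_of_int (fs ! (4 * i + r)) * Gq c (int j) (int (4 * i + r)))\<bar> \<le> 1040 * (\<Sum>i<7. \<bar>real_of_int (fs ! (4 * i + r))\<bar>)"
    if "apx 1030 c (int r) (int j) X" for r X
  proof -
    have "apx 1030 c (int j) r X" using that apx_sym[OF c, of "int r" "int j"] by simp
    from row_dot_apx[OF c _ _ this, of "residue_class fs r"]
    have "\<bar>row_dot c (int j) (residue_class fs r) (int r) X - prec * (\<Sum>i<7. real_of_int (fs ! (4 * i + r)) * Gq c (int j) (int (4 * i + r)))\<bar> \<le> 1037 * (\<Sum>i<7. \<bar>real_of_int (fs ! (4 * i + r))\<bar>)"
      by (simp add: residue_class_def add_ac)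
    also have "\<dots> \<le> 1040 * (\<Sum>i<7. \<bar>real_of_int (fs ! (4 * i + r))\<bar>)" by (intro mult_right_mono sum_nonneg) auto
    finally show ?thesis .
  qed
  have j0: "apx 1030 c 0 (int j) (idiv (4 * prec) (c + j))"
    using apx_0[OF c, of j] by (auto simp: add.commute intro: apx_mono)
  have rw: "row_sums c fs xs ys zs ! j = row_dot c j (residue_class fs 0) 0 (idiv (4 * prec) (c + j)) + row_dot c j (residue_class fs 1) 1 (xs ! j)
      + (row_dot c j (residue_class fs 2) 2 (ys ! j) + row_dot c j (residue_class fs 3) 3 (zs ! j))"
    using j len by (simp add: row_sums_def padd_nth row_dots_nth zero_column_nth)
  have s1: "(\<Sum>l<28. real_of_int (fs ! l) * Gq c (int j) (int l)) = (\<Sum>i<7. real_of_int (fs ! (4 * i)) * Gq c (int j) (int (4 * i))) + (\<Sum>i<7. real_of_int (fs ! (4 * i + 1)) * Gq c (int j) (int (4 * i + 1))) + ((\<Sum>i<7. real_of_int (fs ! (4 * i + 2)) * Gq c (int j) (int (4 * i + 2))) + (\<Sum>i<7. real_of_int (fs ! (4 * i + 3)) * Gq c (int j) (int (4 * i + 3))))"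
    using sum_residues[of "\<lambda>l. real_of_int (fs ! l) * Gq c (int j) (int l)" 7] by simp
  have s2: "(\<Sum>l<28. \<bar>real_of_int (fs ! l)\<bar>) = (\<Sum>i<7. \<bar>real_of_int (fs ! (4 * i))\<bar>) + (\<Sum>i<7. \<bar>real_of_int (fs ! (4 * i + 1))\<bar>) + ((\<Sum>i<7. \<bar>real_of_int (fs ! (4 * i + 2))\<bar>) + (\<Sum>i<7. \<bar>real_of_int (fs ! (4 * i + 3))\<bar>))"
    using sum_residues[of "\<lambda>l. \<bar>real_of_int (fs ! l)\<bar>" 7] by simp
  have tri: "\<bar>(a0 + a1 + (a2 + a3)) - p * (b0 + b1 + (b2 + b3))\<bar> \<le> 1040 * (s0 + s1 + (s2 + s3))"
    if "\<bar>a0 - p * b0\<bar> \<le> 1040 * s0" "\<bar>a1 - p * b1\<bar> \<le> 1040 * s1" "\<bar>a2 - p * b2\<bar> \<le> 1040 * s2" "\<bar>a3 - p * b3\<bar> \<le> 1040 * s3"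
    for a0 a1 a2 a3 b0 b1 b2 b3 s0 s1 s2 s3 p :: real
    using that by (simp add: distrib_left)
  show ?thesis unfolding rw s1 s2 of_int_add
    using tri[OF part[of 0, simplified, OF j0] part[of 1, simplified, OF x[OF j]] part[of 2, simplified, OF y[OF j]] part[of 3, simplified, OF z[OF j]]]
    by (simp add: add_ac)
qed

section \<open>Tables of integer values\<close>

text \<open>Coefficients of a trial function of norm about \<open>10 ^ 14\<close>, obtained by minimizing the residual numerically. Entries 4, 12 and 20 vanish
  because symmetrized powers with exponent 1, 3 or 5 are linear combinations of those with smaller integer exponents.\<close>
definition trial_coeffs :: "int list" where "trial_coeffs = [239673362594053572351336, 48088878, 52703671132760, 999919817420, 0, -1066472224214577, 10628052768625015, -106234706230990687,
    -1198139371263208486254654, -6953667731776176555, 43744341323200560939, -232122280937077788804, 0, -3961707502065397782494,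
    12807581843549602267404, -35241418961820772327687, 1282752843815238183701506, -164651589077185623644784, 278781236083647725471892,
    -399306264372403499064731, 0, -483234731606662964700894, 400025318861204148041104, -268258387075294324300842, 143123096490705953581942,
    -57363150354335765859170, 16572191287526813208458, -3056945059524358103257]"

lemma residues:
  "residue_class trial_coeffs 0 = [239673362594053572351336, 0, -1198139371263208486254654, 0, 1282752843815238183701506, 0, 143123096490705953581942]"
  "residue_class trial_coeffs 1 = [48088878, -1066472224214577, -6953667731776176555, -3961707502065397782494, -164651589077185623644784, -483234731606662964700894,
    -57363150354335765859170]"
  "residue_class trial_coeffs 2 = [52703671132760, 10628052768625015, 43744341323200560939, 12807581843549602267404, 278781236083647725471892, 400025318861204148041104,
    16572191287526813208458]"
  "residue_class trial_coeffs 3 = [999919817420, -106234706230990687, -232122280937077788804, -35241418961820772327687, -399306264372403499064731, -268258387075294324300842,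
    -3056945059524358103257]"
  by (simp_all add: residue_class_def trial_coeffs_def upt_rec)

lemmas base_value_evals = base_value_eval peel_step_def prec_def quarter_eval int_eval

lemma gl_4_1_1: "base_value 4 1 1 93 0 prec =
    60615705075129905205775467586469521423997321711025258394"
  by (simp only: base_value_evals)

lemma gl_4_1_2: "base_value 4 1 2 93 0 prec =
    48984886977175063026820817054521752901670054863400535422"
  by (simp only: base_value_evals)

lemma gl_4_1_3: "base_value 4 1 3 93 0 prec =
    40852189747901009534280613152474036167544437724210790847"
  by (simp only: base_value_evals)

lemma gl_4_2_2: "base_value 4 2 2 93 0 prec =
    38515813862747145629679947977008337678639552471074394008"
  by (simp only: base_value_evals)

lemma gl_4_2_3: "base_value 4 2 3 93 0 prec =
    31336867277897462053014867576248447022970279267524291776"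
  by (simp only: base_value_evals)

lemma gl_4_3_3: "base_value 4 3 3 93 0 prec =
    24928325272512137085239916453632981645860303291585841296"
  by (simp only: base_value_evals)

lemma gl_6_1_1: "base_value 6 1 1 93 0 prec =
    47448549694751795333774667892001048140967662201183477709"
  by (simp only: base_value_evals)

lemma gl_6_1_2: "base_value 6 1 2 93 0 prec =
    41071272635936566511237541269701937326981124638469039010"
  by (simp only: base_value_evals)

lemma gl_6_1_3: "base_value 6 1 3 93 0 prec =
    36160841804789971062406985730144437893818755520937772954"
  by (simp only: base_value_evals)

lemma gl_6_2_2: "base_value 6 2 2 93 0 prec =
    35219080918217873296144045701333597911602199553342093272"
  by (simp only: base_value_evals)

lemma gl_6_2_3: "base_value 6 2 3 93 0 prec =
    30754010296164743022858297435296024872202499886185313186"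
  by (simp only: base_value_evals)

lemma gl_6_3_3: "base_value 6 3 3 93 0 prec =
    26663126448477136287113288111597106264810514732660855557"
  by (simp only: base_value_evals)

lemmas base_values = gl_4_1_1 gl_4_1_2 gl_4_1_3 gl_4_2_2 gl_4_2_3 gl_4_3_3 gl_6_1_1 gl_6_1_2 gl_6_1_3 gl_6_2_2 gl_6_2_3 gl_6_3_3

definition colB1 :: "int list" where "colB1 = [78463771692333509547947367790095830201279443055800431411, 60615705075129905205775467586469521423997321711025258394,
    48984886977175063026820817054521752901670054863400535422, 40852189747901009534280613152474036167544437724210790847,
    34872787418814893132421052351153702311679752469244636182, 30307852537564952602887733793234760711998660855512629197,
    26719029260277307105538627484284592491820029925491201139, 23830444019608922228330357672276521097734255339122961327,
    21460176873116857312259109139171509114879847673381314573, 19483619488434612387570686009936631886284853407115261626,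
    17812686173518204737025751656189728327880019950327467426, 16383430263481134031977120899690108254692300545647035912,
    15148360145729546338065253510003418198738716004739751463, 14071502963869442279912162118287567473427949682916577841,
    13125137180487098227282132799297694557385277858136028629, 12287572697610850523982840674767581191019225409235276934,
    11541607730079654352811621721907366246658069336944572543, 10873434108444569034477579818676756684012506573162810149,
    10271846489076859482220799582059065305779782671584718057, 9727661718941923331486415534191001776223553448977927572,
    9233286184063723482249297377525892997326455469555658034, 8782389087589844220154968315085072706317793770631500504,
    8369652694803366985513244103899979138042785880550511009, 7990579269130865593720984188799751459040776047374726219,
    7641340290259633226689073691745566618477066595494337683, 7318657572991536850129140262570893921931494808859583753,
    7019708711770565858817559571012885728681046222397202781, 6742051258329167844702080409299790293565654789972425247,
    6483561458402113040827092829359874706586601959813377428, 6242384400492781430992501988663409521647451454615527318]"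

lemma colB1_eq: "table_column 4 1 30 0 [idiv (4 * prec) 5, base_value 4 1 1 93 0 prec, base_value 4 1 2 93 0 prec, base_value 4 1 3 93 0 prec] = colB1"
  by (simp only: base_values) (simp only: colB1_def table_column_eval append.simps shift_step_def prec_def int_eval)

definition colB2 :: "int list" where "colB2 = [65386476410277924623289473158413191834399535879833692842, 48984886977175063026820817054521752901670054863400535422,
    38515813862747145629679947977008337678639552471074394008, 31336867277897462053014867576248447022970279267524291776,
    26154590564111169849315789263365276733759814351933477136, 22265857716897755921282189570237160409850024937909334282,
    19257906931373572814839973988504168839319776235537197004, 16873697765021710336238774848749163781599381144051541725,
    14945480322349239913894736721923015276434179629676272649, 13359514630138653552769313742142296245910014962745600569,
    12036191832108483009274983742815105524574860147210748127, 10918275024425812570507442549190635388093717210856879939,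
    9963653548232826609263157814615343517622786419784181766, 9140720536410657694000056770939465852464747079773305652,
    8425334282475938106492488619970573867202402103047523688, 7798767874589866121791030392279025277209798007754914242,
    7246293489623873897645932956083886194634753759843041284, 6756184744303529599913085439390039977908726102441138960,
    6319000711856953579869366464977930400401801577285642766, 5927063584688298252561183098132059210679446485893734823,
    5574071915095287613573794581602989380488272122956185603, 5254810356680523022154622008414475538373453635231996968,
    4964929130744749241325930793911231028887129810724433601, 4700774567166581372720938319208184891228526523295031066,
    4459257532076230090859035665282391504390617698364948482, 4237750287645583082382759684205222208365688415509674974,
    4034004918730108758577318770052875210970792971213602300, 3846088282227202941317131352079424001914248973605025417,
    3672329732298071839530970547879616533027567516300545808, 3511278809763483125402858024055755544074427544279444978]"

lemma colB2_eq: "table_column 4 2 30 0 [idiv (4 * prec) 6, base_value 4 1 2 93 0 prec, base_value 4 2 2 93 0 prec, base_value 4 2 3 93 0 prec] = colB2"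
  by (simp only: base_values) (simp only: colB2_def table_column_eval append.simps shift_step_def prec_def int_eval)

definition colB3 :: "int list" where "colB3 = [56045551208809649677105262707211307286628173611286022436, 40852189747901009534280613152474036167544437724210790847,
    31336867277897462053014867576248447022970279267524291776, 24928325272512137085239916453632981645860303291585841296,
    20380200439567145337129186438985929922410244949558553613, 17021745728292087305950255480197515069810182385087829519,
    14463169512875751716776092727499283241370898123472750050, 12464162636256068542619958226816490822930151645792920648,
    10869440234435810846468899434125829291952130639764561926, 9574731972164299109597018707611102226768227591611904104,
    8507746772279853951044760427940754847865234190278088264, 7616988277712041887156641138610077725123981561317895951,
    6864909621748933166190883853132102710706608825114460163, 6223575781906794421238062159947216447399347934547737667,
    5671831181519902634029840285293836565243489460185392176, 5193401098440028559424982594506871176220896519080383602,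
    4775589302086214376480614854352767103100249617470928809, 4408366178850646048376960696629278316907871453637980847,
    4083718450694329896501485005411562326975312411333482366, 3795177725783097793425948819062713551853732071635664939,
    3537473557100899538133788781002049706000184901830317636, 3306274634137984536282720522471958737680903590228485635,
    3097993307423284749070092073070840385981271484459883174, 2909636256433708308293227427948080389754527921587343119,
    2738689205497470610168094540130619127225949601417020105, 2583027057920300418970875408181217763813205929866004402,
    2440843211909254650782496784843692425318577533210817046, 2310593497756180127174033545723475603628595702437007770,
    2190951364397976488134475632104495301780759681133616084, 2080771796658019781948760745479314309738415887947614657]"

lemma colB3_eq: "table_column 4 3 30 0 [idiv (4 * prec) 7, base_value 4 1 3 93 0 prec, base_value 4 2 3 93 0 prec, base_value 4 3 3 93 0 prec] = colB3"
  by (simp only: base_values) (simp only: colB3_def table_column_eval append.simps shift_step_def prec_def int_eval)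

definition colY1 :: "int list" where "colY1 = [56045551208809649677105262707211307286628173611286022436, 47448549694751795333774667892001048140967662201183477709,
    41071272635936566511237541269701937326981124638469039010, 36160841804789971062406985730144437893818755520937772954,
    32268650695981313450454545195061055710482887836801043220, 29111154240948189668590322072868987939841221519040786118,
    26500565417772022000181496719679339362575850126966521024, 24307704370040502161992966499206808645423619272834000081,
    22440865150678934476772248623372285059009503050013918478, 20833193106688669731079065699516977886687928187176375794,
    19434831211058714389712025903247446203538708067617582534, 18207860862560371387369520885844153582514410199031052673,
    17122943842997729652545907694088354104986432116392265482, 16157034575758752310132971631022563299723134756857991979,
    15291785441072878329687403214965435272635312612215305957, 14512412398064785559515244662543362207363553559654873651,
    13806873293977490906793949501928512763886200193427480127, 13165262905468008972921981391932557561016155607506876586,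
    12579360951419142588333877670577030000323013941911028917, 12042289860350154823674095784351208466576652565678203115,
    11548252468473789721327965418770208616368219723343595235, 11092328727118607809628556972367055285688816131962462275,
    10670316521943451698447932597651767445665726712481361468, 10278605848832898825456105005203870893725826207763961473,
    9914078482941662384104372331530481983407647069385121266, 9574027323759716859929108372973056272977714490315586052,
    9256091065907108151460572087653079006988575191822982102, 8958200909289548555589861964478285204665432404905868303,
    8678536802470791902978234701320536350547826636991910645, 8415491291203692251394034144447792017401218420566053920]"

lemma colY1_eq: "table_column 6 1 30 0 [idiv (4 * prec) 7, base_value 6 1 1 93 0 prec, base_value 6 1 2 93 0 prec, base_value 6 1 3 93 0 prec] = colY1"
  by (simp only: base_values) (simp only: colY1_def table_column_eval append.simps shift_step_def prec_def int_eval)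

definition colY2 :: "int list" where "colY2 = [49039857307708443467467104868809893875799651909875269632, 41071272635936566511237541269701937326981124638469039010,
    35219080918217873296144045701333597911602199553342093272, 30754010296164743022858297435296024872202499886185313186,
    27244365170949135259703947149338829930999806616597372017, 24419035815177087070030633212533253939089382339609018455,
    22099585723194580479414177424687241087229464367128792778, 20164002708012695599404047528330428658974458691760585517,
    18526168316245411976598684061550404353079868499286212971, 17123648463239928959425167732308825892955311669408006102,
    15910129646790207189857291522515866817038565530617867812, 14850567223356884883377540382397609717595716694250073048,
    13917978550187729669814473572290807976179329780136028904, 13091267197635305531959940906987870955997080019341477790,
    12353712380125970187521326644728728605197253151751155409, 11691898616059694989106768479315470025574685901769240259,
    11094943378188428797189912191483127312852873627863844070, 10553930572125344804847441243911664464841792161695371874,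
    10061488795709008390359906288467885769007318394593115887, 9611473130037307576954275663400054395444610415103935057,
    9198722083321824295849082860638854415045550043535869650, 8818869839969830039311525935097889413090524804583011887,
    8468199723691238229985422497516669427845359087365513197, 8143528731219079938358944754007728489539929573216473512,
    7842115741485761365491948777571638770434155838611042038, 7561587944896711977569869454648747088494835772897348302,
    7299881424128735847593341655559972316685100678739598657, 7055192821150615455383770857427595772731585503829067067,
    6825939759047569113419176528760310064053227162028962616, 6610728229629885931399116231586906656120010279331055307]"

lemma colY2_eq: "table_column 6 2 30 0 [idiv (4 * prec) 8, base_value 6 1 2 93 0 prec, base_value 6 2 2 93 0 prec, base_value 6 2 3 93 0 prec] = colY2"
  by (simp only: base_values) (simp only: colY2_def table_column_eval append.simps shift_step_def prec_def int_eval)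

definition colY3 :: "int list" where "colY3 = [43590984273518616415526315438942127889599690586555795228, 36160841804789971062406985730144437893818755520937772954,
    30754010296164743022858297435296024872202499886185313186, 26663126448477136287113288111597106264810514732660855557,
    23472068454971562685283400620968838094399833392760812815, 20921093674397796761874675290367486003025008916232922117,
    18840251759493689671472266289959729132320953542457494558, 17113990855398574177552852978691499977054561518858598709,
    15661195254829765354718504279873325585675182952816878466, 14423363589336954418712457230542118264203385420530624261,
    13357315473958674807263796634632130692505740594968875706, 12430532343251273857190506360976318456659987414441476651,
    11618090203179373044463205431699581634034779478337550668, 10900586717709215779176978296535367768280165416852957712,
    10262707562744777859528706858854770590038261749540849109, 9692214373657867473193756862622351736424243189315149166,
    9179217100975543405077504093845417361366246489598264236, 8715642159399619012456756412311502208840663684618440597,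
    8294837850947139120203348420534584656345497519245759246, 7911277639477592206264936506951150756540931059684946992,
    7560334234094943877294005453280473261777339946679060467, 7238105623062827649994329021807846186786717377143059597,
    6941279707289549127616722639708627688929055269784630639, 6667027949528688267602265211747337483779787237346061043,
    6412921071093916171224863730475493726528968015484543176, 6176861669379895162555169681504634507727482200576873139,
    5957029942683802918759640571029427815870557823429811652, 5751839656517526828555600899137091524724490265708783631,
    5559902177155157368746269559910245975042457264472991515, 5379996908061002416482658082829902143004924387840928069]"

lemma colY3_eq: "table_column 6 3 30 0 [idiv (4 * prec) 9, base_value 6 1 3 93 0 prec, base_value 6 2 3 93 0 prec, base_value 6 3 3 93 0 prec] = colY3"
  by (simp only: base_values) (simp only: colY3_def table_column_eval append.simps shift_step_def prec_def int_eval)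

definition XL :: "int list" where "XL = [4882670650984700815837901488604586434449704581995254389322597563807433,
    2493668539095156580817472903855161369857352096862843126471537039244995476539064,
    3773069137033650577292088316688939928355131093587183241953614013959130242560323,
    4434324054093586055918510579780433598357110301888066702826473937725643322062678,
    4757435901147629779941953041796396488975359582728085206296718564047634906195144,
    4886897415693173321009129804831821300852299290666481723675549416248443162752855,
    4902384060930636462028018643844211234386991503756014106319956969614284744783478,
    4850009103190377995422212051351648062990337847830510319406922866405908546863905,
    4757435900300060054040642251562863668314668498082563176435417728223647030530721,
    4641703139331060880900151625573503458432220282532222554983715230777268149551385,
    4513501937245918686444131181958973626128774780999325905250290853285601925819651,
    4379617909089657936266069184096124602283263079857619261075441036986517090807897,
    4244376365667437715709242778002403462016260920179335884952538030073587309560366,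
    4110523418410658675871478461076963410300855187618768764452005825254254927055427,
    3979776736101456972353303167116459653948030804842575147572726067986370731727383,
    3853177105739396795486570972584413041665276437335727523513526538973809021739690,
    3731316831206985102604749927399511242829900283902240433226365200531765105816668,
    3614490314312077980675132428242487078926645403666547170515720314609942609328248,
    3502794536620012998788859019248848185009436252070282796899346689795751501175577,
    3396196757297368575030526961153125574690255675112799447232343437788905460320506,
    3294580452452220930227275717945084617213570672376837337663490252350852438968197,
    3197776636435236774535735020843028608848689611230646435968043897451901925646408,
    3105585259564446721492847419116496219300895313153060587569064762145469451331555,
    3017789810108513502952831449691119911603496545411403421735904825337923152695658,
    2934167229365947975425295810478505989645147925939679250468234630212628923615571,
    2854494576601393409160239050140031684638187988082606087718800053553263092238426,
    2778553431736468815237734218885868031142216380446717164018970581989173343843656,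
    2706132720491861114401606903383756441755802305682224922848753345822460654167258,
    2637030439766694834385362162276776206844347627813615783213134526125639298880794,
    2571054618537726847638176699948615064080552085964796437276089494561206451840540]"

lemma XL_eq: "row_sums 4 trial_coeffs colB1 colB2 colB3 = XL"
  by (simp only: row_sums_def residues zero_column_eval row_dots.simps row_dot.simps padd.simps shift_step_def prec_def colB1_def colB2_def colB3_def XL_def int_eval)

definition YL :: "int list" where "YL = [-3773069130483747155535860525212782550417251337038049093452135477238222729857834,
    -2449703671424490509197728530122301231890773131624758955365455243611198761564408,
    -1561177144455671048996993989112071477622918729105110051480898390215667196777507,
    -944218511398649345141361484678217430889837032688183546490691636866358757721734,
    -504813092441581342460819755428206656064962437965289546523012468188518511008322,
    -185730115026187624133746000517200581016710470463990190077065714494229788063757,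
    49431292090096979757459938309389162356590943374556396460645807287835412572347,
    224661101302395200955060209762631110043839784364045892902210133703782334787473,
    356241913844039467233645801905304887849521535307571888437780743124712519829048,
    455502255131398406118531867773482080351835134818641396280034210023953357195132,
    530492259910730922807218103353630996787411213326545142092426632924535426060723,
    587037751518825910851389059444250083057442434569342654354319212244710595510697,
    629422395363675458174646824998112514840800058041918958322872428718375852472973,
    660840190290979588753377084994123476175810158501449768874272986360142897506160,
    683702194767932662252468683063174702078212415053578491594343906997287371194819,
    699848473378473117648709449385019628432589586412260954084508689805387497927617,
    710697079820757743954616664925765477418808757681695199217948084953121823999403,
    717350403206770258376198982834640834093958652294803032032191583226363033839142,
    720672140456852127789697561534189162266434781427377202919353125596075098208270,
    721343714137270965407171623925159239581389817101799486926618704173431111357145,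
    719906101916296731837610737994225570591321447774526050359224234149463022170686,
    716791177257295067743874060029143693346430525626396212845471903231416412314611,
    712345418917900974271745659208360474807309399189480883900428489200705118775538,
    706848007374966323423598595320682495611030170204073542833426629157344597060638,
    700524750775842139338522026475523314181877911981341149544562321680563790802008,
    693558883208305635493776742974519656953438985670920747016836282872207976121903,
    686099496928388452832832474283371466426501131553241206828330844055072303488216,
    678268170221171812892576740425065981150601973968697455208853472523122579053204,
    670164208842227156351673955184882481484910666027738484916933802732961875341533,
    661868814659877990804050860576997160248105177437979181089094004046714937776284]"

lemma YL_eq: "row_sums 6 trial_coeffs colY1 colY2 colY3 = YL"
  by (simp only: row_sums_def residues zero_column_eval row_dots.simps row_dot.simps padd.simps shift_step_def prec_def colY1_def colY2_def colY3_def YL_def int_eval)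

definition CL :: "int list" where "CL = [4882670650984700815837901488604586434449704580781213437987989021897944,
    -2493668531239588521533138487531814189507707221426554400429408227604462472308472,
    -3773069130483747155535860525212782550417251337038049094928088272420641753183801,
    -4434324048491949753376680422798131828587643100807253489599605156078290908672596,
    -4757435896264959128957252225958495000370773148278380624741739097054010798601210,
    -4886897411373542248024688516935686136389375883400375958507102355686966355845958,
    -4902384057063248719612561154676863841528433348609139321763721933132174813201713,
    -4850009099693738666505004613383832387661550203162975679342357906174593333773417,
    -4757435897112528854858563016192027821031464232923902652251199256468719333824487,
    -4641703136404925451928895113339139843886946246343269317796569170540361454556893,
    -4513501934543521881338578523345745657070884235874808960029672030349504164713251,
    -4379617906580780169207727051534937414893003815564653572096718463252277396251043,
    -4244376363327476242428474332865100435393747739666197388776793600263910108572300,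
    -4110523416219329683931790298718752775474025487238328796716850353417103695198965,
    -3979776734041850403871804608585163448313186352134276945218265357576549109362494,
    -3853177103797275032910946166004785749826875729980726355170936267830259301191068,
    -3731316829370253904771479026580605062643984304782360285808458230556714159379886,
    -3614490312570381420736120089809288744818723268341259312294192479397219603624471,
    -3502794534964419198249401234745824390753664937988231765816180126772327668279874,
    -3396196755720122942087904687121723600768883640094901667481516501338954352807316,
    -3294580450946550282614595738487007296352204953024083698074206641119094310849503,
    -3197776634995192302755424900432025515506165858586450925661520928408933819718552,
    -3105585258184776940396349526988672032762632459013037586183976706495737855806906,
    -3017789808784560601374189959354483344949920521094430925155369753194117687053209,
    -2934167228093562599109348807744924732040533844054814974949231250633831627086763,
    -2854494575376864095872025981963768041950208123870766081850184283234905333115674,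
    -2778553430556463173267219654847257154469996555160384696919533832908929343211276,
    -2706132719353376485772937187570306857688216791855558526439994833306949208141877,
    -2637030438667016673593814530791975811950810720760851073651120935125788120143105,
    -2571054617474393418900305628386639830548475899612044727799575786477380614708534,
    -2508023749576138475003920046960994109473931016228325243917698455300164027760807,
    -2447766865296673138942726152691504152543329009678941967356385926933020899790169]"

lemma CL_eq: "cauchy_dots 32 4 trial_coeffs (map (\<lambda>_. prec) trial_coeffs) = CL"
  by (simp only: trial_coeffs_def list.map cauchy_dots_eval cauchy_dot.simps prec_def CL_def int_eval)

definition GL :: "int list" where "GL = [6244708597629034532033352618582222785141373998178245727666015440609311614537027,
    3776874063230806302368717215356616521670166255000009374877536105086662093919416,
    2019252385652905077093636883171196421721880364332695350319136349299986387199338,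
    742920474551386128529569994691108138629044008307173452031043405892071488452837,
    -197725155119060037800758456864234406906347227483372120824192456790735621818862,
    -898644392991570042057224685734003094936252971666645421319370006075807651297480,
    -1424967644037498957233599645567556467568710779551447002500251185292214216106782,
    -1822009009950471602827879567739058196846000903814008096477833864407067996256351,
    -2121969029736807171503953183604977374342136288822994866107980360353882981405519,
    -2348150996760049367366865411705769697326124222557628725760741410750435037653551,
    -2517689572664988257545110682187739464527648243301545792095260561811494681529471,
    -2643360752844597700680190141768975189383064088050001999701121354466319980533759,
    -2734808771175829618241771972090489021655449085176772568331569718320619555774435,
    -2799393886001080004681556251970837926617211092839435912782934815727295945575064,
    -2842788312118428095890441643843862061057263400026612106781386423979660916620181,
    -2869401605980325142593350270028426859061449453110957048436074707147379808489889,
    -2882688555271909634567871044987393229538422793037502002453053255252440623498398,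
    -2885374850261427510135635926943636689757311558414314692330218063594506804546222,
    -2879624401624650268089563572356219510920620388112377815423294462547772221454544,
    -2867164703217336792615878042915376463590781019323931642812694109512651514114859,
    -2849381670071997866264021012166528524937260190068977210621413499430967969538656,
    -2827392024097741749593339122020908563384004788514401893124322762028913897137607,
    -2802098997885447871718388370264755778421498742563762214623234391969715182475726,
    -2774235527787511017360624581298199615247645784258710306038348757481839313626324,
    -2744397982829183632720880791242849441226683355679853445790998561590035086097404,
    -2713072676151780507840119058542962502183402904189128499807753720126281909355357,
    -2680656830778461192812119283817876317653780971154982230836379721453687849173511,
    -2647475254183293875752193676456579332962815665046007775809802244382038740981498]"

lemma GL_eq: "cauchy_dots 28 8 trial_coeffs (blist 0 colB2) = GL"
  by (simp only: trial_coeffs_def colB2_def blist.simps cauchy_dots_eval cauchy_dot.simps GL_def int_eval)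

lemma dot1: "dot_list trial_coeffs CL =
    2808944430105807929654509478931895229059235701088387665110958268035536201029938902376847502671015243477"
  by (simp only: trial_coeffs_def CL_def dot_list.simps list.sel int_eval)

lemma dot2: "dot_list trial_coeffs XL =
    -2808944430105807929164110905854809264802084627319592445103250909054129017779953877556141711334555329414"
  by (simp only: trial_coeffs_def XL_def dot_list.simps list.sel int_eval)

lemma dot3: "dot_list (pmul trial_coeffs (blist 0 colB2)) (tl (tl CL)) =
    323518368713697592271902631187846416329960435793457751221083545172840161929216169823134004830359407833623902013161790884352985497102721027621915826102416291052"
  by (simp only: trial_coeffs_def colB2_def blist.simps pmul.simps CL_def dot_list.simps list.sel int_eval)

lemma dot4: "dot_list (pmul trial_coeffs (blist 0 colB2)) (tl (tl XL)) =
    -323518368554982237910742087218537114687682694677844113167345843856992745543210119014616469578305406321666267790327621312161123646275293023361500348904624917006"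
  by (simp only: trial_coeffs_def colB2_def blist.simps pmul.simps XL_def dot_list.simps list.sel int_eval)

lemma dot5: "dot_list trial_coeffs YL =
    -824631194485449600863155104357799017603691682129663495037719397088361271549312630577304815875786407708"
  by (simp only: trial_coeffs_def YL_def dot_list.simps list.sel int_eval)

lemma dot6: "dot_list (pmul trial_coeffs (blist 0 colB2)) GL =
    766488502004317812298382155471273430031444181870029769019206376463022232077305839299066299236296882910207369449918418112509614439484041374147907397400525471159"
  by (simp only: trial_coeffs_def colB2_def blist.simps pmul.simps GL_def dot_list.simps list.sel int_eval)

lemma dot7: "dot_list (pmul trial_coeffs (blist 0 colB2)) (tl (tl YL)) =
    -191622125440617115650007444647453644728978116665838261984977688238390242002264040822375334881648574851389271471280141463288250532644318322438772367531408602254"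
  by (simp only: trial_coeffs_def colB2_def blist.simps pmul.simps YL_def dot_list.simps list.sel int_eval)

lemma dot8: "dot_list (pmul trial_coeffs (ulist 0 colY2)) (tl (tl (tl (tl CL)))) =
    95811062690077389210919098347608600592732241261204099678723086976722803122759549241682679713505014038496078481427901718431083968646715960600036076074900611742"
  by (simp only: trial_coeffs_def colY2_def prec_def ulist.simps pmul.simps CL_def dot_list.simps list.sel int_eval)

section \<open>Error propagation\<close>

text \<open>The factor 2 absorbs the error of the second factor into its bound.\<close>
lemma sum_mult_err:
  fixes F u u' w w' :: "nat \<Rightarrow> real"
  assumes P: "(\<Sum>k<n. \<bar>F k\<bar>) \<le> P"
    and u: "\<And>k. k < n \<Longrightarrow> \<bar>u' k - u k\<bar> \<le> e" "\<And>k. k < n \<Longrightarrow> \<bar>u k\<bar> \<le> M"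
    and w: "\<And>k. k < n \<Longrightarrow> \<bar>w' k - w k\<bar> \<le> e'" "\<And>k. k < n \<Longrightarrow> \<bar>w k\<bar> \<le> M'"
    and pos: "0 \<le> e" "0 \<le> M" "0 \<le> e'" "e' \<le> M'"
  shows "\<bar>(\<Sum>k<n. F k * (u' k * w' k)) - (\<Sum>k<n. F k * u k * w k)\<bar> \<le> P * (2 * e * M' + M * e')"
proof -
  have t: "\<bar>u' k * w' k - u k * w k\<bar> \<le> 2 * e * M' + M * e'" if k: "k < n" for k
  proof -
    have "\<bar>w' k\<bar> \<le> 2 * M'" using w[OF k] pos by linarith
    then have "\<bar>u' k - u k\<bar> * \<bar>w' k\<bar> \<le> e * (2 * M')" using u(1)[OF k] by (intro mult_mono) (use pos in auto)
    moreover have "\<bar>u k\<bar> * \<bar>w' k - w k\<bar> \<le> M * e'" using u(2)[OF k] w(1)[OF k] by (intro mult_mono) (use pos in auto)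
    moreover have "u' k * w' k - u k * w k = (u' k - u k) * w' k + u k * (w' k - w k)" by (simp add: algebra_simps)
    ultimately show ?thesis unfolding abs_mult[symmetric] by linarith
  qed
  have "\<bar>(\<Sum>k<n. F k * (u' k * w' k)) - (\<Sum>k<n. F k * u k * w k)\<bar> = \<bar>\<Sum>k<n. F k * (u' k * w' k - u k * w k)\<bar>"
    by (simp add: sum_subtractf[symmetric] algebra_simps)
  also have "\<dots> \<le> (\<Sum>k<n. \<bar>F k\<bar> * (2 * e * M' + M * e'))"
    by (rule order_trans[OF sum_abs]) (auto simp: abs_mult intro!: sum_mono mult_left_mono t)
  also have "\<dots> = (\<Sum>k<n. \<bar>F k\<bar>) * (2 * e * M' + M * e')" by (simp add: sum_distrib_right)
  also have "\<dots> \<le> P * (2 * e * M' + M * e')" using P pos by (intro mult_right_mono) auto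
  finally show ?thesis .
qed

lemma abs_sum_le:
  fixes F g :: "nat \<Rightarrow> real"
  assumes P: "(\<Sum>k<n. \<bar>F k\<bar>) \<le> P" and g: "\<And>k. k < n \<Longrightarrow> \<bar>g k\<bar> \<le> M" and M: "0 \<le> M"
  shows "\<bar>\<Sum>k<n. F k * g k\<bar> \<le> P * M"
proof -
  have "\<bar>\<Sum>k<n. F k * g k\<bar> \<le> (\<Sum>k<n. \<bar>F k\<bar> * M)"
    by (rule order_trans[OF sum_abs]) (auto simp: abs_mult intro!: sum_mono mult_left_mono g)
  also have "\<dots> = (\<Sum>k<n. \<bar>F k\<bar>) * M" by (simp add: sum_distrib_right)
  also have "\<dots> \<le> P * M" using P M by (intro mult_right_mono) auto
  finally show ?thesis .
qed

definition Fr :: "nat \<Rightarrow> real" where "Fr k = real_of_int (trial_coeffs ! k)"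
definition Phi :: real where "Phi = 5 * 10 ^ 24"
text \<open>A common error bound for table entries after division by the scale: 1000 units for the initial values and one
  further unit for each of the fewer than 100 recursion steps behind an entry.\<close>
definition ulp :: real where "ulp = 1100 / real_of_int prec"

lemma prec_pos: "0 < real_of_int prec" by (simp add: prec_def)

lemma ulp_pos: "0 \<le> ulp" "ulp \<le> 1" by (simp_all add: ulp_def prec_def)

lemma sum_Fr: "(\<Sum>k<28. \<bar>Fr k\<bar>) \<le> Phi"
  by (simp add: Fr_def Phi_def trial_coeffs_def eval_nat_numeral lessThan_Suc)

lemma length_trial_coeffs [simp]: "length trial_coeffs = 28" by (simp add: trial_coeffs_def)

lemma length_tables [simp]: "length colB1 = 30" "length colB2 = 30" "length colB3 = 30"
  "length colY1 = 30" "length colY2 = 30" "length colY3 = 30" "length XL = 30" "length YL = 30" "length CL = 32" "length GL = 28"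
  by (simp_all add: colB1_def colB2_def colB3_def colY1_def colY2_def colY3_def XL_def YL_def CL_def GL_def)

lemma column_apx:
  assumes c: "c = 4 \<or> c = 6" and r: "r \<in> {1..3}"
    and q: "q = [idiv (4 * prec) (r + c), base_value c (min r 1) (max r 1) 93 0 prec, base_value c (min r 2) (max r 2) 93 0 prec, base_value c (min r 3) (max r 3) 93 0 prec]"
    and l: "l < 30"
  shows "apx 1030 c r (int l) (table_column c r 30 0 q ! l)"
proof -
  have b: "apx 1000 c r s (base_value c (min r s) (max r s) 93 0 prec)" if s: "s \<in> {1..3}" for s
  proof (cases "r \<le> s")
    case True
    then show ?thesis using base_apx[OF c r s] by (simp add: min_def max_def)
  next
    case False
    then show ?thesis using base_apx[OF c s r] apx_sym[OF c, of r s] r s by (simp add: min_def max_def)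
  qed
  have 0: "apx 1000 c r 0 (idiv (4 * prec) (r + c))"
    using apx_0[OF c, of r] apx_sym[OF c, of r 0] r by (auto intro: apx_mono)
  have "apx (1000 + real l) c r (0 + int l) (table_column c r 30 0 q ! l)"
  proof (rule table_column_apx[OF c])
    fix i :: nat assume "i < 4"
    then consider "i = 0" | "i = 1" | "i = 2" | "i = 3" by linarith
    then show "apx 1000 c r (0 + int i) (q ! i)"
      by cases (use 0 b[of 1] b[of 2] b[of 3] in \<open>auto simp: q\<close>)
  qed (use r l q in auto)
  then show ?thesis using l by (auto intro: apx_mono)
qed

lemma columns:
  assumes "l < 30"
  shows "apx 1030 4 1 (int l) (colB1 ! l)" "apx 1030 4 2 (int l) (colB2 ! l)" "apx 1030 4 3 (int l) (colB3 ! l)"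
    "apx 1030 6 1 (int l) (colY1 ! l)" "apx 1030 6 2 (int l) (colY2 ! l)" "apx 1030 6 3 (int l) (colY3 ! l)"
  unfolding colB1_eq[symmetric] colB2_eq[symmetric] colB3_eq[symmetric] colY1_eq[symmetric] colY2_eq[symmetric] colY3_eq[symmetric]
  by (rule column_apx; use assms in simp)+

lemma apx_divide:
  assumes "\<bar>real_of_int X - real_of_int prec * g\<bar> \<le> E" "E \<le> 1100 * C"
  shows "\<bar>real_of_int X / real_of_int prec - g\<bar> \<le> C * ulp"
proof -
  have "real_of_int X / real_of_int prec - g = (real_of_int X - real_of_int prec * g) / real_of_int prec" using prec_pos by (simp add: field_simps)
  also have "\<bar>\<dots>\<bar> = \<bar>real_of_int X - real_of_int prec * g\<bar> / real_of_int prec" using prec_pos by (simp add: abs_divide)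
  also have "\<dots> \<le> 1100 * C / real_of_int prec" using assms prec_pos by (intro divide_right_mono) auto
  finally show ?thesis by (simp add: ulp_def mult.commute)
qed

abbreviation hat :: "int \<Rightarrow> real" where "hat X \<equiv> real_of_int X / real_of_int prec"

lemma B2_err: "k < 30 \<Longrightarrow> \<bar>hat (colB2 ! k) - qB 2 k\<bar> \<le> ulp"
  using columns(2)[of k] apx_divide[of "colB2 ! k" "qB 2 k" 1030 1] by (simp add: apx_def qB_def)

lemma Y2_err: "k < 30 \<Longrightarrow> \<bar>hat (colY2 ! k) - qY 2 k\<bar> \<le> ulp"
  using columns(5)[of k] apx_divide[of "colY2 ! k" "qY 2 k" 1030 1] by (simp add: apx_def qY_def)

lemma X_err: assumes "j < 30" shows "\<bar>hat (XL ! j) - sB Fr 28 j\<bar> \<le> Phi * ulp"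
proof (rule apx_divide)
  have "\<bar>row_sums 4 trial_coeffs colB1 colB2 colB3 ! j - prec * (\<Sum>l<28. real_of_int (trial_coeffs ! l) * Gq 4 (int j) (int l))\<bar> \<le> 1040 * (\<Sum>l<28. \<bar>real_of_int (trial_coeffs ! l)\<bar>)"
    by (rule row_sums_apx) (use assms columns in auto)
  also have "\<dots> \<le> 1040 * Phi" using sum_Fr unfolding Fr_def by (intro mult_left_mono) auto
  finally show "\<bar>real_of_int (XL ! j) - real_of_int prec * sB Fr 28 j\<bar> \<le> 1040 * Phi"
    unfolding XL_eq sB_def qB_def Fr_def .
qed (simp add: Phi_def)

lemma Y_err: assumes "j < 30" shows "\<bar>hat (YL ! j) - sY Fr 28 j\<bar> \<le> Phi * ulp"
proof (rule apx_divide)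
  have "\<bar>row_sums 6 trial_coeffs colY1 colY2 colY3 ! j - prec * (\<Sum>l<28. real_of_int (trial_coeffs ! l) * Gq 6 (int j) (int l))\<bar> \<le> 1040 * (\<Sum>l<28. \<bar>real_of_int (trial_coeffs ! l)\<bar>)"
    by (rule row_sums_apx) (use assms columns in auto)
  also have "\<dots> \<le> 1040 * Phi" using sum_Fr unfolding Fr_def by (intro mult_left_mono) auto
  finally show "\<bar>real_of_int (YL ! j) - real_of_int prec * sY Fr 28 j\<bar> \<le> 1040 * Phi"
    unfolding YL_eq sY_def qY_def Fr_def .
qed (simp add: Phi_def)

lemma C_err: assumes "j < 32" shows "\<bar>hat (CL ! j) - sC Fr 28 j\<bar> \<le> Phi * ulp"
proof (rule apx_divide)
  have "\<bar>real_of_int (CL ! j) - (\<Sum>i<28. real_of_int (trial_coeffs ! i) * (4 * real_of_int prec / (real_of_int (4 + int j) + int i)))\<bar> \<le> (\<Sum>i<28. \<bar>real_of_int (trial_coeffs ! i)\<bar>)"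
    using cauchy_dot_apx[of "4 + int j" trial_coeffs "map (\<lambda>_. prec) trial_coeffs"] assms by (simp add: CL_eq[symmetric] cauchy_dots_nth)
  also have "\<dots> \<le> Phi" using sum_Fr by (simp add: Fr_def)
  also have "(\<Sum>i<28. real_of_int (trial_coeffs ! i) * (4 * real_of_int prec / (real_of_int (4 + int j) + int i))) = real_of_int prec * sC Fr 28 j"
    unfolding sC_def sum_distrib_left by (intro sum.cong refl) (simp add: Fr_def add_ac)
  finally show "\<bar>real_of_int (CL ! j) - real_of_int prec * sC Fr 28 j\<bar> \<le> Phi" .
qed (simp add: Phi_def)

lemma bt_err: assumes "k < 28" shows "\<bar>hat (blist 0 colB2 ! k) / 2 - bt k\<bar> \<le> 17 * ulp"
proof -
  have "hat (blist 0 colB2 ! k) / 2 - bt k = (k + 6) / 2 * (hat (colB2 ! k) - qB 2 k)"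
    using assms by (simp add: blist_nth bt_def right_diff_distrib)
  also have "\<bar>\<dots>\<bar> = (k + 6) / 2 * \<bar>hat (colB2 ! k) - qB 2 k\<bar>" by (simp add: abs_mult)
  also have "\<dots> \<le> 17 * ulp" using assms B2_err[of k] by (intro mult_mono) auto
  finally show ?thesis .
qed

lemma wu_err: assumes "k < 28" shows "\<bar>hat (ulist 0 colY2 ! k) - wu k\<bar> \<le> 35 * ulp"
proof -
  have "hat (ulist 0 colY2 ! k) - wu k = (k + 8) * (hat (colY2 ! k) - qY 2 k)"
    using assms prec_pos by (simp add: ulist_nth wu_def right_diff_distrib diff_divide_distrib)
  also have "\<bar>\<dots>\<bar> = (k + 8) * \<bar>hat (colY2 ! k) - qY 2 k\<bar>" by (simp add: abs_mult)
  also have "\<dots> \<le> 35 * ulp" using assms Y2_err[of k] by (intro mult_mono) auto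
  finally show ?thesis .
qed

lemma bt_le: assumes "k < 28" shows "\<bar>bt k\<bar> \<le> 17"
proof -
  have "bt k \<le> 17 * 1" unfolding bt_def using assms qB_bounds[of 2 k] by (intro mult_mono) auto
  moreover have "0 \<le> bt k" unfolding bt_def using qB_bounds[of 2 k] by simp
  ultimately show ?thesis by simp
qed

lemma wu_le: assumes "k < 28" shows "\<bar>wu k\<bar> \<le> 35"
proof -
  have "(real k + 8) * qY 2 k \<le> 35 * 1" using assms qY_bounds[of 2 k] by (intro mult_mono) auto
  moreover have "0 \<le> (real k + 8) * qY 2 k" using qY_bounds[of 2 k] by simp
  ultimately show ?thesis unfolding wu_def by linarith
qed

lemma sums_le: "\<bar>sC Fr 28 j\<bar> \<le> Phi" "\<bar>sB Fr 28 j\<bar> \<le> Phi" "\<bar>sY Fr 28 j\<bar> \<le> Phi" "\<bar>sG Fr 28 j\<bar> \<le> 9 * Phi"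
proof -
  show "\<bar>sB Fr 28 j\<bar> \<le> Phi" unfolding sB_def
    using abs_sum_le[OF sum_Fr, of "qB j" 1] qB_bounds by simp
  show "\<bar>sY Fr 28 j\<bar> \<le> Phi" unfolding sY_def
    using abs_sum_le[OF sum_Fr, of "qY j" 1] qY_bounds by simp
  show "\<bar>sC Fr 28 j\<bar> \<le> Phi" unfolding sC_def
    using abs_sum_le[OF sum_Fr, of "\<lambda>l. 4 / (j + l + 4)" 1] by (simp add: divide_le_eq)
  have "\<bar>4 * bt l / (j + l + 8)\<bar> \<le> 9" if "l < 28" for l
  proof -
    have "\<bar>4 * bt l / (j + l + 8)\<bar> = \<bar>bt l\<bar> * (4 / (j + l + 8))" by (simp add: abs_mult)
    also have "\<dots> \<le> 17 * (1/2)" using bt_le[OF that] by (intro mult_mono) (auto simp: divide_le_eq)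
    finally show ?thesis by simp
  qed
  then show "\<bar>sG Fr 28 j\<bar> \<le> 9 * Phi" unfolding sG_def
    using abs_sum_le[OF sum_Fr, of "\<lambda>l. 4 * bt l / (j + l + 8)" 9] by (simp add: mult.commute)
qed

lemma G_err: assumes "k < 28" shows "\<bar>hat (GL ! k) / 2 - sG Fr 28 k\<bar> \<le> 9 * (Phi * ulp)"
proof -
  let ?b = "\<lambda>i. hat (blist 0 colB2 ! i) / 2"
  let ?G = "\<Sum>i<28. Fr i * (4 * ?b i / (k + i + 8))"
  have "\<bar>real_of_int (GL ! k) - (\<Sum>i<28. real_of_int (trial_coeffs ! i) * (4 * real_of_int (blist 0 colB2 ! i) / (real_of_int (8 + int k) + int i)))\<bar> \<le> (\<Sum>i<28. \<bar>real_of_int (trial_coeffs ! i)\<bar>)"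
    using cauchy_dot_apx[of "8 + int k" trial_coeffs "blist 0 colB2"] assms by (simp add: GL_eq[symmetric] cauchy_dots_nth)
  also have "\<dots> \<le> Phi" using sum_Fr by (simp add: Fr_def)
  also have "(\<Sum>i<28. real_of_int (trial_coeffs ! i) * (4 * real_of_int (blist 0 colB2 ! i) / (real_of_int (8 + int k) + int i))) = real_of_int prec * (2 * ?G)"
    unfolding sum_distrib_left using prec_pos by (intro sum.cong refl) (simp add: Fr_def add_ac)
  finally have 1: "\<bar>hat (GL ! k) - 2 * ?G\<bar> \<le> Phi * ulp" by (rule apx_divide) (simp add: Phi_def)
  have 2: "\<bar>?G - sG Fr 28 k\<bar> \<le> 8.5 * (Phi * ulp)"
  proof -
    have "?G - sG Fr 28 k = (\<Sum>i<28. Fr i * ((?b i - bt i) * (4 / (k + i + 8))))"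
      unfolding sG_def sum_subtractf[symmetric] by (intro sum.cong refl) (simp add: algebra_simps diff_divide_distrib)
    also have "\<bar>\<dots>\<bar> \<le> Phi * (17 * ulp * (1/2))"
    proof (rule abs_sum_le[OF sum_Fr])
      fix i :: nat assume "i < 28"
      then show "\<bar>(?b i - bt i) * (4 / (k + i + 8))\<bar> \<le> 17 * ulp * (1/2)"
        unfolding abs_mult using bt_err[of i] ulp_pos by (intro mult_mono) (auto simp: divide_le_eq)
    qed (use ulp_pos in auto)
    finally show ?thesis by (simp add: mult_ac)
  qed
  have "\<bar>h / 2 - s\<bar> \<le> 9 * x" if "\<bar>h - 2 * g\<bar> \<le> x" "\<bar>g - s\<bar> \<le> 8.5 * x" for h g s x :: real
    using that by linarith
  from this[OF 1 2] show ?thesis .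
qed

section \<open>The moments and their integer approximations\<close>

definition A0 :: real where "A0 = ip (trial Fr 28) (trial Fr 28)"
definition A1 :: real where "A1 = ip (trial Fr 28) (Kstar (trial Fr 28))"
definition A2 :: real where "A2 = ip (Kstar (trial Fr 28)) (Kstar (trial Fr 28))"

text \<open>All error bounds for the moments are multiples of this one quantity.\<close>
definition err_unit :: real where "err_unit = Phi * (Phi * ulp)"

lemma err_unit_le: "err_unit \<le> 3 / 10000" by (simp add: err_unit_def Phi_def ulp_def prec_def)

lemma Phi_ulp: "0 \<le> Phi" "0 \<le> Phi * ulp" "Phi * ulp \<le> Phi"  "9 * (Phi * ulp) \<le> 9 * Phi"
  using ulp_pos by (auto simp: Phi_def)

lemma dot_hat1:
  assumes "length ys \<ge> 28"
  shows "(\<Sum>k<28. Fr k * (1 * hat (ys ! k))) = hat (dot_list trial_coeffs ys)"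
  using assms by (simp add: dot_list_sum Fr_def sum_divide_distrib)

lemma dot_hat2:
  assumes "length xs \<ge> 28" "length ys \<ge> 28"
  shows "(\<Sum>k<28. Fr k * (hat (xs ! k) * hat (ys ! k))) = hat (dot_list (pmul trial_coeffs xs) ys) / real_of_int prec"
  using assms by (simp add: dot_list_sum Fr_def sum_divide_distrib pmul_nth min_def mult_ac)

lemma dot_hat3:
  assumes "length xs \<ge> 28" "length ys \<ge> 28"
  shows "(\<Sum>k<28. Fr k * (hat (xs ! k) / 2 * hat (ys ! k))) = hat (dot_list (pmul trial_coeffs xs) ys) / real_of_int prec / 2"
  unfolding dot_hat2[OF assms, symmetric] sum_divide_distrib by (simp add: mult_ac)

lemma abs_scale: "0 \<le> c \<Longrightarrow> \<bar>c * a - c * b\<bar> = c * \<bar>a - b\<bar>" for a b c :: real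
  by (simp add: right_diff_distrib[symmetric] abs_mult)

definition M0 :: real where "M0 = 2 * (hat (dot_list trial_coeffs CL) + hat (dot_list trial_coeffs XL))"

definition M1 :: real where
  "M1 = (2 * hat (dot_list (pmul trial_coeffs (blist 0 colB2)) (tl (tl CL))) + hat (dot_list (pmul trial_coeffs (blist 0 colB2)) (tl (tl XL)))) / real_of_int prec
     + 4 * hat (dot_list trial_coeffs YL)"

definition M2 :: real where
  "M2 = (hat (dot_list (pmul trial_coeffs (blist 0 colB2)) GL) + 8 * hat (dot_list (pmul trial_coeffs (blist 0 colB2)) (tl (tl YL)))
     + 8 * hat (dot_list (pmul trial_coeffs (ulist 0 colY2)) (tl (tl (tl (tl CL)))))) / (2 * real_of_int prec) + 32 * hat (colB2 ! 2) * (hat (CL ! 0))\<^sup>2"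

lemma A0_err: "\<bar>A0 - M0\<bar> \<le> 4 * err_unit"
proof -
  have "\<bar>(\<Sum>k<28. Fr k * (1 * hat (CL ! k))) - (\<Sum>k<28. Fr k * 1 * sC Fr 28 k)\<bar> \<le> Phi * (2 * 0 * Phi + 1 * (Phi * ulp))"
    by (intro sum_mult_err sum_Fr C_err sums_le Phi_ulp) auto
  moreover have "\<bar>(\<Sum>k<28. Fr k * (1 * hat (XL ! k))) - (\<Sum>k<28. Fr k * 1 * sB Fr 28 k)\<bar> \<le> Phi * (2 * 0 * Phi + 1 * (Phi * ulp))"
    by (intro sum_mult_err sum_Fr X_err sums_le Phi_ulp) auto
  ultimately show ?thesis unfolding A0_def M0_def norm_trial err_unit_def
    by (simp only: dot_hat1 length_tables) simp
qed

lemma A1_err: "\<bar>A1 - M1\<bar> \<le> 310 * err_unit"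
proof -
  let ?b = "\<lambda>k. hat (blist 0 colB2 ! k) / 2"
  have 1: "\<bar>(\<Sum>k<28. Fr k * (?b k * hat (tl (tl CL) ! k))) - (\<Sum>k<28. Fr k * bt k * sC Fr 28 (k + 2))\<bar> \<le> Phi * (2 * (17 * ulp) * Phi + 17 * (Phi * ulp))"
    using C_err by (intro sum_mult_err sum_Fr bt_err bt_le sums_le Phi_ulp) (auto simp: nth_tl ulp_pos)
  have 2: "\<bar>(\<Sum>k<28. Fr k * (?b k * hat (tl (tl XL) ! k))) - (\<Sum>k<28. Fr k * bt k * sB Fr 28 (k + 2))\<bar> \<le> Phi * (2 * (17 * ulp) * Phi + 17 * (Phi * ulp))"
    using X_err by (intro sum_mult_err sum_Fr bt_err bt_le sums_le Phi_ulp) (auto simp: nth_tl ulp_pos)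
  have 3: "\<bar>(\<Sum>k<28. Fr k * (1 * hat (YL ! k))) - (\<Sum>k<28. Fr k * 1 * sY Fr 28 k)\<bar> \<le> Phi * (2 * 0 * Phi + 1 * (Phi * ulp))"
    by (intro sum_mult_err sum_Fr Y_err sums_le Phi_ulp) auto
  have l: "28 \<le> length (tl (tl CL))" "28 \<le> length (tl (tl XL))" "28 \<le> length YL" "28 \<le> length (blist 0 colB2)" by simp_all
  have d: "\<bar>2 * (2 * x + y + 2 * z) - ((2 * x' + y') / p + 4 * z')\<bar> \<le> 310 * q"
    if "\<bar>x' / p / 2 - x\<bar> \<le> 51 * q" "\<bar>y' / p / 2 - y\<bar> \<le> 51 * q" "\<bar>z' - z\<bar> \<le> q" for x y z x' y' z' p q :: real
  proof -
    define X Y where XY: "X = x' / p" "Y = y' / p"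
    have *: "(2 * x' + y') / p = 2 * X + Y" by (simp add: XY add_divide_distrib)
    show ?thesis unfolding * using that[folded XY] unfolding abs_le_iff by argo
  qed
  have q: "Phi * (2 * (17 * ulp) * Phi + 17 * (Phi * ulp)) = 51 * err_unit" "Phi * (2 * 0 * Phi + 1 * (Phi * ulp)) = err_unit"
    by (simp_all add: err_unit_def algebra_simps)
  show ?thesis unfolding A1_def M1_def form_trial
    using 1 2 3 unfolding dot_hat3[OF l(4) l(1)] dot_hat3[OF l(4) l(2)] dot_hat1[OF l(3)] q mult_1_right by (rule d)
qed

lemma A2_err: "\<bar>A2 - M2\<bar> \<le> 2000 * err_unit"
proof -
  let ?b = "\<lambda>k. hat (blist 0 colB2 ! k) / 2"
  have 1: "\<bar>(\<Sum>k<28. Fr k * (?b k * (hat (GL ! k) / 2))) - (\<Sum>k<28. Fr k * bt k * sG Fr 28 k)\<bar> \<le> Phi * (2 * (17 * ulp) * (9 * Phi) + 17 * (9 * (Phi * ulp)))"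
    using G_err by (intro sum_mult_err sum_Fr bt_err bt_le sums_le Phi_ulp) (auto simp: ulp_pos Phi_ulp)
  have 2: "\<bar>(\<Sum>k<28. Fr k * (?b k * hat (tl (tl YL) ! k))) - (\<Sum>k<28. Fr k * bt k * sY Fr 28 (k + 2))\<bar> \<le> Phi * (2 * (17 * ulp) * Phi + 17 * (Phi * ulp))"
    using Y_err by (intro sum_mult_err sum_Fr bt_err bt_le sums_le Phi_ulp) (auto simp: nth_tl ulp_pos)
  have 3: "\<bar>(\<Sum>k<28. Fr k * (hat (ulist 0 colY2 ! k) * hat (tl (tl (tl (tl CL))) ! k))) - (\<Sum>k<28. Fr k * wu k * sC Fr 28 (k + 4))\<bar> \<le> Phi * (2 * (35 * ulp) * Phi + 35 * (Phi * ulp))"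
    using C_err by (intro sum_mult_err sum_Fr wu_err wu_le sums_le Phi_ulp) (auto simp: nth_tl ulp_pos numeral_eq_Suc)
  have 4: "\<bar>hat (colB2 ! 2) * (hat (CL ! 0))\<^sup>2 - qB 2 2 * (sC Fr 28 0)\<^sup>2\<bar> \<le> 7 * err_unit"
  proof -
    define c c' b b' where "c = sC Fr 28 0" "c' = hat (CL ! 0)" "b = qB 2 2" "b' = hat (colB2 ! 2)"
    note ds = this
    have c: "\<bar>c' - c\<bar> \<le> Phi * ulp" "\<bar>c\<bar> \<le> Phi" using C_err[of 0] sums_le(1)[of 0] by (simp_all add: ds)
    then have c': "\<bar>c'\<bar> \<le> 2 * Phi" using Phi_ulp by linarith
    have b: "\<bar>b' - b\<bar> \<le> ulp" "\<bar>b\<bar> \<le> 1" using B2_err[of 2] qB_bounds[of 2 2] by (simp_all add: ds)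
    have "\<bar>b' - b\<bar> * (\<bar>c'\<bar> * \<bar>c'\<bar>) \<le> ulp * (2 * Phi * (2 * Phi))" using b c' Phi_ulp ulp_pos by (intro mult_mono) auto
    moreover have "\<bar>b\<bar> * (\<bar>c' - c\<bar> * \<bar>c' + c\<bar>) \<le> 1 * (Phi * ulp * (3 * Phi))" using b c c' Phi_ulp ulp_pos by (intro mult_mono) auto
    moreover have "b' * c'\<^sup>2 - b * c\<^sup>2 = (b' - b) * (c' * c') + b * ((c' - c) * (c' + c))" by (simp add: algebra_simps power2_eq_square)
    ultimately have "\<bar>b' * c'\<^sup>2 - b * c\<^sup>2\<bar> \<le> ulp * (2 * Phi * (2 * Phi)) + 1 * (Phi * ulp * (3 * Phi))"
      unfolding abs_mult[symmetric] by linarith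
    also have "\<dots> = 7 * err_unit" by (simp add: err_unit_def)
    finally show ?thesis by (simp add: ds)
  qed
  have l: "28 \<le> length (tl (tl YL))" "28 \<le> length (tl (tl (tl (tl CL))))" "28 \<le> length (blist 0 colB2)" "28 \<le> length GL" by simp_all
  have h4: "(\<Sum>k<28. Fr k * (?b k * (hat (GL ! k) / 2))) = hat (dot_list (pmul trial_coeffs (blist 0 colB2)) GL) / real_of_int prec / 4"
  proof -
    have "(\<Sum>k<28. Fr k * (?b k * (hat (GL ! k) / 2))) = (\<Sum>k<28. Fr k * (?b k * hat (GL ! k))) / 2"
      unfolding sum_divide_distrib by simp
    then show ?thesis unfolding dot_hat3[OF l(3,4)] by simp
  qed
  have hu: "(\<Sum>k<28. Fr k * (hat (ulist 0 colY2 ! k) * hat (ys ! k))) = hat (dot_list (pmul trial_coeffs (ulist 0 colY2)) ys) / real_of_int prec" if "28 \<le> length ys" for ys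
    using dot_hat2[of "ulist 0 colY2" ys] that by simp
  have d: "\<bar>2 * (x + 4 * y + 2 * z) + 8 * b * (2 * c)\<^sup>2 - ((x' + 8 * y' + 8 * z') / (2 * p) + 32 * b' * c'\<^sup>2)\<bar> \<le> 2000 * q"
    if "\<bar>x' / p / 4 - x\<bar> \<le> 459 * q" "\<bar>y' / p / 2 - y\<bar> \<le> 51 * q" "\<bar>z' / p - z\<bar> \<le> 105 * q" "\<bar>b' * c'\<^sup>2 - b * c\<^sup>2\<bar> \<le> 7 * q" for x y z x' y' z' p q b c b' c' :: real
  proof -
    define X Y Z u v where XY: "X = x' / p" "Y = y' / p" "Z = z' / p" "u = b' * c'\<^sup>2" "v = b * c\<^sup>2"
    have *: "(x' + 8 * y' + 8 * z') / (2 * p) = X / 2 + 4 * Y + 4 * Z"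
      by (simp add: XY add_divide_distrib)
    have **: "8 * b * (2 * c)\<^sup>2 = 32 * v" "32 * b' * c'\<^sup>2 = 32 * u" by (simp_all add: XY power2_eq_square)
    show ?thesis unfolding * ** using that[folded XY] unfolding abs_le_iff by argo
  qed
  have q: "Phi * (2 * (17 * ulp) * (9 * Phi) + 17 * (9 * (Phi * ulp))) = 459 * err_unit"
     "Phi * (2 * (17 * ulp) * Phi + 17 * (Phi * ulp)) = 51 * err_unit" "Phi * (2 * (35 * ulp) * Phi + 35 * (Phi * ulp)) = 105 * err_unit"
    by (simp_all add: err_unit_def algebra_simps)
  show ?thesis unfolding A2_def M2_def square_trial
    using 1 2 3 4 unfolding h4 dot_hat3[OF l(3) l(1)] hu[OF l(2)] q by (rule d)
qed

section \<open>The eigenvalue bounds\<close>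

text \<open>The Rayleigh quotient of the trial function, lowered by about one unit in the 27th decimal so that the defect \<open>A1 - rho0 A0\<close> stays
  safely positive. It lies above the required lower bound.\<close>
definition rho0 :: real where "rho0 = 2682918382150264832337066719 / 10 ^ 27"

lemma rho0_nonneg: "0 \<le> rho0" "0 \<le> 2 * rho0" "0 \<le> rho0\<^sup>2" by (simp_all add: rho0_def)

lemma A0_bounds: "10000000000000031190598097124 \<le> A0" "A0 \<le> 10000000000000031190598097125"
proof -
  have "10000000000000031190598097124 + 1/2 \<le> M0"
    "M0 \<le> 10000000000000031190598097125 - 1/10"
    by (simp_all only: M0_def M1_def dot1 dot2 prec_def) simp_all
  with A0_err err_unit_le show "10000000000000031190598097124 \<le> A0" "A0 \<le> 10000000000000031190598097125" by (simp_all add: abs_le_iff)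
qed

lemma A1_defect: "10 \<le> A1 - rho0 * A0" "A1 - rho0 * A0 \<le> 12"
proof -
  have "10.9 \<le> M1 - rho0 * M0" "M1 - rho0 * M0 \<le> 11.1"
    by (simp_all only: M0_def M1_def dot1 dot2 dot3 dot4 dot5 prec_def rho0_def) simp_all
  moreover have "rho0 * \<bar>A0 - M0\<bar> \<le> 3 * (4 * err_unit)" using A0_err by (intro mult_mono) (auto simp: rho0_def)
  then have "\<bar>rho0 * A0 - rho0 * M0\<bar> \<le> 12 * err_unit" unfolding abs_scale[OF rho0_nonneg(1)] by simp
  ultimately have "10 \<le> A1 - rho0 * A0 \<and> A1 - rho0 * A0 \<le> 12" using A1_err err_unit_le unfolding abs_le_iff by argo
  then show "10 \<le> A1 - rho0 * A0" "A1 - rho0 * A0 \<le> 12" by simp_all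
qed

lemma residual_bound: "A2 - 2 * rho0 * A1 + rho0\<^sup>2 * A0 \<le> 29"
proof -
  \<comment> \<open>The third Beta entry is \<open>pi / 8\<close> in units of the scale.\<close>
  have B: "colB2 ! 2 = 38515813862747145629679947977008337678639552471074394008"
    "CL ! 0 = 4882670650984700815837901488604586434449704580781213437987989021897944" by (simp_all add: colB2_def CL_def)
  have "M2 - 2 * rho0 * M1 + rho0\<^sup>2 * M0 \<le> 26.8"
    unfolding M0_def M1_def M2_def B by (simp only: dot1 dot2 dot3 dot4 dot5 dot6 dot7 dot8 prec_def rho0_def) (simp add: power2_eq_square)
  moreover have "2 * rho0 * \<bar>A1 - M1\<bar> \<le> 6 * (310 * err_unit)" using A1_err by (intro mult_mono) (auto simp: rho0_def)
  then have "\<bar>2 * rho0 * A1 - 2 * rho0 * M1\<bar> \<le> 1860 * err_unit" unfolding abs_scale[OF rho0_nonneg(2)] by simp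
  moreover have "rho0\<^sup>2 * \<bar>A0 - M0\<bar> \<le> 9 * (4 * err_unit)" using A0_err by (intro mult_mono) (auto simp: rho0_def power2_eq_square)
  then have "\<bar>rho0\<^sup>2 * A0 - rho0\<^sup>2 * M0\<bar> \<le> 36 * err_unit" unfolding abs_scale[OF rho0_nonneg(3)] by simp
  ultimately show ?thesis using A2_err err_unit_le unfolding abs_le_iff by argo
qed

text \<open>With \<open>x = (lam - rho0) A0\<close>, the Temple inequality reads
  \<open>(x - d) (rho0 - cR) \<le> 29 + small + (lam - rho0) x\<close>. The a priori bound \<open>lam \<le> 2 sqrt 2\<close> makes the last term at most
  \<open>0.146 x\<close>, and \<open>rho0 - cR \<ge> 0.85\<close> then forces \<open>x \<le> 59\<close>, while \<open>A0\<close> exceeds \<open>10 ^ 28\<close>.\<close>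
lemma lambda_star_bounds: "rho0 \<le> lambda_star" "lambda_star \<le> rho0 + 6 / 10 ^ 27"
proof -
  obtain lam phi t where "perron lam phi t" using perron_exists by blast
  then interpret perron lam phi t .
  have A0: "0 < A0" using A0_bounds by simp
  have cR: "cR < rho0" "17/20 \<le> rho0 - cR" using cR_bounds by (simp_all add: rho0_def)
  have "sqrt 2 \<le> 1.4143" by (rule real_le_lsqrt) (auto simp: power2_eq_square)
  then have apriori: "lam - rho0 \<le> 73/500" using lam_le by (simp add: rho0_def)
  define s where "s = sqrt (29 :: real)"
  have s: "0 \<le> s" "s\<^sup>2 = 29" "s \<le> 6" unfolding s_def by (auto intro!: real_le_lsqrt)
  have T: "0 \<le> lam - rho0" "(lam - rho0) * A0 * (rho0 - cR) \<le> (A1 - rho0 * A0) * (rho0 - cR) + s\<^sup>2 + (2 * s + (lam - rho0) * sqrt A0) * ((lam - rho0) * sqrt A0)"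
    using temple[OF bm_trial A0 A0_def[symmetric] _ _ _ s(1) cR(1), of "A1 - rho0 * A0"] A1_defect(1) residual_bound s(2)
    unfolding A1_def A2_def by simp_all
  define x where "x = (lam - rho0) * A0"
  have x0: "0 \<le> x" using T(1) A0 by (simp add: x_def)
  have r: "sqrt A0 * sqrt A0 = A0" using A0 by simp
  have rt: "10 ^ 14 \<le> sqrt A0" using A0_bounds by (intro real_le_rsqrt) simp
  have small: "2 * s * ((lam - rho0) * sqrt A0) \<le> x / 1000"
  proof -
    have "2 * s \<le> sqrt A0 / 1000" using s(3) rt by simp
    then have "2 * s * ((lam - rho0) * sqrt A0) \<le> sqrt A0 / 1000 * ((lam - rho0) * sqrt A0)"
      using T(1) A0 by (intro mult_right_mono) auto
    also have "\<dots> = x / 1000" using r by (simp add: x_def mult_ac)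
    finally show ?thesis .
  qed
  have quad: "(lam - rho0) * sqrt A0 * ((lam - rho0) * sqrt A0) \<le> 73/500 * x"
  proof -
    have "(lam - rho0) * sqrt A0 * ((lam - rho0) * sqrt A0) = (lam - rho0) * x"
      using r by (simp add: x_def mult_ac)
    also have "\<dots> \<le> 73/500 * x" using apriori x0 by (rule mult_right_mono)
    finally show ?thesis .
  qed
  have "x \<le> 59"
  proof (cases "x \<le> 12")
    case False
    have "(x - 12) * (17/20) \<le> (x - (A1 - rho0 * A0)) * (rho0 - cR)"
      using False A1_defect(2) cR(2) by (intro mult_mono) auto
    also have "\<dots> \<le> 29 + (2 * s + (lam - rho0) * sqrt A0) * ((lam - rho0) * sqrt A0)"
      using T(2) s(2) by (simp add: x_def left_diff_distrib)
    also have "\<dots> \<le> 29 + x / 1000 + 73/500 * x" using small quad by (simp add: distrib_right)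
    finally show ?thesis by simp
  qed simp
  moreover have "(lam - rho0) * 10 ^ 28 \<le> x" unfolding x_def using T(1) A0_bounds by (intro mult_left_mono) auto
  ultimately show "rho0 \<le> lambda_star" "lambda_star \<le> rho0 + 6 / 10 ^ 27" using T(1) unfolding lambda_star_eq by simp_all
qed

theorem theorem5p4:
  shows "2.682918382150264832337066716763 < lambda_star \<and>
         lambda_star < 2.682918382150264832337066725454 \<and>
         1.341459191075132416168533358381 < C_2_0 \<and>
         C_2_0 < 1.341459191075132416168533362727 \<and>
         of_int (round (lambda_star * 10 ^ 25)) / 10 ^ 25 = (2.6829183821502648323370667 :: real)"
proof -
  have l: "2.682918382150264832337066716763 < lambda_star" and u: "lambda_star < 2.682918382150264832337066725454"
    using lambda_star_bounds by (simp_all add: rho0_def)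
  have "round (lambda_star * 10 ^ 25) = 26829183821502648323370667"
    unfolding round_def using l u by (intro floor_unique) simp_all
  then show ?thesis using l u by (simp add: C_2_0_def)
qed

end
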